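(* Let $A,B$ be two normal multiplicity-free elements in $\mathbb{K}(C(S^1))$ with $\mathrm{Eig}(A(t))=\mathrm{Eig}(B(t))\subset\mathbb{C}\setminus\{0\}$ for all $t\in S^1$. If $A$ and $B$ satisfy condition (1), then $A$ and $B$ are approximately unitarily equivalent.
   Context: $H$ is a separable infinite-dimensional complex Hilbert space with a fixed orthonormal basis. For compact $X$, $\mathbb{K}(C(X))$ is the ring of compact operators over $X$, i.e. norm limits of (finite) matrices with entries in $C(X)$, viewed as norm-continuous families $x\mapsto A(x)$ of compact operators on $H$. Normality is pointwise. $\mathrm{Eig}(A(x))$ is the set of eigenvalues of $A(x)$; $A$ is multiplicity-free if for every $x$ every eigenvalue of $A(x)$ has multiplicity one. Condition (1): $\bar A\in\mathbb{K}(C[0,1])$ satisfies condition (1) if for every $x_0\in[0,1]$ and every $\mu\in\mathrm{Eig}(\bar A(x_0))$ there is $\lambda\in C[0,1]$ with $\lambda(x_0)=\mu$ and $\lambda(x)\in\mathrm{Eig}(\bar A(x))$ for all $x\in[0,1]$. $A\in\mathbb{K}(C(S^1))$ satisfies condition (1) if $\bar A(x)=A(e^{2\pi xi})$, $x\in[0,1]$, does. $A,B\in\mathbb{K}(C(X))$ are approximately unitarily equivalent if for every $\epsilon>0$ there is a norm-continuous unitary $U\in I+\mathbb{K}(C(X))$ with $\|B(x)-U(x)^*A(x)U(x)\|<\epsilon$ for all $x\in X$. *)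

theory Defs
  imports "HOL-Analysis.Analysis"
begin

section \<open>Complex Hilbert spaces\<close>

text \<open>The scalar product is conjugate-linear in its first argument. Its real part is the
  scalar product of the underlying real Hilbert space, so that \<open>norm\<close> is the
  Hilbert space norm; positive definiteness and completeness are inherited from the superclasses.\<close>

class complex_hilbert_space = real_inner + complete_space +
  fixes scaleC :: "complex \<Rightarrow> 'a \<Rightarrow> 'a" (infixr "*\<^sub>C" 75)
    and cinner :: "'a \<Rightarrow> 'a \<Rightarrow> complex"
  assumes scaleC_add_right: "c *\<^sub>C (x + y) = c *\<^sub>C x + c *\<^sub>C y"
    and scaleC_add_left: "(c + d) *\<^sub>C x = c *\<^sub>C x + d *\<^sub>C x"
    and scaleC_scaleC: "c *\<^sub>C d *\<^sub>C x = (c * d) *\<^sub>C x"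
    and scaleC_of_real: "complex_of_real r *\<^sub>C x = r *\<^sub>R x"
    and cinner_commute: "cinner x y = cnj (cinner y x)"
    and cinner_add_right: "cinner x (y + z) = cinner x y + cinner x z"
    and cinner_scaleC_right: "cinner x (c *\<^sub>C y) = c * cinner x y"
    and Re_cinner: "Re (cinner x y) = inner x y"

global_interpretation complex_vector:
  vector_space "scaleC :: complex \<Rightarrow> 'a \<Rightarrow> 'a::complex_hilbert_space"
  defines cspan = complex_vector.span
    and cdim = complex_vector.dim
proof
  show "1 *\<^sub>C x = x" for x :: 'a
    using scaleC_of_real[of 1 x] by simp
qed (simp_all add: scaleC_add_right scaleC_add_left scaleC_scaleC)

lemma norm_scaleC: "norm (c *\<^sub>C x) = cmod c * norm (x :: 'a::complex_hilbert_space)"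
proof -
  have "cinner (c *\<^sub>C x) x = cnj c * cinner x x"
    using cinner_commute[of "c *\<^sub>C x" x] cinner_commute[of x x, symmetric]
    by (simp only: cinner_scaleC_right complex_cnj_mult)
  then have "cinner (c *\<^sub>C x) (c *\<^sub>C x) = of_real ((cmod c)\<^sup>2) * cinner x x"
    by (simp only: cinner_scaleC_right complex_norm_square mult.assoc)
  then have "inner (c *\<^sub>C x) (c *\<^sub>C x) = (cmod c)\<^sup>2 * inner x x"
    unfolding Re_cinner[symmetric] by (simp del: of_real_power)
  then show ?thesis
    by (simp add: norm_eq_sqrt_inner real_sqrt_mult)
qed

lemma cmod_cinner_le: "cmod (cinner x y) \<le> norm x * norm (y :: 'a::complex_hilbert_space)"
proof (cases "cinner x y = 0")
  case False
  define c where "c = cnj (sgn (cinner x y))"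
  have "c * cinner x y = of_real (cmod (cinner x y))"
    using False complex_norm_square[of "cinner x y"]
    by (simp add: c_def sgn_eq field_simps power2_eq_square)
  then have "cmod (cinner x y) = inner x (c *\<^sub>C y)"
    by (simp add: Re_cinner[symmetric] cinner_scaleC_right)
  also have "\<dots> \<le> norm x * norm (c *\<^sub>C y)"
    by (rule norm_cauchy_schwarz)
  also have "\<dots> = norm x * norm y"
    using False by (simp add: norm_scaleC c_def norm_sgn)
  finally show ?thesis .
qed simp

definition orthonormal_basis :: "(nat \<Rightarrow> 'h::complex_hilbert_space) \<Rightarrow> bool" where
  "orthonormal_basis e \<longleftrightarrow>
     (\<forall>i j. cinner (e i) (e j) = (if i = j then 1 else 0)) \<and> closure (cspan (range e)) = UNIV"

section \<open>Operators\<close>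

text \<open>Operators are elements of the library type \<open>'h \<Rightarrow>\<^sub>L 'h\<close> of bounded real-linear maps with
  the operator norm. All operators in question are norm limits of complex matrices, possibly
  plus the identity, and hence complex-linear. For complex-linear operators the adjoint below
  exists (by Riesz), and it is unique by the following lemma.\<close>

definition cadjoint :: "('h::complex_hilbert_space \<Rightarrow>\<^sub>L 'h) \<Rightarrow> ('h \<Rightarrow>\<^sub>L 'h)" where
  "cadjoint T = (THE S. \<forall>x y. cinner (blinfun_apply S x) y = cinner x (blinfun_apply T y))"

lemma cadjoint_eqI:
  assumes "\<And>x y. cinner (blinfun_apply S x) y = cinner x (blinfun_apply T y)"
  shows "cadjoint T = S"
  unfolding cadjoint_def
proof (rule the_equality)
  fix S' assume S': "\<forall>x y. cinner (blinfun_apply S' x) y = cinner x (blinfun_apply T y)"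
  have "inner (blinfun_apply S' x) y = inner (blinfun_apply S x) y" for x y
    using S' assms by (simp add: Re_cinner[symmetric])
  then show "S' = S"
    by (intro blinfun_eqI) (metis inner_commute vector_eq_rdot)
qed (use assms in blast)

definition normal_op :: "('h::complex_hilbert_space \<Rightarrow>\<^sub>L 'h) \<Rightarrow> bool" where
  "normal_op T \<longleftrightarrow> cadjoint T o\<^sub>L T = T o\<^sub>L cadjoint T"

definition unitary_op :: "('h::complex_hilbert_space \<Rightarrow>\<^sub>L 'h) \<Rightarrow> bool" where
  "unitary_op U \<longleftrightarrow> cadjoint U o\<^sub>L U = id_blinfun \<and> U o\<^sub>L cadjoint U = id_blinfun"

definition eigenspace :: "('h::complex_hilbert_space \<Rightarrow>\<^sub>L 'h) \<Rightarrow> complex \<Rightarrow> 'h set" where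
  "eigenspace T \<mu> = {v. blinfun_apply T v = \<mu> *\<^sub>C v}"

definition Eig :: "('h::complex_hilbert_space \<Rightarrow>\<^sub>L 'h) \<Rightarrow> complex set" where
  "Eig T = {\<mu>. \<exists>v. v \<noteq> 0 \<and> blinfun_apply T v = \<mu> *\<^sub>C v}"

text \<open>Since \<open>cdim\<close> is \<open>0\<close> on infinite-dimensional spaces, the condition below does exclude
  eigenvalues of infinite multiplicity.\<close>

definition multiplicity_free :: "('h::complex_hilbert_space \<Rightarrow>\<^sub>L 'h) \<Rightarrow> bool" where
  "multiplicity_free T \<longleftrightarrow> (\<forall>\<mu>\<in>Eig T. cdim (eigenspace T \<mu>) = 1)"

section \<open>Compact operators over a space\<close>

text \<open>The operator with matrix \<open>a\<close> (of size \<open>n \<times> n\<close>) with respect to \<open>e\<close>, extended by zero.\<close>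

lift_definition matrix_op ::
  "(nat \<Rightarrow> 'h::complex_hilbert_space) \<Rightarrow> nat \<Rightarrow> (nat \<Rightarrow> nat \<Rightarrow> complex) \<Rightarrow> 'h \<Rightarrow>\<^sub>L 'h"
  is "\<lambda>e n a v. \<Sum>i<n. \<Sum>j<n. (a i j * cinner (e j) v) *\<^sub>C e i"
proof -
  fix e :: "nat \<Rightarrow> 'h" and n and a :: "nat \<Rightarrow> nat \<Rightarrow> complex"
  have "bounded_linear (\<lambda>v. (c * cinner u v) *\<^sub>C w)" for c and u w :: 'h
  proof (rule bounded_linear_intro)
    show "(c * cinner u (x + y)) *\<^sub>C w = (c * cinner u x) *\<^sub>C w + (c * cinner u y) *\<^sub>C w" for x y
      by (simp add: cinner_add_right distrib_left scaleC_add_left)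
    show "(c * cinner u (r *\<^sub>R x)) *\<^sub>C w = r *\<^sub>R (c * cinner u x) *\<^sub>C w" for r x
      by (simp add: scaleC_of_real[symmetric] cinner_scaleC_right scaleC_scaleC mult.left_commute)
    show "norm ((c * cinner u x) *\<^sub>C w) \<le> norm x * (cmod c * norm u * norm w)" for x
      using mult_left_mono[OF cmod_cinner_le[of u x], of "cmod c * norm w"]
      by (simp add: norm_scaleC norm_mult mult_ac)
  qed
  then show "bounded_linear (\<lambda>v. \<Sum>i<n. \<Sum>j<n. (a i j * cinner (e j) v) *\<^sub>C e i)"
    by (intro bounded_linear_sum)
qed

text \<open>The ring of compact operators over \<open>X\<close>: uniform norm limits of finite matrices with entries
  in \<open>C(X)\<close>. Families are functions on the whole ambient type; only their values on
  \<open>X\<close> matter.\<close>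

definition compact_over ::
  "(nat \<Rightarrow> 'h::complex_hilbert_space) \<Rightarrow> 'x::topological_space set \<Rightarrow> ('x \<Rightarrow> 'h \<Rightarrow>\<^sub>L 'h) set" where
  "compact_over e X =
     {A. \<forall>\<epsilon>>0. \<exists>n a. (\<forall>i<n. \<forall>j<n. continuous_on X (a i j)) \<and>
           (\<forall>x\<in>X. norm (A x - matrix_op e n (\<lambda>i j. a i j x)) < \<epsilon>)}"

definition condition_one_interval :: "(real \<Rightarrow> 'h::complex_hilbert_space \<Rightarrow>\<^sub>L 'h) \<Rightarrow> bool" where
  "condition_one_interval A \<longleftrightarrow>
     (\<forall>x\<^sub>0\<in>{0..1}. \<forall>\<mu>\<in>Eig (A x\<^sub>0). \<exists>l. continuous_on {0..1} l \<and> l x\<^sub>0 = \<mu> \<and>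
        (\<forall>x\<in>{0..1}. l x \<in> Eig (A x)))"

definition condition_one_circle :: "(complex \<Rightarrow> 'h::complex_hilbert_space \<Rightarrow>\<^sub>L 'h) \<Rightarrow> bool" where
  "condition_one_circle A \<longleftrightarrow>
     condition_one_interval (\<lambda>x. A (exp (2 * of_real pi * of_real x * \<i>)))"

definition approx_unitarily_equivalent ::
  "(nat \<Rightarrow> 'h::complex_hilbert_space) \<Rightarrow> 'x::topological_space set \<Rightarrow>
   ('x \<Rightarrow> 'h \<Rightarrow>\<^sub>L 'h) \<Rightarrow> ('x \<Rightarrow> 'h \<Rightarrow>\<^sub>L 'h) \<Rightarrow> bool" where
  "approx_unitarily_equivalent e X A B \<longleftrightarrow>
     (\<forall>\<epsilon>>0. \<exists>U. continuous_on X U \<and> (\<lambda>x. U x - id_blinfun) \<in> compact_over e X \<and>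
        (\<forall>x\<in>X. unitary_op (U x)) \<and>
        (\<forall>x\<in>X. norm (B x - (cadjoint (U x) o\<^sub>L A x o\<^sub>L U x)) < \<epsilon>))"

end

theory Submission
  imports Defs
begin

text \<open>
  Simple nonzero eigenvalues of a norm continuous path of compact normal operators move continuously and never
  merge: eigenvectors of distinct eigenvalues are orthogonal, so two of them cannot converge into one
  one-dimensional eigenspace (\<open>eigenvalues_do_not_merge\<close>). Together with condition (1) this decomposes the eigenvalues
  over the parameter interval into disjoint continuous curves. The curves depend only on the sets of eigenvalues,
  so they are the same for \<open>A\<close> and \<open>B\<close>, and running once around the circle permutes them (\<open>monodromy\<close>). Along every
  curve \<open>\<lambda>\<close> there are continuous unit eigenvectors \<open>f\<^sub>\<lambda>\<close> of \<open>A\<close> and \<open>g\<^sub>\<lambda>\<close> of \<open>B\<close>, with phases chosen so that transport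
  around the circle carries the eigenvector of a curve exactly to that of its successor (\<open>eigenframe_exists\<close>).

  The sum of all rank one operators \<open>f\<^sub>\<lambda> g\<^sub>\<lambda>\<^sup>*\<close> would be a family of unitaries that intertwines \<open>A\<close> and \<open>B\<close>, but it is not a
  compact perturbation of the identity. Compactness leaves only finitely many curves that ever exceed a given
  modulus (\<open>finite_large_curves\<close>); however, this finite set need not be invariant under the monodromy, so that
  truncating the sum does not give a loop. Instead the sum is damped: let \<open>s\<close>, \<open>c\<close> be continuous functions on
  the plane with \<open>s\<^sup>2 + c\<^sup>2 = 1\<close>, where \<open>s\<close> vanishes near \<open>0\<close> and \<open>c\<close> vanishes away from a small disc, and let
  \<open>W = \<Sum> s(\<lambda>) f\<^sub>\<lambda> g\<^sub>\<lambda>\<^sup>*\<close>. A curve that leaves the finite set has a small value there, where \<open>s\<close> vanishes, so \<open>W\<close> is a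
  continuous family of finite rank operators over the circle (\<open>diagonal_loop_closes\<close>), and \<open>A W = W B\<close>.

  The operator \<open>W\<close> is a contraction with explicit defects \<open>D = 1 - \<Sum> (1 - c(\<lambda>)) f\<^sub>\<lambda> f\<^sub>\<lambda>\<^sup>*\<close> and
  \<open>D' = 1 - \<Sum> (1 - c(\<lambda>)) g\<^sub>\<lambda> g\<^sub>\<lambda>\<^sup>*\<close>, which satisfy \<open>D\<^sup>2 = 1 - W W\<^sup>*\<close>, \<open>D'\<^sup>2 = 1 - W\<^sup>* W\<close> and \<open>D W = W D'\<close>. Hence the block matrix
  with rows \<open>(W, D)\<close> and \<open>(D', - W\<^sup>*)\<close> is unitary on \<open>H \<oplus> H\<close>, and it intertwines \<open>A \<oplus> 0\<close> and \<open>B \<oplus> 0\<close> up to \<open>A D\<close> and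
  \<open>D' B\<close>. These are compact normal operators all of whose eigenvalues are small, because \<open>c(\<lambda>)\<close> vanishes on the large
  eigenvalues, and so their norms are small (\<open>compact_normal_norm_le\<close>). To find the second copy of \<open>H\<close> inside \<open>H\<close>,
  everything is compressed to the first \<open>N\<close> basis vectors, and the next \<open>N\<close> basis vectors serve as the second copy.
  By compactness the compressed block matrix is unitary and intertwining up to a small error, uniformly
  over the circle. A Newton iteration for the unitary polar factor turns it into an exactly unitary family nearby
  without leaving the compact perturbations of the identity (\<open>almost_unitary_family_near_unitary\<close>,
  \<open>unitary_from_intertwiner\<close>).
\<close>

section \<open>Complex Hilbert spaces\<close>

instance complex_hilbert_space \<subseteq> banach ..

lemma cinner_zero_right [simp]: "cinner x (0 :: 'a::complex_hilbert_space) = 0"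
  using cinner_add_right[of x 0 0] by simp

lemma cinner_minus_right [simp]: "cinner x (- y :: 'a::complex_hilbert_space) = - cinner x y"
  using cinner_scaleC_right[of x "-1" y] by (simp add: complex_vector.scale_minus_left)

lemma cinner_diff_right: "cinner x (y - z :: 'a::complex_hilbert_space) = cinner x y - cinner x z"
  using cinner_add_right[of x y "- z"] by simp

lemma cinner_add_left: "cinner (x + y) (z :: 'a::complex_hilbert_space) = cinner x z + cinner y z"
  by (metis cinner_commute cinner_add_right complex_cnj_add)

lemma cinner_diff_left: "cinner (x - y) (z :: 'a::complex_hilbert_space) = cinner x z - cinner y z"
  by (metis cinner_commute cinner_diff_right complex_cnj_diff)

lemma cinner_scaleC_left: "cinner (c *\<^sub>C x) (y :: 'a::complex_hilbert_space) = cnj c * cinner x y"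
  by (metis cinner_commute cinner_scaleC_right complex_cnj_mult)

lemma cinner_zero_left [simp]: "cinner 0 (x :: 'a::complex_hilbert_space) = 0"
  using cinner_add_left[of 0 0 x] by simp

lemma cinner_scaleR_right: "cinner x (r *\<^sub>R y :: 'a::complex_hilbert_space) = of_real r * cinner x y"
  by (metis cinner_scaleC_right scaleC_of_real)

lemma cinner_scaleR_left: "cinner (r *\<^sub>R x) (y :: 'a::complex_hilbert_space) = of_real r * cinner x y"
  by (metis cinner_scaleC_left scaleC_of_real complex_cnj_complex_of_real)

lemma cinner_self: "cinner x x = of_real ((norm (x :: 'a::complex_hilbert_space))\<^sup>2)"
proof (rule complex_eqI)
  show "Re (cinner x x) = Re (of_real ((norm x)\<^sup>2))"
    by (simp add: Re_cinner power2_norm_eq_inner)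
  show "Im (cinner x x) = Im (of_real ((norm x)\<^sup>2))"
    using arg_cong[OF cinner_commute[of x x], of Im] by simp
qed

lemma cinner_self_eq_0 [simp]: "cinner x x = 0 \<longleftrightarrow> (x :: 'a::complex_hilbert_space) = 0"
  by (simp add: cinner_self)

lemma bounded_bilinear_scaleC:
  "bounded_bilinear (scaleC :: complex \<Rightarrow> 'a \<Rightarrow> 'a::complex_hilbert_space)"
proof (rule bounded_bilinear.intro)
  show "\<exists>K. \<forall>a b. norm (a *\<^sub>C b :: 'a) \<le> norm a * norm b * K"
    by (rule exI[of _ 1]) (simp add: norm_scaleC)
qed (simp_all add: scaleC_add_left scaleC_add_right scaleC_scaleC mult.commute
    flip: scaleC_of_real, simp_all add: scaleR_conv_of_real scaleC_scaleC)

lemma bounded_bilinear_cinner: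
  "bounded_bilinear (cinner :: 'a::complex_hilbert_space \<Rightarrow> 'a \<Rightarrow> complex)"
proof (rule bounded_bilinear.intro)
  show "\<exists>K. \<forall>a b. norm (cinner (a :: 'a) b) \<le> norm a * norm b * K"
    by (rule exI[of _ 1]) (simp add: cmod_cinner_le)
qed (simp_all add: cinner_add_left cinner_add_right cinner_scaleR_left cinner_scaleR_right
    scaleR_conv_of_real)

lemmas tendsto_scaleC = bounded_bilinear.tendsto[OF bounded_bilinear_scaleC]
lemmas tendsto_cinner = bounded_bilinear.tendsto[OF bounded_bilinear_cinner]
lemmas continuous_on_scaleC = bounded_bilinear.continuous_on[OF bounded_bilinear_scaleC]
lemmas continuous_on_cinner = bounded_bilinear.continuous_on[OF bounded_bilinear_cinner]

section \<open>Adjoints\<close>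

text \<open>Having an adjoint forces a bounded real-linear operator to be complex linear (\<open>adjointable_scaleC\<close>), so this one
  property carries the star-algebra structure.\<close>

definition adjointable :: "('h::complex_hilbert_space \<Rightarrow>\<^sub>L 'h) \<Rightarrow> bool" where
  "adjointable T \<longleftrightarrow> (\<exists>S. \<forall>x y. cinner (blinfun_apply S x) y = cinner x (blinfun_apply T y))"

lemma adjointableI:
  assumes "\<And>x y. cinner (blinfun_apply S x) y = cinner x (blinfun_apply T y)"
  shows "adjointable T"
  using assms unfolding adjointable_def by blast

lemma cinner_cadjoint_left:
  assumes "adjointable T"
  shows "cinner (blinfun_apply (cadjoint T) x) y = cinner x (blinfun_apply T y)"
  using assms cadjoint_eqI[of _ T] unfolding adjointable_def by metis

lemma cinner_cadjoint_right:
  assumes "adjointable T"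
  shows "cinner x (blinfun_apply (cadjoint T) y) = cinner (blinfun_apply T x) y"
  using cinner_cadjoint_left[OF assms, of y x] by (metis cinner_commute)

lemma adjointable_cadjoint [simp]: "adjointable T \<Longrightarrow> adjointable (cadjoint T)"
  by (rule adjointableI[of T]) (simp add: cinner_cadjoint_right)

lemma cadjoint_cadjoint [simp]: "adjointable T \<Longrightarrow> cadjoint (cadjoint T) = T"
  by (rule cadjoint_eqI) (simp add: cinner_cadjoint_right)

lemma cinner_ext:
  assumes "\<And>z. cinner z x = cinner z (y :: 'a::complex_hilbert_space)"
  shows "x = y"
proof -
  have "cinner (x - y) (x - y) = 0"
    using assms[of "x - y"] by (simp add: cinner_diff_right)
  then show ?thesis by simp
qed

lemma adjointable_scaleC:
  assumes "adjointable T"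
  shows "blinfun_apply T (c *\<^sub>C x) = c *\<^sub>C blinfun_apply T x"
  by (rule cinner_ext) (simp add: cinner_scaleC_right flip: cinner_cadjoint_left[OF assms])

lemma
  assumes "adjointable S" "adjointable T"
  shows adjointable_add: "adjointable (S + T)"
    and cadjoint_add: "cadjoint (S + T) = cadjoint S + cadjoint T"
    and adjointable_diff: "adjointable (S - T)"
    and cadjoint_diff: "cadjoint (S - T) = cadjoint S - cadjoint T"
    and adjointable_compose: "adjointable (S o\<^sub>L T)"
    and cadjoint_compose: "cadjoint (S o\<^sub>L T) = cadjoint T o\<^sub>L cadjoint S"
proof -
  have 1: "cinner (blinfun_apply (cadjoint S + cadjoint T) x) y = cinner x (blinfun_apply (S + T) y)"
    and 2: "cinner (blinfun_apply (cadjoint S - cadjoint T) x) y = cinner x (blinfun_apply (S - T) y)"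
    and 3: "cinner (blinfun_apply (cadjoint T o\<^sub>L cadjoint S) x) y = cinner x (blinfun_apply (S o\<^sub>L T) y)"
    for x y
    using assms by (simp_all add: blinfun.add_left blinfun.diff_left cinner_add_left cinner_add_right
        cinner_diff_left cinner_diff_right cinner_cadjoint_left)
  show "adjointable (S + T)" "cadjoint (S + T) = cadjoint S + cadjoint T"
    using adjointableI[OF 1] cadjoint_eqI[OF 1] by auto
  show "adjointable (S - T)" "cadjoint (S - T) = cadjoint S - cadjoint T"
    using adjointableI[OF 2] cadjoint_eqI[OF 2] by auto
  show "adjointable (S o\<^sub>L T)" "cadjoint (S o\<^sub>L T) = cadjoint T o\<^sub>L cadjoint S"
    using adjointableI[OF 3] cadjoint_eqI[OF 3] by auto
qed

lemma
  assumes "adjointable T"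
  shows adjointable_scaleR: "adjointable (r *\<^sub>R T)"
    and cadjoint_scaleR: "cadjoint (r *\<^sub>R T) = r *\<^sub>R cadjoint T"
  using assms
  by (auto intro!: adjointableI[of "r *\<^sub>R cadjoint T"] cadjoint_eqI
      simp: blinfun.scaleR_left cinner_scaleR_left cinner_scaleR_right cinner_cadjoint_left)

lemma
  shows adjointable_id [simp]: "adjointable id_blinfun"
    and cadjoint_id [simp]: "cadjoint id_blinfun = id_blinfun"
    and adjointable_zero [simp]: "adjointable 0"
    and cadjoint_zero [simp]: "cadjoint 0 = 0"
  by (rule adjointableI[of id_blinfun] adjointableI[of 0] cadjoint_eqI; simp)+

lemma adjointable_sum:
  assumes "\<And>i. i \<in> I \<Longrightarrow> adjointable (T i)"
  shows "adjointable (\<Sum>i\<in>I. T i) \<and> cadjoint (\<Sum>i\<in>I. T i) = (\<Sum>i\<in>I. cadjoint (T i))"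
  using assms
  by (induction I rule: infinite_finite_induct) (auto simp: adjointable_add cadjoint_add)

lemma norm_apply_sq:
  assumes "adjointable T"
  shows "(norm (blinfun_apply T x))\<^sup>2 = Re (cinner x (blinfun_apply (cadjoint T) (blinfun_apply T x)))"
  using assms by (simp add: cinner_cadjoint_right cinner_self)

lemma norm_cadjoint [simp]:
  assumes "adjointable T"
  shows "norm (cadjoint T) = norm T"
proof -
  have le: "norm S \<le> norm (cadjoint S)" if S: "adjointable S" for S :: "'a \<Rightarrow>\<^sub>L 'a"
  proof (rule norm_blinfun_bound)
    fix x
    have "(norm (blinfun_apply S x))\<^sup>2 \<le> norm x * norm (blinfun_apply (cadjoint S) (blinfun_apply S x))"
      unfolding norm_apply_sq[OF S]
      by (meson cmod_cinner_le complex_Re_le_cmod order_trans)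
    also have "\<dots> \<le> norm x * (norm (cadjoint S) * norm (blinfun_apply S x))"
      by (intro mult_left_mono norm_blinfun) auto
    finally show "norm (blinfun_apply S x) \<le> norm (cadjoint S) * norm x"
      by (cases "blinfun_apply S x = 0") (auto simp: power2_eq_square mult_ac)
  qed auto
  show ?thesis
    using le[OF assms] le[OF adjointable_cadjoint[OF assms]] assms by simp
qed

lemma norm_cadjoint_compose_bound:
  assumes T: "adjointable T" and "norm (cadjoint T o\<^sub>L T) \<le> c"
  shows "(norm T)\<^sup>2 \<le> c"
proof -
  have c: "0 \<le> c" using assms(2) norm_ge_zero order_trans by blast
  have "norm T \<le> sqrt c"
  proof (rule norm_blinfun_bound)
    fix x
    have "(norm (blinfun_apply T x))\<^sup>2 \<le> norm x * norm (blinfun_apply (cadjoint T o\<^sub>L T) x)"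
      unfolding norm_apply_sq[OF T]
      by (metis (no_types) blinfun_apply_blinfun_compose cmod_cinner_le complex_Re_le_cmod order_trans)
    also have "\<dots> \<le> norm x * (c * norm x)"
      by (intro mult_left_mono order_trans[OF norm_blinfun mult_right_mono[OF assms(2)]]) auto
    also have "\<dots> = (sqrt c * norm x)\<^sup>2"
      using c by (simp add: power2_eq_square)
    finally show "norm (blinfun_apply T x) \<le> sqrt c * norm x"
      using c by (auto intro: power2_le_imp_le)
  qed (use c in auto)
  then show ?thesis
    by (metis c norm_ge_zero power_mono real_sqrt_pow2)
qed

text \<open>Taking adjoints is isometric, so the adjoints of a convergent sequence form a Cauchy sequence, and the adjoint
  relation passes to its limit.\<close>

lemma adjointable_limit:
  assumes T: "\<And>n. adjointable (T n)" and lim: "T \<longlonglongrightarrow> S"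
  shows "adjointable S \<and> (\<lambda>n. cadjoint (T n)) \<longlonglongrightarrow> cadjoint S"
proof -
  have "dist (cadjoint (T m)) (cadjoint (T n)) = dist (T m) (T n)" for m n
    using T by (simp add: dist_norm norm_cadjoint adjointable_diff flip: cadjoint_diff)
  then have "Cauchy (\<lambda>n. cadjoint (T n))"
    using LIMSEQ_imp_Cauchy[OF lim] unfolding Cauchy_def by simp
  then obtain R where R: "(\<lambda>n. cadjoint (T n)) \<longlonglongrightarrow> R"
    by (metis Cauchy_convergent convergentD)
  have eq: "cinner (blinfun_apply R x) y = cinner x (blinfun_apply S y)" for x y
  proof (rule LIMSEQ_unique)
    show "(\<lambda>n. cinner (blinfun_apply (cadjoint (T n)) x) y) \<longlonglongrightarrow> cinner (blinfun_apply R x) y"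
      by (intro tendsto_cinner blinfun.tendsto R tendsto_const)
    show "(\<lambda>n. cinner (blinfun_apply (cadjoint (T n)) x) y) \<longlonglongrightarrow> cinner x (blinfun_apply S y)"
      using T by (simp add: cinner_cadjoint_left tendsto_cinner blinfun.tendsto lim)
  qed
  then show ?thesis
    using R cadjoint_eqI[OF eq] adjointableI[OF eq] by simp
qed

section \<open>Rank one operators\<close>

lift_definition outer :: "'h::complex_hilbert_space \<Rightarrow> 'h \<Rightarrow> 'h \<Rightarrow>\<^sub>L 'h"
  is "\<lambda>u w x. cinner w x *\<^sub>C u"
  by (rule bounded_linear_compose[OF bounded_bilinear.bounded_linear_left[OF bounded_bilinear_scaleC]
        bounded_bilinear.bounded_linear_right[OF bounded_bilinear_cinner]])

lemma outer_apply [simp]: "blinfun_apply (outer u w) x = cinner w x *\<^sub>C u"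
  by transfer simp

lemma norm_outer_le: "norm (outer u w) \<le> norm u * norm w"
proof (rule norm_blinfun_bound)
  fix x show "norm (blinfun_apply (outer u w) x) \<le> norm u * norm w * norm x"
    using mult_left_mono[OF cmod_cinner_le[of w x], of "norm u"]
    by (simp add: norm_scaleC mult_ac)
qed auto

lemma bounded_bilinear_outer: "bounded_bilinear outer"
proof (rule bounded_bilinear.intro)
  show "\<exists>K. \<forall>a b. norm (outer a b) \<le> norm a * norm b * K"
    by (rule exI[of _ 1]) (simp add: norm_outer_le)
next
  fix r :: real and u u' w w' :: 'a
  show "outer (u + u') w = outer u w + outer u' w"
    by (rule blinfun_eqI) (simp add: blinfun.add_left scaleC_add_right)
  show "outer u (w + w') = outer u w + outer u w'"
    by (rule blinfun_eqI) (simp add: blinfun.add_left scaleC_add_left cinner_add_left)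
  show "outer (r *\<^sub>R u) w = r *\<^sub>R outer u w"
    by (rule blinfun_eqI)
      (simp add: blinfun.scaleR_left bounded_bilinear.scaleR_right[OF bounded_bilinear_scaleC])
  show "outer u (r *\<^sub>R w) = r *\<^sub>R outer u w"
    by (rule blinfun_eqI)
      (simp only: outer_apply blinfun.scaleR_left cinner_scaleR_left scaleC_of_real scaleC_scaleC[symmetric])
qed

lemmas tendsto_outer = bounded_bilinear.tendsto[OF bounded_bilinear_outer]
lemmas continuous_on_outer = bounded_bilinear.continuous_on[OF bounded_bilinear_outer]

lemma
  shows adjointable_outer [simp]: "adjointable (outer u w)"
    and cadjoint_outer [simp]: "cadjoint (outer u w) = outer w u"
proof -
  have "cinner (blinfun_apply (outer w u) x) y = cinner x (blinfun_apply (outer u w) y)" for x y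
    using cinner_commute[of u x] by (simp add: cinner_scaleC_left cinner_scaleC_right)
  then show "adjointable (outer u w)" "cadjoint (outer u w) = outer w u"
    using adjointableI[of "outer w u" "outer u w"] cadjoint_eqI[of "outer w u" "outer u w"] by blast+
qed

lemma compose_outer: "adjointable T \<Longrightarrow> T o\<^sub>L outer u w = outer (blinfun_apply T u) w"
  by (rule blinfun_eqI) (simp add: adjointable_scaleC)

lemma outer_compose: "adjointable T \<Longrightarrow> outer u w o\<^sub>L T = outer u (blinfun_apply (cadjoint T) w)"
  by (rule blinfun_eqI) (simp add: cinner_cadjoint_left)

lemma outer_scaleC_left: "outer (c *\<^sub>C u) w = outer u (cnj c *\<^sub>C w)"
  by (rule blinfun_eqI) (simp add: cinner_scaleC_left scaleC_scaleC mult.commute)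

section \<open>Compact operators\<close>

global_interpretation blinfun_compose: bounded_bilinear blinfun_compose
  by (rule bounded_bilinear_blinfun_compose)

lemma
  shows id_compose [simp]: "id_blinfun o\<^sub>L T = T"
    and compose_id [simp]: "T o\<^sub>L id_blinfun = T"
  by (rule blinfun_eqI; simp)+

lemma norm_contraction_compose: "norm P \<le> 1 \<Longrightarrow> norm (P o\<^sub>L T) \<le> norm T"
  using norm_blinfun_compose[of P T] mult_right_mono[of "norm P" 1 "norm T"] by simp

lemma norm_compose_contraction: "norm P \<le> 1 \<Longrightarrow> norm (T o\<^sub>L P) \<le> norm T"
  using norm_blinfun_compose[of T P] mult_left_mono[of "norm P" 1 "norm T"] by simp

text \<open>A basis-free form of the norm limits of finite matrices. The real span suffices, since complex scalars can be
  absorbed into the first vector of a rank one operator.\<close>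

definition compact_operators :: "('h::complex_hilbert_space \<Rightarrow>\<^sub>L 'h) set" where
  "compact_operators = closure (span (range (case_prod outer)))"

lemma subspace_compact_operators: "subspace compact_operators"
proof (rule subspaceI)
  let ?S = "span (range (case_prod outer)) :: ('a \<Rightarrow>\<^sub>L 'a) set"
  have sub: "subspace ?S" by simp
  show "(0 :: 'a \<Rightarrow>\<^sub>L 'a) \<in> compact_operators"
    unfolding compact_operators_def by (intro subsetD[OF closure_subset] subspace_0 sub)
  fix S T :: "'a \<Rightarrow>\<^sub>L 'a" and c
  assume S: "S \<in> compact_operators"
  then obtain s where s: "\<And>n::nat. s n \<in> ?S" "s \<longlonglongrightarrow> S"
    unfolding compact_operators_def closure_sequential by blast
  then have cs: "(\<lambda>n. c *\<^sub>R s n) \<longlonglongrightarrow> c *\<^sub>R S" "\<And>n. c *\<^sub>R s n \<in> ?S"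
    by (simp_all add: tendsto_scaleR subspace_scale[OF sub])
  show "c *\<^sub>R S \<in> compact_operators"
    unfolding compact_operators_def closure_sequential
    by (intro CollectI exI[of _ "\<lambda>n. c *\<^sub>R s n"] conjI allI cs)
  assume "T \<in> compact_operators"
  then obtain t where t: "\<And>n::nat. t n \<in> ?S" "t \<longlonglongrightarrow> T"
    unfolding compact_operators_def closure_sequential by blast
  then have st: "(\<lambda>n. s n + t n) \<longlonglongrightarrow> S + T" "\<And>n. s n + t n \<in> ?S"
    using s by (simp_all add: tendsto_add subspace_add[OF sub])
  show "S + T \<in> compact_operators"
    unfolding compact_operators_def closure_sequential
    by (intro CollectI exI[of _ "\<lambda>n. s n + t n"] conjI allI st)
qed

lemmas compact_operators_add = subspace_add[OF subspace_compact_operators]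
lemmas compact_operators_diff = subspace_diff[OF subspace_compact_operators]
lemmas compact_operators_scaleR = subspace_scale[OF subspace_compact_operators]
lemmas compact_operators_sum = subspace_sum[OF subspace_compact_operators]

lemma closed_compact_operators: "closed compact_operators"
  by (simp add: compact_operators_def)

lemma outer_in_compact_operators [simp]: "outer u w \<in> compact_operators"
  unfolding compact_operators_def
  by (intro subsetD[OF closure_subset] span_base) auto

text \<open>Most closure properties of compact operators need only be checked on rank one operators, sums and limits.\<close>

lemma compact_operators_induct [consumes 1, case_names outer add limit]:
  assumes T: "T \<in> compact_operators"
    and outer: "\<And>u w. P (outer u w)"
    and add: "\<And>S T. P S \<Longrightarrow> P T \<Longrightarrow> P (S + T)"
    and limit: "\<And>S T. (\<And>n::nat. P (S n)) \<Longrightarrow> S \<longlonglongrightarrow> T \<Longrightarrow> P T"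
  shows "P T"
proof -
  have "P S" if "S \<in> span (range (case_prod outer))" for S
    using that
  proof (induction rule: span_induct_alt)
    case base
    have "outer 0 0 = (0 :: 'a \<Rightarrow>\<^sub>L 'a)" by (rule blinfun_eqI) simp
    then show ?case using outer by metis
  next
    case (step c S R)
    then obtain u w where "S = outer u w" by auto
    then have "c *\<^sub>R S = outer (c *\<^sub>R u) w"
      using bounded_bilinear.scaleR_left[OF bounded_bilinear_outer] by metis
    then show ?case using step outer add by metis
  qed
  then show ?thesis
    using T limit unfolding compact_operators_def closure_sequential by metis
qed

lemma compact_operators_adjoint:
  assumes "T \<in> compact_operators"
  shows "adjointable T" and "cadjoint T \<in> compact_operators"
proof -
  have "adjointable T \<and> cadjoint T \<in> compact_operators"
    using assms
  proof (induction rule: compact_operators_induct)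
    case (limit S T)
    have lim: "adjointable T" "(\<lambda>n. cadjoint (S n)) \<longlonglongrightarrow> cadjoint T"
      using adjointable_limit[of S T] limit by auto
    then show ?case
      using limit closed_sequentially[OF closed_compact_operators _ lim(2)] by auto
  qed (auto simp: adjointable_add cadjoint_add compact_operators_add)
  then show "adjointable T" "cadjoint T \<in> compact_operators" by auto
qed

lemma compact_operators_compose_left:
  assumes "T \<in> compact_operators" and R: "adjointable R"
  shows "R o\<^sub>L T \<in> compact_operators"
  using assms(1)
proof (induction rule: compact_operators_induct)
  case (limit S T)
  have "(\<lambda>n. R o\<^sub>L S n) \<longlonglongrightarrow> (R o\<^sub>L T)"
    by (intro blinfun_compose.tendsto limit tendsto_const)
  then show ?case
    by (rule closed_sequentially[OF closed_compact_operators limit(1)])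
qed (simp_all add: compose_outer R blinfun_compose.add_right compact_operators_add)

lemma compact_operators_compose_right:
  assumes T: "T \<in> compact_operators" and R: "adjointable R"
  shows "T o\<^sub>L R \<in> compact_operators"
proof -
  have "cadjoint (cadjoint R o\<^sub>L cadjoint T) \<in> compact_operators"
    by (intro compact_operators_adjoint(2) compact_operators_compose_left adjointable_cadjoint T R)
  then show ?thesis
    using compact_operators_adjoint[OF T] R by (simp add: cadjoint_compose)
qed

text \<open>For a rank one operator the image of the unit ball lies in the compact image of a disc; a net for a sum is a
  sum of nets, and a net for a close operator is a net for the limit.\<close>

lemma compact_operators_totally_bounded:
  assumes "T \<in> compact_operators"
  shows "\<forall>\<epsilon>>0. \<exists>k. finite k \<and> (\<forall>v. norm v \<le> 1 \<longrightarrow> (\<exists>y\<in>k. norm (blinfun_apply T v - y) < \<epsilon>))"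
  using assms
proof (induction rule: compact_operators_induct)
  case (outer u w)
  show ?case
  proof (intro allI impI)
    fix \<epsilon> :: real assume "\<epsilon> > 0"
    have "compact ((\<lambda>c. c *\<^sub>C u) ` cball 0 (norm w))"
      by (intro compact_continuous_image continuous_on_scaleC continuous_intros) auto
    then obtain k where k: "finite k" "(\<lambda>c. c *\<^sub>C u) ` cball 0 (norm w) \<subseteq> (\<Union>y\<in>k. ball y \<epsilon>)"
      using \<open>\<epsilon> > 0\<close> compact_eq_totally_bounded[of "(\<lambda>c. c *\<^sub>C u) ` cball 0 (norm w)"] by auto
    have "\<exists>y\<in>k. norm (blinfun_apply (outer u w) v - y) < \<epsilon>" if "norm v \<le> 1" for v
    proof -
      have "cmod (cinner w v) \<le> norm w"
        using cmod_cinner_le[of w v] that mult_left_mono[of "norm v" 1 "norm w"] by simp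
      then have "cinner w v *\<^sub>C u \<in> (\<Union>y\<in>k. ball y \<epsilon>)"
        by (intro subsetD[OF k(2)] imageI) simp
      then show ?thesis by (auto simp: dist_norm norm_minus_commute)
    qed
    then show "\<exists>k. finite k \<and> (\<forall>v. norm v \<le> 1 \<longrightarrow> (\<exists>y\<in>k. norm (blinfun_apply (outer u w) v - y) < \<epsilon>))"
      using k(1) by blast
  qed
next
  case (add S T)
  show ?case
  proof (intro allI impI)
    fix \<epsilon> :: real assume "\<epsilon> > 0"
    then have "\<epsilon> / 2 > 0" by simp
    obtain k1 k2 where k: "finite k1" "finite k2"
      and k1: "\<And>v. norm v \<le> 1 \<Longrightarrow> \<exists>y\<in>k1. norm (blinfun_apply S v - y) < \<epsilon> / 2"
      and k2: "\<And>v. norm v \<le> 1 \<Longrightarrow> \<exists>y\<in>k2. norm (blinfun_apply T v - y) < \<epsilon> / 2"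
      using add \<open>\<epsilon> / 2 > 0\<close> by meson
    have "\<exists>y\<in>(\<lambda>(y, z). y + z) ` (k1 \<times> k2). norm (blinfun_apply (S + T) v - y) < \<epsilon>"
      if v: "norm v \<le> 1" for v
    proof -
      obtain y z where yz: "y \<in> k1" "norm (blinfun_apply S v - y) < \<epsilon> / 2"
        "z \<in> k2" "norm (blinfun_apply T v - z) < \<epsilon> / 2"
        using k1[OF v] k2[OF v] by blast
      have "norm (blinfun_apply (S + T) v - (y + z)) < \<epsilon>"
        using norm_triangle_lt[of "blinfun_apply S v - y" "blinfun_apply T v - z" \<epsilon>] yz
        by (simp add: blinfun.add_left algebra_simps)
      with yz show ?thesis by (intro bexI[of _ "y + z"]) auto
    qed
    then show "\<exists>k. finite k \<and> (\<forall>v. norm v \<le> 1 \<longrightarrow> (\<exists>y\<in>k. norm (blinfun_apply (S + T) v - y) < \<epsilon>))"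
      using finite_imageI[OF finite_cartesian_product[OF k]] by blast
  qed
next
  case (limit S T)
  show ?case
  proof (intro allI impI)
    fix \<epsilon> :: real assume "\<epsilon> > 0"
    then have e2: "\<epsilon> / 2 > 0" by simp
    obtain n where n: "norm (S n - T) < \<epsilon> / 2"
      using LIMSEQ_D[OF limit(2) e2] by blast
    obtain k where k: "finite k" "\<And>v. norm v \<le> 1 \<Longrightarrow> \<exists>y\<in>k. norm (blinfun_apply (S n) v - y) < \<epsilon> / 2"
      using limit(1)[of n] e2 by meson
    have "\<exists>y\<in>k. norm (blinfun_apply T v - y) < \<epsilon>" if v: "norm v \<le> 1" for v
    proof -
      obtain y where y: "y \<in> k" "norm (blinfun_apply (S n) v - y) < \<epsilon> / 2"
        using k(2)[OF v] by blast
      have "norm (blinfun_apply (T - S n) v) \<le> norm (T - S n) * norm v"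
        by (rule norm_blinfun)
      also have "\<dots> \<le> norm (T - S n)"
        using v by (simp add: mult_left_le)
      finally have "norm (blinfun_apply T v - blinfun_apply (S n) v) < \<epsilon> / 2"
        using n by (simp add: blinfun.diff_left norm_minus_commute)
      then have "norm (blinfun_apply T v - y) < \<epsilon>"
        using y(2) norm_triangle_lt[of "blinfun_apply T v - blinfun_apply (S n) v" "blinfun_apply (S n) v - y" \<epsilon>]
        by simp
      with y show ?thesis by blast
    qed
    with k(1) show "\<exists>k. finite k \<and> (\<forall>v. norm v \<le> 1 \<longrightarrow> (\<exists>y\<in>k. norm (blinfun_apply T v - y) < \<epsilon>))"
      by blast
  qed
qed

lemma compact_operators_convergent_subsequence:
  assumes T: "T \<in> compact_operators" and v: "\<And>n::nat. norm (v n) \<le> 1"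
  obtains r y where "strict_mono r" and "(\<lambda>n. blinfun_apply T (v (r n))) \<longlonglongrightarrow> y"
proof -
  let ?B = "closure (blinfun_apply T ` cball 0 1)"
  have "\<exists>k. finite k \<and> ?B \<subseteq> (\<Union>y\<in>k. ball y \<epsilon>)" if "\<epsilon> > 0" for \<epsilon>
  proof -
    have "\<epsilon> / 2 > 0" using that by simp
    then obtain k where k: "finite k"
      "\<And>v. norm v \<le> 1 \<Longrightarrow> \<exists>y\<in>k. norm (blinfun_apply T v - y) < \<epsilon> / 2"
      using compact_operators_totally_bounded[OF T] by meson
    have "blinfun_apply T ` cball 0 1 \<subseteq> (\<Union>y\<in>k. cball y (\<epsilon> / 2))"
      using k(2) by (fastforce simp: dist_norm norm_minus_commute)
    then have "?B \<subseteq> (\<Union>y\<in>k. cball y (\<epsilon> / 2))"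
      using k(1) by (intro closure_minimal closed_UN) auto
    also have "\<dots> \<subseteq> (\<Union>y\<in>k. ball y \<epsilon>)" using that by fastforce
    finally show ?thesis using k(1) by blast
  qed
  then have "compact ?B"
    unfolding compact_eq_totally_bounded by (auto simp: complete_eq_closed)
  moreover have "blinfun_apply T (v n) \<in> ?B" for n
    using v by (intro subsetD[OF closure_subset]) auto
  ultimately obtain r y where "strict_mono r" "((\<lambda>n. blinfun_apply T (v n)) \<circ> r) \<longlonglongrightarrow> y"
    using compact_imp_seq_compact seq_compactE[of ?B "\<lambda>n. blinfun_apply T (v n)"] by blast
  then show ?thesis
    using that by (simp add: o_def)
qed

text \<open>Compactness makes \<open>S (v n)\<close> subconverge, and \<open>v n\<close> is asymptotically \<open>S (v n) / \<mu>\<close>. The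
  eigenvector arguments below rest on this lemma.\<close>

lemma approximate_eigenvectors_subconverge:
  assumes K: "S \<in> compact_operators" and mu: "\<mu> \<noteq> 0"
    and v: "\<And>n::nat. norm (v n) = 1"
    and lim: "(\<lambda>n. blinfun_apply S (v n) - \<mu> *\<^sub>C v n) \<longlonglongrightarrow> 0"
  obtains r w where "strict_mono r" and "(\<lambda>n. v (r n)) \<longlonglongrightarrow> w" and "norm w = 1"
    and "blinfun_apply S w = \<mu> *\<^sub>C w"
proof -
  obtain r y where r: "strict_mono r" and y: "(\<lambda>n. blinfun_apply S (v (r n))) \<longlonglongrightarrow> y"
    using compact_operators_convergent_subsequence[OF K, of v] v by (metis order_refl)
  have "(\<lambda>n. blinfun_apply S (v (r n)) - (blinfun_apply S (v (r n)) - \<mu> *\<^sub>C v (r n))) \<longlonglongrightarrow> y - 0"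
    using LIMSEQ_subseq_LIMSEQ[OF lim r] by (intro tendsto_diff y) (simp add: o_def)
  then have "(\<lambda>n. inverse \<mu> *\<^sub>C \<mu> *\<^sub>C v (r n)) \<longlonglongrightarrow> inverse \<mu> *\<^sub>C y"
    by (intro tendsto_scaleC tendsto_const) simp
  then have w: "(\<lambda>n. v (r n)) \<longlonglongrightarrow> inverse \<mu> *\<^sub>C y"
    using mu by (simp add: scaleC_scaleC)
  have "norm (inverse \<mu> *\<^sub>C y) = 1"
    using tendsto_norm[OF w] v by (simp add: LIMSEQ_const_iff)
  moreover have "blinfun_apply S (inverse \<mu> *\<^sub>C y) = \<mu> *\<^sub>C inverse \<mu> *\<^sub>C y"
    using LIMSEQ_unique[OF blinfun.tendsto[OF tendsto_const w] y] mu by (simp add: scaleC_scaleC)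
  ultimately show ?thesis using that r w by blast
qed

lemma eigenvectors_subconverge:
  assumes K: "S \<in> compact_operators" and mu: "\<mu> \<noteq> 0" and v: "\<And>n::nat. norm (v n) = 1"
    and T: "T \<longlonglongrightarrow> S" and m: "m \<longlonglongrightarrow> \<mu>"
    and ev: "\<And>n. blinfun_apply (T n) (v n) = m n *\<^sub>C v n"
  obtains r w where "strict_mono r" and "(\<lambda>n. v (r n)) \<longlonglongrightarrow> w" and "norm w = 1"
    and "blinfun_apply S w = \<mu> *\<^sub>C w"
proof (rule approximate_eigenvectors_subconverge[OF K mu, of v])
  have bound: "norm (blinfun_apply S (v n) - \<mu> *\<^sub>C v n) \<le> norm (S - T n) + cmod (m n - \<mu>)" for n
  proof -
    have "blinfun_apply S (v n) - \<mu> *\<^sub>C v n = blinfun_apply (S - T n) (v n) + (m n - \<mu>) *\<^sub>C v n"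
      using ev[of n] by (simp add: blinfun.diff_left complex_vector.scale_left_diff_distrib)
    also have "norm \<dots> \<le> norm (S - T n) * norm (v n) + cmod (m n - \<mu>) * norm (v n)"
      by (intro norm_triangle_le add_mono norm_blinfun) (simp add: norm_scaleC)
    finally show ?thesis using v by simp
  qed
  have "(\<lambda>n. norm (S - T n) + cmod (m n - \<mu>)) \<longlonglongrightarrow> norm (S - S) + cmod (\<mu> - \<mu>)"
    by (intro tendsto_intros T m)
  then have lim: "(\<lambda>n. norm (S - T n) + cmod (m n - \<mu>)) \<longlonglongrightarrow> 0" by simp
  show "(\<lambda>n. blinfun_apply S (v n) - \<mu> *\<^sub>C v n) \<longlonglongrightarrow> 0"
    by (rule Lim_null_comparison[OF always_eventually[OF allI[OF bound]] lim])
qed (use v that in auto)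

section \<open>Compact operators and finite matrices\<close>

lemma norm_projection_le_1:
  assumes "adjointable P" "cadjoint P = P" "P o\<^sub>L P = P"
  shows "norm P \<le> 1"
proof -
  have "(norm P)\<^sup>2 \<le> norm P"
    using norm_cadjoint_compose_bound[of P "norm P"] assms by simp
  then show ?thesis
    using mult_le_cancel_left_pos[of "norm P" "norm P" 1] by (cases "P = 0") (auto simp: power2_eq_square)
qed

definition coord_proj :: "(nat \<Rightarrow> 'h::complex_hilbert_space) \<Rightarrow> nat \<Rightarrow> 'h \<Rightarrow>\<^sub>L 'h" where
  "coord_proj e n = (\<Sum>i<n. outer (e i) (e i))"

lemma matrix_op_eq_sum_outer:
  "matrix_op e n a = (\<Sum>i<n. \<Sum>j<n. outer (a i j *\<^sub>C e i) (e j))"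
  by (rule blinfun_eqI)
     (simp add: matrix_op.rep_eq blinfun.sum_left scaleC_scaleC mult.commute)

lemma orthonormal_basis_cinner:
  "orthonormal_basis e \<Longrightarrow> cinner (e i) (e j) = (if i = j then 1 else 0)"
  by (simp add: orthonormal_basis_def)

lemma coord_proj_apply: "blinfun_apply (coord_proj e n) v = (\<Sum>i<n. cinner (e i) v *\<^sub>C e i)"
  by (simp add: coord_proj_def blinfun.sum_left)

lemma coord_proj_compact [simp]: "coord_proj e n \<in> compact_operators"
  by (simp add: coord_proj_def compact_operators_sum)

lemma coord_proj_adjoint [simp]: "adjointable (coord_proj e n)" "cadjoint (coord_proj e n) = coord_proj e n"
  using adjointable_sum[of "{..<n}" "\<lambda>i. outer (e i) (e i)"] by (auto simp: coord_proj_def)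

lemma coord_proj_basis:
  assumes "orthonormal_basis e"
  shows "blinfun_apply (coord_proj e n) (e i) = (if i < n then e i else 0)"
  by (simp add: coord_proj_apply orthonormal_basis_cinner[OF assms] if_distrib
      [of "\<lambda>c. c *\<^sub>C _"] cong: if_cong)

lemma coord_proj_coord_proj:
  assumes "orthonormal_basis e" "n \<le> m"
  shows "blinfun_apply (coord_proj e m) (blinfun_apply (coord_proj e n) v) = blinfun_apply (coord_proj e n) v"
  using assms(2)
  by (simp add: coord_proj_apply[of e n] blinfun.sum_right adjointable_scaleC coord_proj_basis[OF assms(1)])

lemma norm_coord_proj:
  assumes "orthonormal_basis e"
  shows "norm (coord_proj e n) \<le> 1" and "norm (id_blinfun - coord_proj e n) \<le> 1"
proof -
  have pp: "coord_proj e n o\<^sub>L coord_proj e n = coord_proj e n"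
    using coord_proj_coord_proj[OF assms order_refl, of n] by (intro blinfun_eqI) simp
  then show "norm (coord_proj e n) \<le> 1"
    by (intro norm_projection_le_1) simp_all
  show "norm (id_blinfun - coord_proj e n) \<le> 1"
    by (rule norm_projection_le_1)
      (simp_all add: adjointable_diff cadjoint_diff blinfun_compose.diff_left blinfun_compose.diff_right pp)
qed

lemma coord_proj_tendsto:
  assumes e: "orthonormal_basis e"
  shows "(\<lambda>n. blinfun_apply (coord_proj e n) v) \<longlonglongrightarrow> v"
proof (rule LIMSEQ_I)
  fix \<epsilon> :: real assume "\<epsilon> > 0"
  have "v \<in> closure (cspan (range e))"
    using e by (simp add: orthonormal_basis_def)
  then obtain u where u: "u \<in> cspan (range e)" "norm (u - v) < \<epsilon> / 2"
    using \<open>\<epsilon> > 0\<close> by (metis closure_approachable dist_norm half_gt_zero)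
  have "\<exists>N. \<forall>n\<ge>N. blinfun_apply (coord_proj e n) u = u"
    using u(1)
  proof (induction rule: complex_vector.span_induct_alt)
    case (step c x y)
    then obtain i N where "x = e i" and N: "\<And>n. n \<ge> N \<Longrightarrow> blinfun_apply (coord_proj e n) y = y"
      by auto
    then show ?case
      by (intro exI[of _ "max N (Suc i)"])
         (auto simp: blinfun.add_right adjointable_scaleC coord_proj_basis[OF e])
  qed auto
  then obtain N where N: "\<And>n. n \<ge> N \<Longrightarrow> blinfun_apply (coord_proj e n) u = u"
    by blast
  show "\<exists>N. \<forall>n\<ge>N. norm (blinfun_apply (coord_proj e n) v - v) < \<epsilon>"
  proof (intro exI[of _ N] allI impI)
    fix n assume "n \<ge> N"
    have "norm (blinfun_apply (coord_proj e n) v - v)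
        = norm (blinfun_apply (id_blinfun - coord_proj e n) (u - v))"
      using N[OF \<open>n \<ge> N\<close>] by (simp add: blinfun.diff_left blinfun.diff_right)
    also have "\<dots> \<le> 1 * norm (u - v)"
      by (intro order_trans[OF norm_blinfun] mult_right_mono norm_coord_proj[OF e]) auto
    also have "\<dots> < \<epsilon>" using u \<open>\<epsilon> > 0\<close> by simp
    finally show "norm (blinfun_apply (coord_proj e n) v - v) < \<epsilon>" .
  qed
qed

lemma coord_proj_compress_eq_matrix_op:
  assumes "adjointable T"
  shows "coord_proj e n o\<^sub>L T o\<^sub>L coord_proj e n = matrix_op e n (\<lambda>i j. cinner (e i) (blinfun_apply T (e j)))"
  using assms
  by (intro blinfun_eqI)
     (simp add: coord_proj_apply matrix_op.rep_eq blinfun.sum_right adjointable_scaleC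
       cinner_scaleC_right scaleC_scaleC complex_vector.scale_sum_left mult.commute,
      rule sum.swap)

lemma coord_proj_matrix_op:
  assumes e: "orthonormal_basis e" and "n \<le> m"
  shows "coord_proj e m o\<^sub>L matrix_op e n a = matrix_op e n a"
    and "matrix_op e n a o\<^sub>L coord_proj e m = matrix_op e n a"
proof -
  show "coord_proj e m o\<^sub>L matrix_op e n a = matrix_op e n a"
    using \<open>n \<le> m\<close>
    by (intro blinfun_eqI)
       (simp add: matrix_op.rep_eq blinfun.sum_right adjointable_scaleC coord_proj_basis[OF e])
  show "matrix_op e n a o\<^sub>L coord_proj e m = matrix_op e n a"
  proof (rule blinfun_eqI)
    fix v
    have "cinner (e j) (blinfun_apply (coord_proj e m) v) = cinner (e j) v" if "j < n" for j
      using cinner_cadjoint_left[of "coord_proj e m" "e j" v] that \<open>n \<le> m\<close>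
      by (simp add: coord_proj_basis[OF e])
    then show "blinfun_apply (matrix_op e n a o\<^sub>L coord_proj e m) v = blinfun_apply (matrix_op e n a) v"
      by (simp add: matrix_op.rep_eq)
  qed
qed

text \<open>On rank one operators this is completeness of the basis; it passes to limits because the projections are
  uniformly bounded.\<close>

lemma compact_operators_coord_proj:
  assumes "T \<in> compact_operators" and e: "orthonormal_basis e"
  shows "(\<lambda>n. coord_proj e n o\<^sub>L T) \<longlonglongrightarrow> T"
  using assms(1)
proof (induction rule: compact_operators_induct)
  case (outer u w)
  then show ?case
    by (simp add: compose_outer tendsto_outer coord_proj_tendsto[OF e])
next
  case (add S T)
  then show ?case by (simp add: blinfun_compose.add_right tendsto_add)
next
  case (limit S T)
  show ?case
  proof (rule LIMSEQ_I)
    fix \<epsilon> :: real assume "\<epsilon> > 0"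
    then have e2: "\<epsilon> / 2 > 0" by simp
    obtain k where k: "norm (T - S k) < \<epsilon> / 2"
      using LIMSEQ_D[OF limit(2) e2] by (metis norm_minus_commute order_refl)
    obtain N where N: "\<And>n. n \<ge> N \<Longrightarrow> norm ((coord_proj e n o\<^sub>L S k) - S k) < \<epsilon> / 2"
      using LIMSEQ_D[OF limit(1)[of k] e2] by blast
    show "\<exists>N. \<forall>n\<ge>N. norm ((coord_proj e n o\<^sub>L T) - T) < \<epsilon>"
    proof (intro exI[of _ N] allI impI)
      fix n assume "n \<ge> N"
      have "(coord_proj e n o\<^sub>L T) - T
          = ((coord_proj e n o\<^sub>L S k) - S k) - ((id_blinfun - coord_proj e n) o\<^sub>L (T - S k))"
        by (rule blinfun_eqI) (simp add: blinfun.diff_left blinfun.diff_right)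
      moreover have "norm ((id_blinfun - coord_proj e n) o\<^sub>L (T - S k)) \<le> norm (T - S k)"
        by (rule norm_contraction_compose[OF norm_coord_proj(2)[OF e]])
      ultimately show "norm ((coord_proj e n o\<^sub>L T) - T) < \<epsilon>"
        using N[OF \<open>n \<ge> N\<close>] k norm_triangle_ineq4
        by (smt (verit, best) field_sum_of_halves)
    qed
  qed
qed

lemma compact_operators_matrix_approx:
  assumes T: "T \<in> compact_operators" and e: "orthonormal_basis e" and "\<epsilon> > 0"
  obtains n a where "norm (T - matrix_op e n a) < \<epsilon>"
proof -
  have aT: "adjointable T" and aT': "adjointable (cadjoint T)"
    using compact_operators_adjoint[OF T] by auto
  have "(\<lambda>n. cadjoint (coord_proj e n o\<^sub>L cadjoint T)) \<longlonglongrightarrow> cadjoint (cadjoint T)"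
    using adjointable_limit[OF _ compact_operators_coord_proj[OF compact_operators_adjoint(2)[OF T] e]]
      aT' by (simp add: adjointable_compose)
  then have *: "(\<lambda>n. T o\<^sub>L coord_proj e n) \<longlonglongrightarrow> T"
    using aT by (simp add: cadjoint_compose)
  have "\<exists>n. norm (T - (T o\<^sub>L coord_proj e n)) < \<epsilon> / 2 \<and> norm (T - (coord_proj e n o\<^sub>L T)) < \<epsilon> / 2"
  proof -
    have "\<epsilon> / 2 > 0" using \<open>\<epsilon> > 0\<close> by simp
    then obtain n1 n2 where "\<And>n. n \<ge> n1 \<Longrightarrow> norm ((T o\<^sub>L coord_proj e n) - T) < \<epsilon> / 2"
      "\<And>n. n \<ge> n2 \<Longrightarrow> norm ((coord_proj e n o\<^sub>L T) - T) < \<epsilon> / 2"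
      using LIMSEQ_D[OF *] LIMSEQ_D[OF compact_operators_coord_proj[OF T e]] by meson
    then show ?thesis
      by (intro exI[of _ "max n1 n2"]) (simp add: norm_minus_commute)
  qed
  then obtain n where n: "norm (T - (T o\<^sub>L coord_proj e n)) < \<epsilon> / 2"
    "norm (T - (coord_proj e n o\<^sub>L T)) < \<epsilon> / 2" by blast
  have "T - (coord_proj e n o\<^sub>L T o\<^sub>L coord_proj e n)
      = (T - (coord_proj e n o\<^sub>L T)) + (coord_proj e n o\<^sub>L (T - (T o\<^sub>L coord_proj e n)))"
    by (rule blinfun_eqI) (simp add: blinfun.diff_left blinfun.diff_right blinfun.add_left)
  moreover have "norm (coord_proj e n o\<^sub>L (T - (T o\<^sub>L coord_proj e n))) \<le> norm (T - (T o\<^sub>L coord_proj e n))"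
    by (rule norm_contraction_compose[OF norm_coord_proj(1)[OF e]])
  ultimately have "norm (T - (coord_proj e n o\<^sub>L T o\<^sub>L coord_proj e n)) < \<epsilon>"
    using n norm_triangle_ineq by (smt (verit, best) field_sum_of_halves)
  then show ?thesis
    using that coord_proj_compress_eq_matrix_op[OF aT] by metis
qed

lemma matrix_op_compact [simp]: "matrix_op e n a \<in> compact_operators"
  by (simp add: matrix_op_eq_sum_outer compact_operators_sum)

lemma compact_over_pointwise:
  assumes A: "A \<in> compact_over e X" and x: "x \<in> X"
  shows "A x \<in> compact_operators"
proof -
  have "A x \<in> closure compact_operators"
    unfolding closure_approachable
  proof (intro allI impI)
    fix \<epsilon> :: real assume "\<epsilon> > 0"
    then obtain n a where "norm (A x - matrix_op e n (\<lambda>i j. a i j x)) < \<epsilon>"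
      using A x unfolding compact_over_def by blast
    then show "\<exists>y\<in>compact_operators. dist y (A x) < \<epsilon>"
      by (intro bexI[of _ "matrix_op e n (\<lambda>i j. a i j x)"]) (auto simp: dist_norm norm_minus_commute)
  qed
  then show ?thesis by (simp add: closure_closed[OF closed_compact_operators])
qed

lemma compact_over_continuous:
  assumes A: "A \<in> compact_over e X"
  shows "continuous_on X A"
proof -
  have "\<exists>M. continuous_on X M \<and> (\<forall>x\<in>X. norm (A x - M x) < inverse (Suc k))" for k
  proof -
    have "inverse (real (Suc k)) > 0" by simp
    then obtain n a where a: "\<forall>i<n. \<forall>j<n. continuous_on X (a i j)"
      and *: "\<forall>x\<in>X. norm (A x - matrix_op e n (\<lambda>i j. a i j x)) < inverse (Suc k)"
      using A unfolding compact_over_def by blast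
    have "continuous_on X (\<lambda>x. matrix_op e n (\<lambda>i j. a i j x))"
      unfolding matrix_op_eq_sum_outer
      by (intro continuous_on_sum continuous_on_outer continuous_on_scaleC continuous_on_const) (use a in auto)
    with * show ?thesis by blast
  qed
  then obtain M where M: "\<And>k. continuous_on X (M k)"
    "\<And>k x. x \<in> X \<Longrightarrow> norm (A x - M k x) < inverse (Suc k)" by metis
  show ?thesis
  proof (rule uniform_limit_theorem[of _ _ sequentially])
    show "uniform_limit X M A sequentially"
    proof (rule uniform_limitI)
      fix \<epsilon> :: real assume "\<epsilon> > 0"
      then obtain k0 where "inverse (Suc k0) < \<epsilon>" using reals_Archimedean by blast
      then have "dist (M k x) (A x) < \<epsilon>" if "k \<ge> k0" "x \<in> X" for k x
      proof -
        have "inverse (real (Suc k)) \<le> inverse (real (Suc k0))"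
          using that(1) by (intro le_imp_inverse_le) auto
        then show ?thesis
          using M(2)[OF that(2), of k] \<open>inverse (Suc k0) < \<epsilon>\<close>
          by (simp only: dist_norm norm_minus_commute[of "M k x"])
      qed
      then show "\<forall>\<^sub>F k in sequentially. \<forall>x\<in>X. dist (M k x) (A x) < \<epsilon>"
        unfolding eventually_sequentially by blast
    qed
  qed (use M in auto)
qed

text \<open>A matrix of size \<open>N\<close> is fixed by the projections onto at least \<open>N\<close> basis vectors, so the compression error of \<open>A\<close>
  is bounded by its distance to the matrix.\<close>

lemma compact_over_coord_proj:
  assumes A: "A \<in> compact_over e X" and e: "orthonormal_basis e" and "\<epsilon> > 0"
  shows "\<exists>N. \<forall>n\<ge>N. \<forall>x\<in>X. norm (A x - (coord_proj e n o\<^sub>L A x)) \<le> \<epsilon> \<and>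
    norm (A x - (A x o\<^sub>L coord_proj e n)) \<le> \<epsilon>"
proof -
  obtain N a where a: "\<And>x. x \<in> X \<Longrightarrow> norm (A x - matrix_op e N (\<lambda>i j. a i j x)) < \<epsilon>"
    using A \<open>\<epsilon> > 0\<close> unfolding compact_over_def by blast
  have 1: "norm (A x - (coord_proj e n o\<^sub>L A x)) \<le> \<epsilon>" "norm (A x - (A x o\<^sub>L coord_proj e n)) \<le> \<epsilon>"
    if n: "n \<ge> N" and x: "x \<in> X" for n x
  proof -
    let ?M = "matrix_op e N (\<lambda>i j. a i j x)"
    have "A x - (coord_proj e n o\<^sub>L A x) = (id_blinfun - coord_proj e n) o\<^sub>L (A x - ?M)"
      using coord_proj_matrix_op(1)[OF e n, of "\<lambda>i j. a i j x"]
      by (simp add: blinfun_compose.diff_left blinfun_compose.diff_right)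
    moreover have "norm \<dots> \<le> norm (A x - ?M)"
      by (rule norm_contraction_compose[OF norm_coord_proj(2)[OF e]])
    ultimately show "norm (A x - (coord_proj e n o\<^sub>L A x)) \<le> \<epsilon>" using a[OF x] by simp
    have "A x - (A x o\<^sub>L coord_proj e n) = (A x - ?M) o\<^sub>L (id_blinfun - coord_proj e n)"
      using coord_proj_matrix_op(2)[OF e n, of "\<lambda>i j. a i j x"]
      by (simp add: blinfun_compose.diff_left blinfun_compose.diff_right)
    moreover have "norm \<dots> \<le> norm (A x - ?M)"
      by (rule norm_compose_contraction[OF norm_coord_proj(2)[OF e]])
    ultimately show "norm (A x - (A x o\<^sub>L coord_proj e n)) \<le> \<epsilon>" using a[OF x] by simp
  qed
  then show ?thesis by blast
qed

text \<open>A matrix that approximates \<open>A\<close> at a point does so nearby. Finitely many of these neighbourhoods cover \<open>X\<close>, and the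
  largest matrix size that occurs works everywhere. The entries of the compression are then continuous.\<close>

lemma compact_over_iff:
  assumes X: "compact X" and e: "orthonormal_basis e"
  shows "A \<in> compact_over e X \<longleftrightarrow> continuous_on X A \<and> (\<forall>x\<in>X. A x \<in> compact_operators)"
proof
  assume A: "continuous_on X A \<and> (\<forall>x\<in>X. A x \<in> compact_operators)"
  show "A \<in> compact_over e X"
    unfolding compact_over_def
  proof (intro CollectI allI impI)
    fix \<epsilon> :: real assume "\<epsilon> > 0"
    then have e2: "\<epsilon> / 4 > 0" by simp
    have "\<forall>x. \<exists>n a. x \<in> X \<longrightarrow> norm (A x - matrix_op e n a) < \<epsilon> / 4"
      using compact_operators_matrix_approx[OF _ e e2] A by metis
    then obtain n a where na: "\<And>x. x \<in> X \<Longrightarrow> norm (A x - matrix_op e (n x) (a x)) < \<epsilon> / 4"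
      by metis
    have "\<forall>x. \<exists>U. x \<in> X \<longrightarrow> open U \<and> x \<in> U \<and> (\<forall>y\<in>X \<inter> U. norm (A y - A x) < \<epsilon> / 4)"
    proof (intro allI)
      fix x
      show "\<exists>U. x \<in> X \<longrightarrow> open U \<and> x \<in> U \<and> (\<forall>y\<in>X \<inter> U. norm (A y - A x) < \<epsilon> / 4)"
        using A e2 unfolding continuous_on_topological
        by (metis (no_types, lifting) IntE centre_in_ball dist_commute dist_norm mem_ball open_ball)
    qed
    then obtain U where U: "\<And>x. x \<in> X \<Longrightarrow> open (U x)" "\<And>x. x \<in> X \<Longrightarrow> x \<in> U x"
      "\<And>x y. x \<in> X \<Longrightarrow> y \<in> X \<Longrightarrow> y \<in> U x \<Longrightarrow> norm (A y - A x) < \<epsilon> / 4"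
      by (metis IntI)
    obtain C where C: "C \<subseteq> X" "finite C" "X \<subseteq> (\<Union>c\<in>C. U c)"
      using compactE_image[OF X, of X U] U by (metis UN_I subsetI)
    obtain N where N: "\<And>c. c \<in> C \<Longrightarrow> n c \<le> N"
      using C(2) finite_nat_set_iff_bounded_le[of "n ` C"] by auto
    show "\<exists>n a. (\<forall>i<n. \<forall>j<n. continuous_on X (a i j)) \<and>
        (\<forall>x\<in>X. norm (A x - matrix_op e n (\<lambda>i j. a i j x)) < \<epsilon>)"
    proof (intro exI conjI allI impI ballI)
      show "continuous_on X (\<lambda>x. cinner (e i) (blinfun_apply (A x) (e j)))" for i j
        using A by (intro continuous_on_cinner blinfun.continuous_on continuous_on_const) auto
      fix x assume x: "x \<in> X"
      then obtain c where c: "c \<in> C" "x \<in> U c" using C by blast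
      let ?p = "coord_proj e N" and ?M = "matrix_op e (n c) (a c)"
      have "norm (A x - A c) < \<epsilon> / 4" "norm (A c - ?M) < \<epsilon> / 4"
        using U(3)[of c x] na[of c] c C x by auto
      then have M: "norm (A x - ?M) < \<epsilon> / 2"
        using norm_triangle_lt[of "A x - A c" "A c - ?M" "\<epsilon> / 2"] by simp
      have "A x - matrix_op e N (\<lambda>i j. cinner (e i) (blinfun_apply (A x) (e j))) = A x - (?p o\<^sub>L A x o\<^sub>L ?p)"
        using A x compact_operators_adjoint by (subst coord_proj_compress_eq_matrix_op) auto
      also have "\<dots> = (A x - ?M) - (?p o\<^sub>L (A x - ?M) o\<^sub>L ?p)"
        using coord_proj_matrix_op[OF e N[OF c(1)], of "a c"]
        by (simp add: blinfun_compose.diff_left blinfun_compose.diff_right)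
      also have "norm \<dots> \<le> norm (A x - ?M) + norm (A x - ?M)"
        by (intro order_trans[OF norm_triangle_ineq4] add_left_mono
             order_trans[OF norm_compose_contraction norm_contraction_compose] norm_coord_proj[OF e])
      finally show "norm (A x - matrix_op e N (\<lambda>i j. cinner (e i) (blinfun_apply (A x) (e j)))) < \<epsilon>"
        using M by simp
    qed
  qed
qed (use compact_over_continuous compact_over_pointwise in blast)

section \<open>Compact normal operators\<close>

lemma normal_op_apply:
  "normal_op T \<Longrightarrow> blinfun_apply (cadjoint T) (blinfun_apply T v) = blinfun_apply T (blinfun_apply (cadjoint T) v)"
  unfolding normal_op_def by (metis blinfun_apply_blinfun_compose)

text \<open>Expanding the square of the norm of \<open>T\<^sup>* v - cnj \<mu> v\<close> and moving adjoints across gives the corresponding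
  expression for \<open>T v - \<mu> v\<close>, which is \<open>0\<close>.\<close>

lemma normal_op_eigenvector_cadjoint:
  assumes T: "adjointable T" "normal_op T" and ev: "blinfun_apply T v = \<mu> *\<^sub>C v"
  shows "blinfun_apply (cadjoint T) v = cnj \<mu> *\<^sub>C v"
proof -
  let ?y = "blinfun_apply (cadjoint T) v - cnj \<mu> *\<^sub>C v"
  have "cinner (blinfun_apply (cadjoint T) v) (blinfun_apply (cadjoint T) v)
      = cinner v (blinfun_apply (cadjoint T) (blinfun_apply T v))"
    using T by (simp only: cinner_cadjoint_left normal_op_apply)
  also have "\<dots> = \<mu> * cnj \<mu> * cinner v v"
    using T by (simp add: cinner_cadjoint_right ev cinner_scaleC_left cinner_scaleC_right)
  finally have "cinner (blinfun_apply (cadjoint T) v) (blinfun_apply (cadjoint T) v) = \<mu> * cnj \<mu> * cinner v v" .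
  moreover have "cinner v (blinfun_apply (cadjoint T) v) = cnj \<mu> * cinner v v"
    using T by (simp add: cinner_cadjoint_right ev cinner_scaleC_left)
  moreover have "cinner (blinfun_apply (cadjoint T) v) v = \<mu> * cinner v v"
    using T by (simp add: cinner_cadjoint_left ev cinner_scaleC_right)
  ultimately have "cinner ?y ?y = 0"
    by (simp add: cinner_diff_left cinner_diff_right cinner_scaleC_left cinner_scaleC_right)
  then show ?thesis by simp
qed

lemma normal_op_eigenvectors_orthogonal:
  assumes T: "adjointable T" "normal_op T"
    and ev: "blinfun_apply T v = \<mu> *\<^sub>C v" "blinfun_apply T w = \<nu> *\<^sub>C w" and "\<mu> \<noteq> \<nu>"
  shows "cinner v w = 0"
proof -
  have "\<mu> * cinner v w = cinner (blinfun_apply (cadjoint T) v) w"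
    by (simp add: normal_op_eigenvector_cadjoint[OF T ev(1)] cinner_scaleC_left)
  also have "\<dots> = \<nu> * cinner v w"
    using T ev by (simp add: cinner_cadjoint_left cinner_scaleC_right)
  finally show ?thesis using \<open>\<mu> \<noteq> \<nu>\<close> by simp
qed

text \<open>A maximizing sequence for the norm of \<open>T\<close> on \<open>M\<close> consists of approximate eigenvectors of \<open>T\<^sup>*T\<close>
  for the square of that norm, hence subconverges.\<close>

lemma compact_norm_attained:
  assumes K: "T \<in> compact_operators" and M: "closed M"
    and scale: "\<And>r x. x \<in> M \<Longrightarrow> r *\<^sub>R x \<in> M"
    and inv: "\<And>x. x \<in> M \<Longrightarrow> blinfun_apply (cadjoint T) (blinfun_apply T x) \<in> M"
    and nz: "x0 \<in> M" "blinfun_apply T x0 \<noteq> 0"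
  obtains s v where "s > 0" and "v \<in> M" and "v \<noteq> 0"
    and "blinfun_apply (cadjoint T) (blinfun_apply T v) = of_real (s\<^sup>2) *\<^sub>C v"
    and "\<And>x. x \<in> M \<Longrightarrow> norm (blinfun_apply T x) \<le> s * norm x"
proof -
  have aT: "adjointable T" using compact_operators_adjoint[OF K] by auto
  define N where "N = (\<lambda>x. norm (blinfun_apply T x)) ` {x \<in> M. norm x = 1}"
  define s where "s = Sup N"
  have bdd: "bdd_above N"
  proof (rule bdd_aboveI)
    fix y assume "y \<in> N"
    then obtain x where "y = norm (blinfun_apply T x)" "norm x = 1" by (auto simp: N_def)
    then show "y \<le> norm T" using norm_blinfun[of T x] by simp
  qed
  have bound: "norm (blinfun_apply T x) \<le> s * norm x" if "x \<in> M" for x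
  proof (cases "x = 0")
    case False
    have "norm (blinfun_apply T ((1 / norm x) *\<^sub>R x)) \<in> N"
      unfolding N_def using False scale[OF that] by (intro imageI) auto
    then have "norm (blinfun_apply T ((1 / norm x) *\<^sub>R x)) \<le> s"
      unfolding s_def using bdd by (rule cSup_upper)
    then show ?thesis using False by (simp add: blinfun.scaleR_right field_simps)
  qed simp
  have "x0 \<noteq> 0" using nz by auto
  then have s: "s > 0"
    using bound[OF nz(1)] nz(2) by (smt (verit) mult_nonneg_nonneg norm_le_zero_iff zero_less_mult_pos2)
  have "N \<noteq> {}"
    unfolding N_def using \<open>x0 \<noteq> 0\<close> scale[OF nz(1), of "1 / norm x0"] by force
  have "\<exists>x. x \<in> M \<and> norm x = 1 \<and> s - inverse (Suc n) < norm (blinfun_apply T x)" for n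
  proof -
    have "s - inverse (Suc n) < Sup N" by (simp add: s_def)
    then obtain y where "y \<in> N" "s - inverse (Suc n) < y"
      using less_cSup_iff[OF \<open>N \<noteq> {}\<close> bdd] by blast
    then show ?thesis by (auto simp: N_def)
  qed
  then obtain x where x: "\<And>n. x n \<in> M" "\<And>n. norm (x n) = 1"
    "\<And>n. s - inverse (Suc n) < norm (blinfun_apply T (x n))" by metis
  have lim: "(\<lambda>n. norm (blinfun_apply T (x n))) \<longlonglongrightarrow> s"
  proof (rule tendsto_sandwich[of "\<lambda>n. s - inverse (real (Suc n))" _ _ "\<lambda>n. s"])
    show "(\<lambda>n. s - inverse (real (Suc n))) \<longlonglongrightarrow> s"
      using tendsto_diff[OF tendsto_const LIMSEQ_inverse_real_of_nat, of s] by simp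
    show "\<forall>\<^sub>F n in sequentially. norm (blinfun_apply T (x n)) \<le> s"
      using bound[OF x(1)] x(2) by simp
    show "\<forall>\<^sub>F n in sequentially. s - inverse (real (Suc n)) \<le> norm (blinfun_apply T (x n))"
      using x(3) by (simp add: less_imp_le)
  qed auto
  let ?S = "cadjoint T o\<^sub>L T"
  have "?S \<in> compact_operators"
    by (intro compact_operators_compose_left K adjointable_cadjoint aT)
  moreover have "(\<lambda>n. blinfun_apply ?S (x n) - of_real (s\<^sup>2) *\<^sub>C x n) \<longlonglongrightarrow> 0"
  proof -
    have est: "(norm (blinfun_apply ?S (x n) - of_real (s\<^sup>2) *\<^sub>C x n))\<^sup>2
        \<le> s\<^sup>2 * (s\<^sup>2 - (norm (blinfun_apply T (x n)))\<^sup>2)" for n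
    proof -
      let ?z = "blinfun_apply ?S (x n)" and ?y = "blinfun_apply T (x n)"
      have zM: "?z \<in> M" using inv[OF x(1)] by simp
      have "(norm ?z)\<^sup>2 = Re (cinner (blinfun_apply T ?z) ?y)"
        using aT cinner_self[of ?z] by (simp add: cinner_cadjoint_right)
      also have "\<dots> \<le> norm (blinfun_apply T ?z) * norm ?y"
        by (meson cmod_cinner_le complex_Re_le_cmod order_trans)
      also have "\<dots> \<le> s * norm ?z * norm ?y"
        by (intro mult_right_mono bound zM) auto
      finally have "norm ?z * norm ?z \<le> norm ?z * (s * norm ?y)"
        by (simp add: power2_eq_square mult_ac)
      then have "norm ?z \<le> s * norm ?y"
        using s by (cases "norm ?z = 0") auto
      then have z2: "(norm ?z)\<^sup>2 \<le> s\<^sup>2 * (norm ?y)\<^sup>2"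
        by (metis norm_ge_zero power_mono power_mult_distrib)
      have zx: "inner ?z (x n) = (norm ?y)\<^sup>2"
        using aT by (simp add: cinner_cadjoint_left cinner_self flip: Re_cinner)
      have "(norm (?z - of_real (s\<^sup>2) *\<^sub>C x n))\<^sup>2 = (norm ?z)\<^sup>2 - 2 * s\<^sup>2 * (norm ?y)\<^sup>2 + (s\<^sup>2)\<^sup>2"
      proof -
        have "(norm (z - a *\<^sub>R u))\<^sup>2 = (norm z)\<^sup>2 - 2 * a * inner z u + a\<^sup>2 * (norm u)\<^sup>2"
          for z u :: 'a and a
          unfolding power2_norm_eq_inner
          by (simp add: inner_diff_left inner_diff_right inner_commute[of u z] power2_eq_square right_diff_distrib)
        then show ?thesis
          unfolding scaleC_of_real using zx x(2)[of n] by simp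
      qed
      also have "\<dots> \<le> s\<^sup>2 * (s\<^sup>2 - (norm ?y)\<^sup>2)"
        using z2 by (simp add: right_diff_distrib power2_eq_square)
      finally show ?thesis .
    qed
    have "(\<lambda>n. s\<^sup>2 * (s\<^sup>2 - (norm (blinfun_apply T (x n)))\<^sup>2)) \<longlonglongrightarrow> s\<^sup>2 * (s\<^sup>2 - s\<^sup>2)"
      by (intro tendsto_intros lim)
    then have lim0: "(\<lambda>n. s\<^sup>2 * (s\<^sup>2 - (norm (blinfun_apply T (x n)))\<^sup>2)) \<longlonglongrightarrow> 0" by simp
    have "(\<lambda>n. (norm (blinfun_apply ?S (x n) - of_real (s\<^sup>2) *\<^sub>C x n))\<^sup>2) \<longlonglongrightarrow> 0"
      by (rule tendsto_sandwich[OF _ _ tendsto_const lim0]) (use est in auto)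
    then show ?thesis
      using tendsto_real_sqrt tendsto_norm_zero_iff by fastforce
  qed
  moreover have "complex_of_real (s\<^sup>2) \<noteq> 0" using s by simp
  ultimately obtain r w where r: "strict_mono r" "(\<lambda>n. x (r n)) \<longlonglongrightarrow> w" "norm w = 1"
    "blinfun_apply ?S w = of_real (s\<^sup>2) *\<^sub>C w"
    using approximate_eigenvectors_subconverge[of ?S "of_real (s\<^sup>2)" x] x(2) by metis
  have "w \<in> M"
    by (rule closed_sequentially[OF M _ r(2)]) (rule x(1))
  moreover have "w \<noteq> 0" using r(3) by auto
  ultimately show ?thesis
    using that[of s w] s r bound by auto
qed

text \<open>On the top eigenspace of \<open>T\<^sup>*T\<close> the selfadjoint operator \<open>T + T\<^sup>*\<close> has an eigenvector, and on
  its eigenspace \<open>T\<close> satisfies a quadratic equation, which has a complex root.\<close>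

lemma compact_normal_has_norm_eigenvalue:
  assumes K: "T \<in> compact_operators" and nT: "normal_op T" and "T \<noteq> 0"
  obtains r where "r \<in> Eig T" and "cmod r = norm T"
proof -
  have aT: "adjointable T" using compact_operators_adjoint[OF K] by auto
  let ?Ta = "cadjoint T"
  have comm: "blinfun_apply ?Ta (blinfun_apply T v) = blinfun_apply T (blinfun_apply ?Ta v)" for v
    by (rule normal_op_apply[OF nT])
  obtain x0 where "blinfun_apply T x0 \<noteq> 0"
    using \<open>T \<noteq> 0\<close> by (metis blinfun_eqI zero_blinfun.rep_eq)
  then obtain s v0 where s: "s > 0" and v0: "v0 \<noteq> 0"
    "blinfun_apply ?Ta (blinfun_apply T v0) = of_real (s\<^sup>2) *\<^sub>C v0"
    and bound: "\<And>x. norm (blinfun_apply T x) \<le> s * norm x"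
    using compact_norm_attained[OF K, of UNIV x0] by auto
  define M where "M = {v. blinfun_apply (?Ta o\<^sub>L T) v = of_real (s\<^sup>2) *\<^sub>C v}"
  have M_iff: "v \<in> M \<longleftrightarrow> blinfun_apply ?Ta (blinfun_apply T v) = of_real (s\<^sup>2) *\<^sub>C v" for v
    by (simp add: M_def)
  have "closed M"
    unfolding M_def by (intro closed_Collect_eq blinfun.continuous_on continuous_on_scaleC continuous_intros)
  have Madd: "v + w \<in> M" if "v \<in> M" "w \<in> M" for v w
    using that by (simp add: M_iff blinfun.add_right scaleC_add_right)
  have Mscale: "c *\<^sub>C v \<in> M" if "v \<in> M" for v c
    using that aT by (simp add: M_iff adjointable_scaleC complex_vector.scale_left_commute)
  have MT: "blinfun_apply T v \<in> M" "blinfun_apply ?Ta v \<in> M" if "v \<in> M" for v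
    using that aT comm unfolding M_iff by (metis adjointable_scaleC adjointable_cadjoint)+
  define S where "S = T + ?Ta"
  have KS: "S \<in> compact_operators"
    unfolding S_def by (intro compact_operators_add compact_operators_adjoint K)
  have aS: "cadjoint S = S"
    unfolding S_def using aT by (simp add: cadjoint_add add.commute)
  have S: "blinfun_apply S v = blinfun_apply T v + blinfun_apply ?Ta v" for v
    by (simp add: S_def blinfun.add_left)
  have MS: "blinfun_apply S v \<in> M" if "v \<in> M" for v
    unfolding S using MT[OF that] Madd by blast
  have "\<exists>v b. v \<in> M \<and> v \<noteq> 0 \<and> blinfun_apply S v = of_real b *\<^sub>C v"
  proof (cases "\<exists>x\<in>M. blinfun_apply S x \<noteq> 0")
    case False
    then show ?thesis using v0 by (intro exI[of _ v0] exI[of _ 0]) (auto simp: M_iff)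
  next
    case True
    then obtain x1 where x1: "x1 \<in> M" "blinfun_apply S x1 \<noteq> 0" by blast
    obtain a v where a: "a > 0" and v: "v \<in> M" "v \<noteq> 0"
      and SS: "blinfun_apply S (blinfun_apply S v) = of_real (a\<^sup>2) *\<^sub>C v"
    proof (rule compact_norm_attained[OF KS \<open>closed M\<close> _ _ x1])
      show "r *\<^sub>R x \<in> M" if "x \<in> M" for r x
        using Mscale[OF that, of "of_real r"] by (simp add: scaleC_of_real)
    qed (auto simp: aS MS)
    \<comment> \<open>factor \<open>S\<^sup>2 - a\<^sup>2\<close> as \<open>(S - a) (S + a)\<close>\<close>
    define y where "y = blinfun_apply S v + of_real a *\<^sub>C v"
    show ?thesis
    proof (cases "y = 0")
      case True
      then have "blinfun_apply S v = of_real (- a) *\<^sub>C v"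
        unfolding y_def by (simp add: add_eq_0_iff2 complex_vector.scale_minus_left)
      then show ?thesis using v by blast
    next
      case False
      have "adjointable S" using compact_operators_adjoint[OF KS] by simp
      then have "blinfun_apply S y = of_real a *\<^sub>C y"
        unfolding y_def
        by (simp add: blinfun.add_right adjointable_scaleC SS scaleC_add_right scaleC_scaleC
            power2_eq_square add.commute)
      moreover have "y \<in> M"
        unfolding y_def by (intro Madd MS Mscale v)
      ultimately show ?thesis using False by blast
    qed
  qed
  then obtain v b where v: "v \<in> M" "v \<noteq> 0" and b: "blinfun_apply S v = of_real b *\<^sub>C v" by blast
  \<comment> \<open>on the common eigenspace \<open>T\<^sup>2 - b T + s\<^sup>2 = 0\<close>; \<open>r1\<close> and \<open>r2\<close> are the roots of this polynomial\<close>
  define d where "d = csqrt (of_real (b\<^sup>2 - 4 * s\<^sup>2))"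
  define r1 where "r1 = (of_real b + d) / 2"
  define r2 where "r2 = (of_real b - d) / 2"
  have d2: "d\<^sup>2 = of_real (b\<^sup>2 - 4 * s\<^sup>2)" by (simp add: d_def)
  have r: "r1 + r2 = of_real b" "r1 * r2 = of_real (s\<^sup>2)"
    using d2 by (simp_all add: r1_def r2_def field_simps power2_eq_square)
  have TT: "blinfun_apply T (blinfun_apply T v) = of_real b *\<^sub>C blinfun_apply T v - of_real (s\<^sup>2) *\<^sub>C v"
  proof -
    have "blinfun_apply T (blinfun_apply S v) = of_real b *\<^sub>C blinfun_apply T v"
      by (simp add: b adjointable_scaleC[OF aT])
    then show ?thesis
      using v(1) comm[of v] by (simp add: S blinfun.add_right M_iff eq_diff_eq)
  qed
  have "\<exists>w r. w \<in> M \<and> w \<noteq> 0 \<and> blinfun_apply T w = r *\<^sub>C w"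
  proof (cases "blinfun_apply T v = r2 *\<^sub>C v")
    case False
    define y where "y = blinfun_apply T v - r2 *\<^sub>C v"
    have "blinfun_apply T y = r1 *\<^sub>C y"
    proof -
      have "blinfun_apply T y = of_real b *\<^sub>C blinfun_apply T v - of_real (s\<^sup>2) *\<^sub>C v - r2 *\<^sub>C blinfun_apply T v"
        by (simp add: y_def blinfun.diff_right adjointable_scaleC[OF aT] TT)
      also have "\<dots> = r1 *\<^sub>C y"
        unfolding y_def r(1)[symmetric] r(2)[symmetric]
        by (simp add: scaleC_add_left complex_vector.scale_right_diff_distrib scaleC_scaleC)
      finally show ?thesis .
    qed
    moreover have "y \<in> M"
      unfolding y_def using Madd[OF MT(1)[OF v(1)] Mscale[OF v(1), of "- r2"]]
      by (simp add: complex_vector.scale_minus_left)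
    moreover have "y \<noteq> 0" using False by (simp add: y_def)
    ultimately show ?thesis by blast
  qed (use v in blast)
  then obtain w r where w: "w \<in> M" "w \<noteq> 0" "blinfun_apply T w = r *\<^sub>C w" by blast
  have "(norm (blinfun_apply T w))\<^sup>2 = s\<^sup>2 * (norm w)\<^sup>2"
    using norm_apply_sq[OF aT, of w] w(1) by (simp add: M_iff cinner_scaleC_right cinner_self del: of_real_power)
  then have "(cmod r)\<^sup>2 = s\<^sup>2"
    using w by (simp add: norm_scaleC power_mult_distrib)
  then have r_eq: "cmod r = s" using s by (simp add: power2_eq_iff_nonneg)
  have "norm T = s"
  proof (rule antisym)
    show "norm T \<le> s" using bound s by (intro norm_blinfun_bound) auto
    show "s \<le> norm T"
      using norm_blinfun[of T w] w r_eq by (simp add: norm_scaleC)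
  qed
  then show ?thesis
    using that[of r] w r_eq by (auto simp: Eig_def)
qed

lemma compact_normal_norm_le:
  assumes "T \<in> compact_operators" and "normal_op T" and "0 \<le> c"
    and "\<And>r. r \<in> Eig T \<Longrightarrow> cmod r \<le> c"
  shows "norm T \<le> c"
proof (cases "T = 0")
  case False
  then show ?thesis
    using compact_normal_has_norm_eigenvalue[OF assms(1,2)] assms(4) by metis
qed (use assms(3) in simp)

section \<open>Almost unitary families\<close>

lemma norm_add_le: "norm a \<le> r \<Longrightarrow> norm b \<le> s \<Longrightarrow> norm (a + b :: 'a::real_normed_vector) \<le> r + s"
  by (rule norm_triangle_mono)

lemma norm_diff_le: "norm a \<le> r \<Longrightarrow> norm b \<le> s \<Longrightarrow> norm (a - b :: 'a::real_normed_vector) \<le> r + s"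
  using norm_triangle_ineq4[of a b] by linarith

lemma norm_compose_le:
  "norm S \<le> r \<Longrightarrow> norm T \<le> s \<Longrightarrow> norm (S o\<^sub>L T) \<le> r * s"
  by (rule order_trans[OF norm_blinfun_compose], rule mult_mono') auto

lemma inner_ext: "(\<And>z. inner x z = inner y (z :: 'a::real_inner)) \<Longrightarrow> x = y"
  by (metis vector_eq_rdot)

lemma continuous_on_cadjoint:
  assumes cont: "continuous_on X F" and F: "\<And>x. x \<in> X \<Longrightarrow> adjointable (F x)"
  shows "continuous_on X (\<lambda>x. cadjoint (F x))"
proof -
  have "dist (cadjoint (F x)) (cadjoint (F y)) = dist (F x) (F y)" if "x \<in> X" "y \<in> X" for x y
    using F that by (simp add: dist_norm adjointable_diff flip: cadjoint_diff)
  then show ?thesis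
    using cont unfolding continuous_on tendsto_iff eventually_at_topological by simp
qed

text \<open>Newton's iteration for the unitary polar factor, in the form that avoids inverses: one step is a
  polynomial in \<open>U\<close> and its adjoint, and therefore preserves continuity and compact perturbations of the identity.\<close>

definition newton_schulz :: "('h::complex_hilbert_space \<Rightarrow>\<^sub>L 'h) \<Rightarrow> ('h \<Rightarrow>\<^sub>L 'h)" where
  "newton_schulz U = (3 / 2) *\<^sub>R U - (1 / 2) *\<^sub>R (U o\<^sub>L cadjoint U o\<^sub>L U)"

lemma newton_schulz_adjoint:
  assumes "adjointable U"
  shows "adjointable (newton_schulz U)"
    and "cadjoint (newton_schulz U) = newton_schulz (cadjoint U)"
proof -
  have "cadjoint U o\<^sub>L (U o\<^sub>L cadjoint U) = cadjoint U o\<^sub>L U o\<^sub>L cadjoint U"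
    by (rule blinfun_eqI) simp
  then show "adjointable (newton_schulz U)" "cadjoint (newton_schulz U) = newton_schulz (cadjoint U)"
    using assms unfolding newton_schulz_def
    by (simp_all add: adjointable_diff adjointable_scaleR adjointable_compose cadjoint_diff
        cadjoint_scaleR cadjoint_compose)
qed

text \<open>If \<open>U\<^sup>* U = 1 + E\<close>, one step changes the defect \<open>E\<close> to \<open>E\<^sup>3 / 4 - 3 E\<^sup>2 / 4\<close>: the linear term cancels.\<close>

lemma newton_schulz_defect_aux:
  assumes U: "adjointable U" and E: "norm ((cadjoint U o\<^sub>L U) - id_blinfun) \<le> \<delta>" and \<delta>: "\<delta> \<le> 1 / 2"
  shows "norm ((cadjoint (newton_schulz U) o\<^sub>L newton_schulz U) - id_blinfun) \<le> \<delta>\<^sup>2"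
proof -
  let ?E = "(cadjoint U o\<^sub>L U) - id_blinfun"
  have "(cadjoint (newton_schulz U) o\<^sub>L newton_schulz U) - id_blinfun
      = (1 / 4) *\<^sub>R (?E o\<^sub>L ?E o\<^sub>L ?E) - (3 / 4) *\<^sub>R (?E o\<^sub>L ?E)"
    unfolding newton_schulz_adjoint[OF U] unfolding newton_schulz_def
    using U by (intro blinfun_eqI, intro inner_ext[where 'a='a])
      (simp add: blinfun.bilinear_simps inner_add_left inner_diff_left field_simps)
  moreover have "norm \<dots> \<le> (1 / 4) * (\<delta> * \<delta> * \<delta>) + (3 / 4) * (\<delta> * \<delta>)"
    using E by (intro norm_diff_le) (auto intro!: norm_compose_le)
  moreover have "\<delta> * \<delta> * \<delta> \<le> \<delta> * \<delta> * 1"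
    using \<delta> E by (intro mult_left_mono) auto
  ultimately show ?thesis by (simp add: power2_eq_square)
qed

lemma newton_schulz_defect:
  assumes U: "adjointable U"
    and E: "norm ((cadjoint U o\<^sub>L U) - id_blinfun) \<le> \<delta>" "norm ((U o\<^sub>L cadjoint U) - id_blinfun) \<le> \<delta>"
    and \<delta>: "\<delta> \<le> 1 / 2"
  shows "norm ((cadjoint (newton_schulz U) o\<^sub>L newton_schulz U) - id_blinfun) \<le> \<delta> / 2"
    and "norm ((newton_schulz U o\<^sub>L cadjoint (newton_schulz U)) - id_blinfun) \<le> \<delta> / 2"
    and "norm (newton_schulz U - U) \<le> \<delta>"
proof -
  have "0 \<le> \<delta>" using E(1) norm_ge_zero order_trans by blast
  then have sq: "\<delta>\<^sup>2 \<le> \<delta> / 2" using mult_left_mono[OF \<delta>] by (simp add: power2_eq_square)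
  show "norm ((cadjoint (newton_schulz U) o\<^sub>L newton_schulz U) - id_blinfun) \<le> \<delta> / 2"
    using newton_schulz_defect_aux[OF U E(1) \<delta>] sq by linarith
  show "norm ((newton_schulz U o\<^sub>L cadjoint (newton_schulz U)) - id_blinfun) \<le> \<delta> / 2"
    using newton_schulz_defect_aux[of "cadjoint U" \<delta>] newton_schulz_adjoint[OF U]
      newton_schulz_adjoint[of "cadjoint U"] U E(2) \<delta> sq by simp
  have "norm (cadjoint U o\<^sub>L U) \<le> 4"
    using norm_triangle_ineq[of "(cadjoint U o\<^sub>L U) - id_blinfun" id_blinfun] E(1) \<delta>
      norm_blinfun_id_le[where 'a='a] by simp
  then have "norm U \<le> 2"
    using norm_cadjoint_compose_bound[OF U, of 4] power2_le_imp_le[of "norm U" 2] by simp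
  have "newton_schulz U - U = - (1 / 2) *\<^sub>R (U o\<^sub>L ((cadjoint U o\<^sub>L U) - id_blinfun))"
    unfolding newton_schulz_def
    by (intro blinfun_eqI, intro inner_ext[where 'a='a]) (simp add: blinfun.bilinear_simps inner_add_left inner_diff_left field_simps)
  also have "norm \<dots> = 1 / 2 * norm (U o\<^sub>L ((cadjoint U o\<^sub>L U) - id_blinfun))"
    by simp
  also have "\<dots> \<le> 1 / 2 * (2 * \<delta>)"
    by (intro mult_left_mono norm_compose_le \<open>norm U \<le> 2\<close> E) auto
  finally show "norm (newton_schulz U - U) \<le> \<delta>" by simp
qed

lemma compact_perturbation_compose:
  assumes "P - id_blinfun \<in> compact_operators" "Q - id_blinfun \<in> compact_operators" "adjointable Q"
  shows "(P o\<^sub>L Q) - id_blinfun \<in> compact_operators"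
proof -
  have "(P o\<^sub>L Q) - id_blinfun = ((P - id_blinfun) o\<^sub>L Q) + (Q - id_blinfun)"
    by (simp add: blinfun_compose.diff_left)
  also have "\<dots> \<in> compact_operators"
    by (intro compact_operators_add compact_operators_compose_right assms)
  finally show ?thesis .
qed

lemma newton_schulz_compact_perturbation:
  assumes U: "adjointable U" and K: "U - id_blinfun \<in> compact_operators"
  shows "newton_schulz U - id_blinfun \<in> compact_operators"
proof -
  have K': "cadjoint U - id_blinfun \<in> compact_operators"
    using compact_operators_adjoint(2)[OF K] U by (simp add: cadjoint_diff)
  have "newton_schulz U - id_blinfun
      = (3 / 2) *\<^sub>R (U - id_blinfun) - (1 / 2) *\<^sub>R ((U o\<^sub>L cadjoint U o\<^sub>L U) - id_blinfun)"
    unfolding newton_schulz_def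
    by (intro blinfun_eqI, intro inner_ext[where 'a='a]) (simp add: blinfun.bilinear_simps inner_add_left inner_diff_left field_simps)
  moreover have "(U o\<^sub>L cadjoint U o\<^sub>L U) - id_blinfun \<in> compact_operators"
    using U by (intro compact_perturbation_compose K K') auto
  ultimately show ?thesis
    using K by (simp only: compact_operators_diff compact_operators_scaleR)
qed

text \<open>The defect at least halves in each step, and each step moves \<open>U\<close> by at most the defect. So the iteration
  converges uniformly in the parameter, at total distance at most \<open>2 \<delta>\<close>.\<close>

lemma almost_unitary_family_near_unitary:
  fixes U :: "'x::topological_space \<Rightarrow> 'h::complex_hilbert_space \<Rightarrow>\<^sub>L 'h"
  assumes cont: "continuous_on X U" and U: "\<And>x. x \<in> X \<Longrightarrow> adjointable (U x)"
    and K: "\<And>x. x \<in> X \<Longrightarrow> U x - id_blinfun \<in> compact_operators"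
    and E1: "\<And>x. x \<in> X \<Longrightarrow> norm ((cadjoint (U x) o\<^sub>L U x) - id_blinfun) \<le> \<delta>"
    and E2: "\<And>x. x \<in> X \<Longrightarrow> norm ((U x o\<^sub>L cadjoint (U x)) - id_blinfun) \<le> \<delta>"
    and \<delta>: "0 < \<delta>" "\<delta> \<le> 1 / 2"
  obtains V where "continuous_on X V" and "\<And>x. x \<in> X \<Longrightarrow> unitary_op (V x)"
    and "\<And>x. x \<in> X \<Longrightarrow> adjointable (V x)"
    and "\<And>x. x \<in> X \<Longrightarrow> V x - id_blinfun \<in> compact_operators"
    and "\<And>x. x \<in> X \<Longrightarrow> norm (V x - U x) \<le> 2 * \<delta>"
proof -
  define N where "N k x = (newton_schulz ^^ k) (U x)" for k :: nat and x
  have N0: "N 0 x = U x" and NSuc: "N (Suc k) x = newton_schulz (N k x)" for k x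
    by (simp_all add: N_def)
  have inv: "adjointable (N k x) \<and> N k x - id_blinfun \<in> compact_operators \<and>
      norm ((cadjoint (N k x) o\<^sub>L N k x) - id_blinfun) \<le> \<delta> / 2 ^ k \<and>
      norm ((N k x o\<^sub>L cadjoint (N k x)) - id_blinfun) \<le> \<delta> / 2 ^ k" if x: "x \<in> X" for k x
  proof (induction k)
    case 0
    then show ?case using U K E1 E2 x by (simp add: N0)
  next
    case (Suc k)
    have "\<delta> / 2 ^ k \<le> \<delta> / 1" using \<delta>(1) by (intro divide_left_mono) auto
    then have "\<delta> / 2 ^ k \<le> 1 / 2" using \<delta> by linarith
    then show ?case
      using newton_schulz_defect[of "N k x" "\<delta> / 2 ^ k"] Suc newton_schulz_adjoint[of "N k x"]
        newton_schulz_compact_perturbation[of "N k x"] by (auto simp: NSuc mult.commute)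
  qed
  have step: "norm (N (Suc k) x - N k x) \<le> \<delta> / 2 ^ k" if x: "x \<in> X" for k x
  proof -
    have "\<delta> / 2 ^ k \<le> \<delta> / 1" using \<delta>(1) by (intro divide_left_mono) auto
    then have "\<delta> / 2 ^ k \<le> 1 / 2" using \<delta> by linarith
    then show ?thesis
      using newton_schulz_defect(3)[of "N k x" "\<delta> / 2 ^ k"] inv[OF x, of k] by (simp add: NSuc)
  qed
  have tele: "norm (N (k + j) x - N k x) \<le> 2 * \<delta> / 2 ^ k * (1 - 1 / 2 ^ j)" if x: "x \<in> X" for k j x
  proof (induction j)
    case (Suc j)
    have "norm (N (k + Suc j) x - N k x) \<le> norm (N (Suc (k + j)) x - N (k + j) x) + norm (N (k + j) x - N k x)"
      using norm_triangle_ineq[of "N (Suc (k + j)) x - N (k + j) x" "N (k + j) x - N k x"] by simp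
    also have "\<dots> \<le> \<delta> / 2 ^ (k + j) + 2 * \<delta> / 2 ^ k * (1 - 1 / 2 ^ j)"
      by (intro add_mono step[OF x] Suc.IH)
    also have "\<dots> = 2 * \<delta> / 2 ^ k * (1 - 1 / 2 ^ Suc j)"
      by (simp add: power_add field_simps)
    finally show ?case .
  qed simp
  have tele2: "norm (N (k + j) x - N k x) \<le> 2 * \<delta> / 2 ^ k" if x: "x \<in> X" for k j x
    using tele[OF x, of k j] mult_left_mono[of "1 - 1 / 2 ^ j" 1 "2 * \<delta> / 2 ^ k"] \<delta>(1) by simp
  have small: "\<exists>k. 2 * \<delta> / 2 ^ k < \<epsilon>" if "\<epsilon> > 0" for \<epsilon>
  proof -
    obtain k where "(1 / 2) ^ k < \<epsilon> / (2 * \<delta>)"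
      using real_arch_pow_inv[of "\<epsilon> / (2 * \<delta>)" "1 / 2"] \<open>\<epsilon> > 0\<close> \<delta>(1) by auto
    then show ?thesis using \<delta>(1) by (intro exI[of _ k]) (simp add: field_simps power_divide)
  qed
  have "Cauchy (\<lambda>k. N k x)" if x: "x \<in> X" for x
  proof (rule CauchyI')
    fix \<epsilon> :: real assume "\<epsilon> > 0"
    then obtain k where k: "2 * \<delta> / 2 ^ k < \<epsilon> / 2" using small[of "\<epsilon> / 2"] by auto
    have "dist (N m x) (N n x) < \<epsilon>" if "m \<ge> k" "n > m" for m n
      using tele2[OF x, of k "m - k"] tele2[OF x, of k "n - k"] that k
        norm_triangle_ineq4[of "N m x - N k x" "N n x - N k x"] by (simp add: dist_norm)
    then show "\<exists>M. \<forall>m\<ge>M. \<forall>n>m. dist (N m x) (N n x) < \<epsilon>" by blast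
  qed
  then have "\<exists>L. (\<lambda>k. N k x) \<longlonglongrightarrow> L" if "x \<in> X" for x
    using that Cauchy_convergent_iff convergent_def by blast
  then obtain V where V: "\<And>x. x \<in> X \<Longrightarrow> (\<lambda>k. N k x) \<longlonglongrightarrow> V x" by metis
  have VN: "norm (V x - N k x) \<le> 2 * \<delta> / 2 ^ k" if x: "x \<in> X" for k x
  proof (rule tendsto_upperbound)
    show "(\<lambda>j. norm (N (j + k) x - N k x)) \<longlonglongrightarrow> norm (V x - N k x)"
      by (intro tendsto_intros LIMSEQ_ignore_initial_segment V x)
    show "\<forall>\<^sub>F j in sequentially. norm (N (j + k) x - N k x) \<le> 2 * \<delta> / 2 ^ k"
      using tele2[OF x, of k] by (simp add: add.commute)
  qed auto
  show ?thesis
  proof (rule that)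
    show "norm (V x - U x) \<le> 2 * \<delta>" if "x \<in> X" for x
      using VN[OF that, of 0] by (simp add: N0)
    have aV: "adjointable (V x) \<and> (\<lambda>k. cadjoint (N k x)) \<longlonglongrightarrow> cadjoint (V x)" if "x \<in> X" for x
      using adjointable_limit[OF _ V[OF that]] inv[OF that] by blast
    then show "adjointable (V x)" if "x \<in> X" for x using that by blast
    show "V x - id_blinfun \<in> compact_operators" if "x \<in> X" for x
      by (rule closed_sequentially[OF closed_compact_operators, of "\<lambda>k. N k x - id_blinfun"])
         (use inv[OF that] V[OF that] in \<open>auto intro!: tendsto_intros\<close>)
    have d0: "(\<lambda>k. \<delta> / 2 ^ k) \<longlonglongrightarrow> 0"
      by (rule LIMSEQ_divide_realpow_zero) simp
    show "unitary_op (V x)" if x: "x \<in> X" for x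
    proof -
      have "(\<lambda>k. (cadjoint (N k x) o\<^sub>L N k x) - id_blinfun) \<longlonglongrightarrow> (cadjoint (V x) o\<^sub>L V x) - id_blinfun"
        using aV[OF x] by (intro tendsto_diff blinfun_compose.tendsto V x tendsto_const) auto
      moreover have "(\<lambda>k. (cadjoint (N k x) o\<^sub>L N k x) - id_blinfun) \<longlonglongrightarrow> 0"
        by (rule Lim_null_comparison[OF always_eventually d0]) (use inv[OF x] in auto)
      ultimately have 1: "(cadjoint (V x) o\<^sub>L V x) - id_blinfun = 0"
        by (rule LIMSEQ_unique)
      have "(\<lambda>k. (N k x o\<^sub>L cadjoint (N k x)) - id_blinfun) \<longlonglongrightarrow> (V x o\<^sub>L cadjoint (V x)) - id_blinfun"
        using aV[OF x] by (intro tendsto_diff blinfun_compose.tendsto V x tendsto_const) auto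
      moreover have "(\<lambda>k. (N k x o\<^sub>L cadjoint (N k x)) - id_blinfun) \<longlonglongrightarrow> 0"
        by (rule Lim_null_comparison[OF always_eventually d0]) (use inv[OF x] in auto)
      ultimately have 2: "(V x o\<^sub>L cadjoint (V x)) - id_blinfun = 0"
        by (rule LIMSEQ_unique)
      show ?thesis unfolding unitary_op_def using 1 2 by simp
    qed
    have contN: "continuous_on X (N k)" for k
    proof (induction k)
      case 0
      then show ?case using cont by (simp add: N_def)
    next
      case (Suc k)
      have "continuous_on X (\<lambda>x. newton_schulz (N k x))"
        unfolding newton_schulz_def
        by (intro continuous_on_diff continuous_on_scaleR continuous_on_const blinfun_compose.continuous_on
            Suc continuous_on_cadjoint) (use inv in blast)
      then show ?case by (simp add: NSuc)
    qed
    show "continuous_on X V"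
    proof (rule uniform_limit_theorem[of _ _ sequentially])
      show "uniform_limit X N V sequentially"
      proof (rule uniform_limitI)
        fix \<epsilon> :: real assume "\<epsilon> > 0"
        then obtain k0 where k0: "2 * \<delta> / 2 ^ k0 < \<epsilon>" using small by blast
        have "dist (N k x) (V x) < \<epsilon>" if "k \<ge> k0" "x \<in> X" for k x
        proof -
          have "2 * \<delta> / 2 ^ k \<le> 2 * \<delta> / 2 ^ k0"
            using that(1) \<delta>(1) by (intro divide_left_mono power_increasing) auto
          then show ?thesis
            using VN[OF that(2), of k] k0 by (simp add: dist_norm norm_minus_commute)
        qed
        then show "\<forall>\<^sub>F k in sequentially. \<forall>x\<in>X. dist (N k x) (V x) < \<epsilon>"
          unfolding eventually_sequentially by blast
      qed
    qed (use contN in auto)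
  qed
qed

section \<open>Unitary dilations in finite matrices\<close>

text \<open>This partial isometry makes the span of the second \<open>n\<close> basis vectors a copy of the span of the first \<open>n\<close>, which
  gives room for a dilation within finite matrices.\<close>

definition basis_shift :: "(nat \<Rightarrow> 'h::complex_hilbert_space) \<Rightarrow> nat \<Rightarrow> 'h \<Rightarrow>\<^sub>L 'h" where
  "basis_shift e n = (\<Sum>i<n. outer (e (i + n)) (e i))"

lemma basis_shift_compact [simp]: "basis_shift e n \<in> compact_operators"
  by (simp add: basis_shift_def compact_operators_sum)

lemma basis_shift_adjoint:
  "adjointable (basis_shift e n)" "cadjoint (basis_shift e n) = (\<Sum>i<n. outer (e i) (e (i + n)))"
  using adjointable_sum[of "{..<n}" "\<lambda>i. outer (e (i + n)) (e i)"] by (auto simp: basis_shift_def)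

lemma basis_shift_relations:
  assumes e: "orthonormal_basis e"
  shows "cadjoint (basis_shift e n) o\<^sub>L basis_shift e n = coord_proj e n"
    and "coord_proj e n o\<^sub>L basis_shift e n = 0"
    and "basis_shift e n o\<^sub>L coord_proj e n = basis_shift e n"
  unfolding basis_shift_adjoint(2) unfolding basis_shift_def
  by (intro blinfun_eqI;
      simp add: coord_proj_apply blinfun.sum_left blinfun.sum_right
        cinner_scaleC_right orthonormal_basis_cinner[OF e] if_distrib[of "\<lambda>c. c *\<^sub>C _"]
        if_distrib[of "\<lambda>c. _ * c"] cong: if_cong)+

text \<open>With respect to the decomposition into the ranges of \<open>p\<close>, of \<open>S p S\<^sup>*\<close> and the rest, the following
  operator is the block matrix with rows \<open>(a, d)\<close> and \<open>(d', - a\<^sup>*)\<close>, extended by the identity. If \<open>a\<close> is a contraction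
  and \<open>d\<close>, \<open>d'\<close> are the square roots of \<open>1 - a a\<^sup>*\<close>, \<open>1 - a\<^sup>* a\<close>, it is the unitary dilation of \<open>a\<close>.\<close>

definition block_dilation ::
  "('h::complex_hilbert_space \<Rightarrow>\<^sub>L 'h) \<Rightarrow> ('h \<Rightarrow>\<^sub>L 'h) \<Rightarrow> ('h \<Rightarrow>\<^sub>L 'h) \<Rightarrow> ('h \<Rightarrow>\<^sub>L 'h) \<Rightarrow> ('h \<Rightarrow>\<^sub>L 'h)
    \<Rightarrow> ('h \<Rightarrow>\<^sub>L 'h)" where
  "block_dilation p S a d d' = a + (d o\<^sub>L cadjoint S) + (S o\<^sub>L d')
     - (S o\<^sub>L cadjoint a o\<^sub>L cadjoint S) + (id_blinfun - p - (S o\<^sub>L cadjoint S))"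

text \<open>An orthogonal projection \<open>p\<close> and a partial isometry \<open>S\<close> from its range onto an orthogonal subspace.\<close>

locale block_decomposition =
  fixes p S :: "'h::complex_hilbert_space \<Rightarrow>\<^sub>L 'h"
  assumes adj: "adjointable p" "adjointable S"
    and p_adj: "cadjoint p = p" and pp: "p o\<^sub>L p = p"
    and SS: "cadjoint S o\<^sub>L S = p" and pS: "p o\<^sub>L S = 0" and Sp: "S o\<^sub>L p = S"
begin

lemma pointwise:
  "blinfun_apply p (blinfun_apply p x) = blinfun_apply p x"
  "blinfun_apply (cadjoint S) (blinfun_apply S x) = blinfun_apply p x"
  "blinfun_apply p (blinfun_apply S x) = 0"
  "blinfun_apply S (blinfun_apply p x) = blinfun_apply S x"
  "blinfun_apply (cadjoint S) (blinfun_apply p x) = 0"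
  "blinfun_apply p (blinfun_apply (cadjoint S) x) = blinfun_apply (cadjoint S) x"
  "blinfun_apply S (blinfun_apply S x) = 0"
  "blinfun_apply (cadjoint S) (blinfun_apply (cadjoint S) x) = 0"
proof -
  have "cadjoint (p o\<^sub>L S) = cadjoint S o\<^sub>L p" "cadjoint (S o\<^sub>L p) = p o\<^sub>L cadjoint S"
    using adj by (simp_all add: cadjoint_compose p_adj)
  then have Sp': "cadjoint S o\<^sub>L p = 0" and pS': "p o\<^sub>L cadjoint S = cadjoint S"
    by (simp_all add: pS Sp)
  show 1: "blinfun_apply p (blinfun_apply p x) = blinfun_apply p x"
   "blinfun_apply (cadjoint S) (blinfun_apply S x) = blinfun_apply p x"
   "blinfun_apply p (blinfun_apply S x) = 0"
   "blinfun_apply S (blinfun_apply p x) = blinfun_apply S x"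
   "blinfun_apply (cadjoint S) (blinfun_apply p x) = 0"
   "blinfun_apply p (blinfun_apply (cadjoint S) x) = blinfun_apply (cadjoint S) x" for x
    using pp SS pS Sp Sp' pS' by (metis blinfun_apply_blinfun_compose zero_blinfun.rep_eq)+
  show "blinfun_apply S (blinfun_apply S x) = 0"
    using 1(3,4) by (metis blinfun.zero_right)
  show "blinfun_apply (cadjoint S) (blinfun_apply (cadjoint S) x) = 0"
    using 1(5,6) by metis
qed

lemma norm_p: "norm p \<le> 1" and norm_S: "norm S \<le> 1" and norm_S_adj: "norm (cadjoint S) \<le> 1"
  and norm_rest: "norm (id_blinfun - p - (S o\<^sub>L cadjoint S)) \<le> 1"
proof -
  show p: "norm p \<le> 1" by (rule norm_projection_le_1[OF adj(1) p_adj pp])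
  have "(norm S)\<^sup>2 \<le> 1" using norm_cadjoint_compose_bound[OF adj(2)] SS p by simp
  then show "norm S \<le> 1" by (simp add: power_le_one_iff)
  then show "norm (cadjoint S) \<le> 1" using adj by simp
  show "norm (id_blinfun - p - (S o\<^sub>L cadjoint S)) \<le> 1"
    using adj
    by (intro norm_projection_le_1 blinfun_eqI)
       (simp_all add: adjointable_diff adjointable_compose cadjoint_diff cadjoint_compose p_adj
         blinfun.bilinear_simps pointwise)
qed

definition corner :: "('h \<Rightarrow>\<^sub>L 'h) \<Rightarrow> bool" where
  "corner a \<longleftrightarrow> adjointable a \<and> p o\<^sub>L a = a \<and> a o\<^sub>L p = a"

lemma corner_cadjoint: "corner a \<Longrightarrow> corner (cadjoint a)"
  unfolding corner_def using adj cadjoint_compose p_adj by (metis adjointable_cadjoint)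

lemma corner_pointwise:
  assumes "corner a"
  shows "blinfun_apply p (blinfun_apply a x) = blinfun_apply a x"
    and "blinfun_apply a (blinfun_apply p x) = blinfun_apply a x"
    and "blinfun_apply a (blinfun_apply S x) = 0"
    and "blinfun_apply (cadjoint S) (blinfun_apply a x) = 0"
proof -
  show 1: "blinfun_apply p (blinfun_apply a x) = blinfun_apply a x"
    "blinfun_apply a (blinfun_apply p x) = blinfun_apply a x" for x
    using assms unfolding corner_def by (metis blinfun_apply_blinfun_compose)+
  show "blinfun_apply a (blinfun_apply S x) = 0"
    using 1(2)[of "blinfun_apply S x"] by (simp add: pointwise blinfun.zero_right)
  show "blinfun_apply (cadjoint S) (blinfun_apply a x) = 0"
    using pointwise(5)[of "blinfun_apply a x"] by (simp add: 1)
qed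

lemma block_dilation_adjoint:
  assumes "adjointable a" "adjointable d" "adjointable d'" "cadjoint d = d" "cadjoint d' = d'"
  shows "adjointable (block_dilation p S a d d')"
    and "cadjoint (block_dilation p S a d d') = block_dilation p S (cadjoint a) d' d"
proof -
  have "S o\<^sub>L (a o\<^sub>L cadjoint S) = S o\<^sub>L a o\<^sub>L cadjoint S"
    by (rule blinfun_eqI) simp
  then show "adjointable (block_dilation p S a d d')"
    and "cadjoint (block_dilation p S a d d') = block_dilation p S (cadjoint a) d' d"
    using assms adj unfolding block_dilation_def
    by (simp_all add: adjointable_add adjointable_diff adjointable_compose cadjoint_add
        cadjoint_diff cadjoint_compose p_adj)
qed

text \<open>The summands of the defect are the entries of the block matrix of \<open>U\<^sup>* U - 1\<close>; the off-diagonal entries are adjoint to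
  each other.\<close>

lemma block_dilation_defect:
  assumes a: "corner a" and d: "corner d" "cadjoint d = d" and d': "corner d'" "cadjoint d' = d'"
    and 1: "norm ((cadjoint a o\<^sub>L a) + (d' o\<^sub>L d') - p) \<le> \<eta>"
    and 2: "norm ((a o\<^sub>L cadjoint a) + (d o\<^sub>L d) - p) \<le> \<eta>"
    and 3: "norm ((d o\<^sub>L a) - (a o\<^sub>L d')) \<le> \<eta>"
  shows "norm ((cadjoint (block_dilation p S a d d') o\<^sub>L block_dilation p S a d d') - id_blinfun) \<le> 4 * \<eta>"
proof -
  have adja: "adjointable a" "adjointable d" "adjointable d'"
    using a d d' by (auto simp: corner_def)
  have a': "corner (cadjoint a)" using corner_cadjoint[OF a] .
  have "cadjoint ((d o\<^sub>L a) - (a o\<^sub>L d')) = (cadjoint a o\<^sub>L d) - (d' o\<^sub>L cadjoint a)"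
    using adja d d' by (simp add: cadjoint_diff cadjoint_compose adjointable_compose)
  then have 4: "norm ((cadjoint a o\<^sub>L d) - (d' o\<^sub>L cadjoint a)) \<le> \<eta>"
    using 3 adja norm_cadjoint[of "(d o\<^sub>L a) - (a o\<^sub>L d')"]
    by (simp add: adjointable_diff adjointable_compose)
  have "(cadjoint (block_dilation p S a d d') o\<^sub>L block_dilation p S a d d') - id_blinfun
    = ((cadjoint a o\<^sub>L a) + (d' o\<^sub>L d') - p)
      + (S o\<^sub>L (((a o\<^sub>L cadjoint a) + (d o\<^sub>L d) - p) o\<^sub>L cadjoint S))
      + (((cadjoint a o\<^sub>L d) - (d' o\<^sub>L cadjoint a)) o\<^sub>L cadjoint S)
      + (S o\<^sub>L ((d o\<^sub>L a) - (a o\<^sub>L d')))"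
    unfolding block_dilation_adjoint(2)[OF adja d(2) d'(2)] unfolding block_dilation_def
    using adja
    by (intro blinfun_eqI)
       (simp add: blinfun.bilinear_simps pointwise corner_pointwise[OF a] corner_pointwise[OF a']
         corner_pointwise[OF d(1)] corner_pointwise[OF d'(1)])
  also have "norm \<dots> \<le> \<eta> + 1 * (\<eta> * 1) + \<eta> * 1 + 1 * \<eta>"
    by (intro norm_add_le norm_compose_le norm_S norm_S_adj 1 2 3 4)
  finally show ?thesis by simp
qed

lemma compress_corner: "adjointable W \<Longrightarrow> corner (p o\<^sub>L W o\<^sub>L p)"
  unfolding corner_def using adj
  by (auto intro!: blinfun_eqI adjointable_compose simp: pointwise)

lemma compress_cadjoint: "adjointable W \<Longrightarrow> cadjoint (p o\<^sub>L W o\<^sub>L p) = p o\<^sub>L cadjoint W o\<^sub>L p"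
  using adj by (auto intro!: blinfun_eqI simp: cadjoint_compose adjointable_compose p_adj)

text \<open>The difference is \<open>p X (1 - p) Y p\<close>.\<close>

lemma compress_mult:
  assumes "norm X \<le> 1" and "norm ((id_blinfun - p) o\<^sub>L Y o\<^sub>L p) \<le> \<eta>"
  shows "norm ((p o\<^sub>L (X o\<^sub>L Y) o\<^sub>L p) - ((p o\<^sub>L X o\<^sub>L p) o\<^sub>L (p o\<^sub>L Y o\<^sub>L p))) \<le> \<eta>"
proof -
  have "(p o\<^sub>L (X o\<^sub>L Y) o\<^sub>L p) - ((p o\<^sub>L X o\<^sub>L p) o\<^sub>L (p o\<^sub>L Y o\<^sub>L p))
      = p o\<^sub>L (X o\<^sub>L ((id_blinfun - p) o\<^sub>L Y o\<^sub>L p))"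
    by (intro blinfun_eqI) (simp add: blinfun.bilinear_simps pointwise)
  also have "norm \<dots> \<le> 1 * (1 * \<eta>)"
    by (intro norm_compose_le norm_p assms)
  finally show ?thesis by simp
qed

text \<open>Without the compressions the dilation would be exactly isometric. Each of the eight products in the block matrix of
  \<open>U\<^sup>* U\<close> contributes one compression error \<open>\<eta>\<close>.\<close>

lemma block_dilation_almost_isometry:
  assumes adjs: "adjointable W" "adjointable D" "adjointable D'" "cadjoint D = D" "cadjoint D' = D'"
    and le1: "norm W \<le> 1" "norm D \<le> 1" "norm D' \<le> 1"
    and W1: "(cadjoint W o\<^sub>L W) + (D' o\<^sub>L D') = id_blinfun"
    and W2: "(W o\<^sub>L cadjoint W) + (D o\<^sub>L D) = id_blinfun"
    and W3: "D o\<^sub>L W = W o\<^sub>L D'"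
    and small: "\<And>Y. Y \<in> {W, cadjoint W, D, D'} \<Longrightarrow> norm ((id_blinfun - p) o\<^sub>L Y o\<^sub>L p) \<le> \<eta>"
  defines "U \<equiv> block_dilation p S (p o\<^sub>L W o\<^sub>L p) (p o\<^sub>L D o\<^sub>L p) (p o\<^sub>L D' o\<^sub>L p)"
  shows "norm ((cadjoint U o\<^sub>L U) - id_blinfun) \<le> 8 * \<eta>"
proof -
  let ?c = "\<lambda>X. p o\<^sub>L X o\<^sub>L p"
  have "norm ((cadjoint U o\<^sub>L U) - id_blinfun) \<le> 4 * (2 * \<eta>)"
    unfolding U_def
  proof (rule block_dilation_defect)
    show "corner (?c W)" "corner (?c D)" "corner (?c D')"
      "cadjoint (?c D) = ?c D" "cadjoint (?c D') = ?c D'"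
      using adjs by (simp_all add: compress_corner compress_cadjoint)
    have leW: "norm (cadjoint W) \<le> 1" using adjs le1 by simp
    have mult: "norm ((?c X o\<^sub>L ?c Y) - ?c (X o\<^sub>L Y)) \<le> \<eta>"
      if "norm X \<le> 1" "Y \<in> {W, cadjoint W, D, D'}" for X Y
      using compress_mult[OF that(1) small[OF that(2)]] by (simp add: norm_minus_commute)
    have cadd: "?c (X + Y) = ?c X + ?c Y" for X Y
      by (simp add: blinfun_compose.add_left blinfun_compose.add_right)
    have cid: "?c id_blinfun = p" by (simp add: pp)
    have eq1: "?c (cadjoint W o\<^sub>L W) + ?c (D' o\<^sub>L D') = p"
      unfolding cadd[symmetric] W1 cid ..
    have eq2: "?c (W o\<^sub>L cadjoint W) + ?c (D o\<^sub>L D) = p"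
      unfolding cadd[symmetric] W2 cid ..
    have "norm (((?c (cadjoint W) o\<^sub>L ?c W) - ?c (cadjoint W o\<^sub>L W)) + ((?c D' o\<^sub>L ?c D') - ?c (D' o\<^sub>L D')))
        \<le> \<eta> + \<eta>"
      by (intro norm_add_le mult le1 leW) auto
    then show "norm ((cadjoint (?c W) o\<^sub>L ?c W) + (?c D' o\<^sub>L ?c D') - p) \<le> 2 * \<eta>"
      unfolding compress_cadjoint[OF adjs(1)] add_diff_add[symmetric] eq1 by simp
    have "norm (((?c W o\<^sub>L ?c (cadjoint W)) - ?c (W o\<^sub>L cadjoint W)) + ((?c D o\<^sub>L ?c D) - ?c (D o\<^sub>L D)))
        \<le> \<eta> + \<eta>"
      by (intro norm_add_le mult le1 leW) auto
    then show "norm ((?c W o\<^sub>L cadjoint (?c W)) + (?c D o\<^sub>L ?c D) - p) \<le> 2 * \<eta>"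
      unfolding compress_cadjoint[OF adjs(1)] add_diff_add[symmetric] eq2 by simp
    have "norm (((?c D o\<^sub>L ?c W) - ?c (D o\<^sub>L W)) - ((?c W o\<^sub>L ?c D') - ?c (W o\<^sub>L D'))) \<le> \<eta> + \<eta>"
      by (intro norm_diff_le mult le1) auto
    then show "norm ((?c D o\<^sub>L ?c W) - (?c W o\<^sub>L ?c D')) \<le> 2 * \<eta>"
      unfolding W3 by simp
  qed
  then show ?thesis by simp
qed

text \<open>If \<open>W\<close> intertwines \<open>A\<close> and \<open>B\<close>, and both are small where \<open>W\<close> fails to be isometric, then the dilation
  almost intertwines them.\<close>

lemma block_dilation_almost_intertwines:
  assumes adjs: "adjointable W"
    and le1: "norm W \<le> 1" "norm D \<le> 1" "norm D' \<le> 1"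
    and AW: "A o\<^sub>L W = W o\<^sub>L B" and AD: "norm (A o\<^sub>L D) \<le> \<epsilon>" and DB: "norm (D' o\<^sub>L B) \<le> \<epsilon>"
    and M: "norm A \<le> M" "norm B \<le> M"
    and small: "norm (A - (A o\<^sub>L p)) \<le> \<eta>" "norm (B - (p o\<^sub>L B)) \<le> \<eta>"
      "norm (W - (p o\<^sub>L W)) \<le> \<eta>" "norm (W - (W o\<^sub>L p)) \<le> \<eta>"
  defines "U \<equiv> block_dilation p S (p o\<^sub>L W o\<^sub>L p) (p o\<^sub>L D o\<^sub>L p) (p o\<^sub>L D' o\<^sub>L p)"
  shows "norm ((A o\<^sub>L U) - (U o\<^sub>L B)) \<le> 2 * \<epsilon> + (2 * M + 10) * \<eta>"
proof -
  let ?A = "A - (A o\<^sub>L p)" and ?B = "B - (p o\<^sub>L B)" and ?r = "id_blinfun - p - (S o\<^sub>L cadjoint S)"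
  let ?W1 = "W - (p o\<^sub>L W)" and ?W2 = "W - (W o\<^sub>L p)" and ?S = "cadjoint S"
  have AW': "blinfun_apply A (blinfun_apply W x) = blinfun_apply W (blinfun_apply B x)" for x
    using AW by (metis blinfun_apply_blinfun_compose)
  have Wa: "cadjoint (p o\<^sub>L W o\<^sub>L p) = p o\<^sub>L cadjoint W o\<^sub>L p" by (rule compress_cadjoint[OF adjs])
  have leW: "norm (cadjoint W) \<le> 1" using adjs le1 by simp
  \<comment> \<open>every term on the right contains one of the small operators \<open>?A\<close>, \<open>?B\<close>, \<open>?W1\<close>, \<open>?W2\<close>, \<open>A D\<close>, \<open>D' B\<close>\<close>
  have eq: "(A o\<^sub>L U) - (U o\<^sub>L B) =
      ((?W1 o\<^sub>L B) - (A o\<^sub>L ?W2)) - (?A o\<^sub>L (W o\<^sub>L p)) + (p o\<^sub>L (W o\<^sub>L ?B))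
      + (((A o\<^sub>L D) - (?A o\<^sub>L D)) o\<^sub>L ?S) + (?A o\<^sub>L (S o\<^sub>L (p o\<^sub>L (D' o\<^sub>L p))))
      - (?A o\<^sub>L (S o\<^sub>L (p o\<^sub>L (cadjoint W o\<^sub>L (p o\<^sub>L ?S))))) + (?A o\<^sub>L ?r)
      - (p o\<^sub>L (D o\<^sub>L (p o\<^sub>L (?S o\<^sub>L ?B)))) - (S o\<^sub>L ((D' o\<^sub>L B) - (D' o\<^sub>L ?B)))
      + (S o\<^sub>L (p o\<^sub>L (cadjoint W o\<^sub>L (p o\<^sub>L (?S o\<^sub>L ?B))))) - (?r o\<^sub>L ?B)"
    unfolding U_def block_dilation_def Wa
    by (intro blinfun_eqI) (simp add: blinfun.bilinear_simps pointwise AW')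
  have "norm ((A o\<^sub>L U) - (U o\<^sub>L B)) \<le> (\<eta> * M + M * \<eta>) + \<eta> * (1 * 1) + 1 * (1 * \<eta>)
      + (\<epsilon> + \<eta> * 1) * 1 + \<eta> * (1 * (1 * (1 * 1)))
      + \<eta> * (1 * (1 * (1 * (1 * 1)))) + \<eta> * 1
      + 1 * (1 * (1 * (1 * \<eta>))) + 1 * (\<epsilon> + 1 * \<eta>)
      + 1 * (1 * (1 * (1 * (1 * \<eta>)))) + 1 * \<eta>"
    unfolding eq
    by (intro norm_add_le norm_diff_le norm_compose_le small M AD DB le1 leW norm_p norm_S norm_S_adj norm_rest)
  then show ?thesis by (simp add: distrib_right)
qed

end

lemma block_decomposition_basis_shift:
  assumes "orthonormal_basis e"
  shows "block_decomposition (coord_proj e n) (basis_shift e n)"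
  by unfold_locales
     (auto simp: basis_shift_relations[OF assms] basis_shift_adjoint(1)
       coord_proj_coord_proj[OF assms order_refl] intro!: blinfun_eqI)

lemma compact_over_bounded:
  assumes "compact X" and "A \<in> compact_over e X"
  obtains M where "M \<ge> 1" and "\<And>x. x \<in> X \<Longrightarrow> norm (A x) \<le> M"
proof -
  have "bounded (A ` X)"
    by (intro compact_imp_bounded compact_continuous_image compact_over_continuous[OF assms(2)] assms(1))
  then obtain M where "\<And>x. x \<in> X \<Longrightarrow> norm (A x) \<le> M"
    by (auto simp: bounded_iff)
  then show ?thesis using that[of "max M 1"] by fastforce
qed

lemma norm_le_1_of_defect:
  assumes "adjointable W" "adjointable D" "cadjoint D = D"
    and "(cadjoint W o\<^sub>L W) + (D o\<^sub>L D) = id_blinfun"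
  shows "norm W \<le> 1" and "norm D \<le> 1"
proof -
  have *: "norm S \<le> 1"
    if "adjointable S" "adjointable T" "(cadjoint S o\<^sub>L S) + (cadjoint T o\<^sub>L T) = id_blinfun"
    for S T :: "'a \<Rightarrow>\<^sub>L 'a"
  proof (rule norm_blinfun_bound)
    fix x
    have sum: "blinfun_apply (cadjoint S) (blinfun_apply S x) + blinfun_apply (cadjoint T) (blinfun_apply T x) = x"
      using arg_cong[OF that(3), of "\<lambda>R. blinfun_apply R x"] by (simp add: blinfun.add_left)
    have "(norm (blinfun_apply S x))\<^sup>2 + (norm (blinfun_apply T x))\<^sup>2 = (norm x)\<^sup>2"
      using arg_cong[OF sum, of "\<lambda>y. Re (cinner x y)"]
      by (simp add: norm_apply_sq that(1,2) cinner_add_right cinner_self)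
    then have "(norm (blinfun_apply S x))\<^sup>2 \<le> (norm x)\<^sup>2"
      using zero_le_power2[of "norm (blinfun_apply T x)"] by linarith
    then show "norm (blinfun_apply S x) \<le> 1 * norm x"
      using power2_le_imp_le[of "norm (blinfun_apply S x)" "norm x"] by simp
  qed simp
  show "norm W \<le> 1" using *[of W D] assms by simp
  show "norm D \<le> 1" using *[of D W] assms by (simp add: add.commute)
qed

text \<open>The operators \<open>D\<close> and \<open>D'\<close> are compact perturbations of the identity, so compression to sufficiently many basis
  vectors almost preserves all relations, uniformly over \<open>X\<close>. The compressed dilation is then almost unitary and almost
  intertwining, and it remains to pass to a nearby unitary family.\<close>

proposition unitary_from_intertwiner:
  fixes A B W KA KB :: "'x::topological_space \<Rightarrow> 'h::complex_hilbert_space \<Rightarrow>\<^sub>L 'h"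
  assumes X: "compact X" and e: "orthonormal_basis e" and \<epsilon>: "0 < \<epsilon>"
    and A: "A \<in> compact_over e X" and B: "B \<in> compact_over e X" and W: "W \<in> compact_over e X"
    and KA: "KA \<in> compact_over e X" and KB: "KB \<in> compact_over e X"
    and KA_adj: "\<And>x. x \<in> X \<Longrightarrow> cadjoint (KA x) = KA x"
    and KB_adj: "\<And>x. x \<in> X \<Longrightarrow> cadjoint (KB x) = KB x"
  defines "D \<equiv> \<lambda>x. id_blinfun - KA x" and "D' \<equiv> \<lambda>x. id_blinfun - KB x"
  assumes W1: "\<And>x. x \<in> X \<Longrightarrow> (cadjoint (W x) o\<^sub>L W x) + (D' x o\<^sub>L D' x) = id_blinfun"
    and W2: "\<And>x. x \<in> X \<Longrightarrow> (W x o\<^sub>L cadjoint (W x)) + (D x o\<^sub>L D x) = id_blinfun"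
    and W3: "\<And>x. x \<in> X \<Longrightarrow> D x o\<^sub>L W x = W x o\<^sub>L D' x"
    and AW: "\<And>x. x \<in> X \<Longrightarrow> A x o\<^sub>L W x = W x o\<^sub>L B x"
    and AD: "\<And>x. x \<in> X \<Longrightarrow> norm (A x o\<^sub>L D x) \<le> \<epsilon>"
    and DB: "\<And>x. x \<in> X \<Longrightarrow> norm (D' x o\<^sub>L B x) \<le> \<epsilon>"
  obtains U where "continuous_on X U" and "(\<lambda>x. U x - id_blinfun) \<in> compact_over e X"
    and "\<And>x. x \<in> X \<Longrightarrow> unitary_op (U x)"
    and "\<And>x. x \<in> X \<Longrightarrow> norm (B x - (cadjoint (U x) o\<^sub>L A x o\<^sub>L U x)) \<le> 3 * \<epsilon>"
proof -
  obtain MA MB where "MA \<ge> 1" and MA: "\<And>x. x \<in> X \<Longrightarrow> norm (A x) \<le> MA"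
    and "MB \<ge> 1" and MB: "\<And>x. x \<in> X \<Longrightarrow> norm (B x) \<le> MB"
    using compact_over_bounded[OF X A] compact_over_bounded[OF X B] by metis
  define M where "M = max MA MB"
  have M1: "M \<ge> 1" using \<open>MA \<ge> 1\<close> by (simp add: M_def)
  have M: "norm (A x) \<le> M" "norm (B x) \<le> M" if "x \<in> X" for x
    using MA[OF that] MB[OF that] by (auto simp: M_def)
  \<comment> \<open>the dilation is unitary up to \<open>8 \<eta>\<close> and intertwines up to \<open>2 \<epsilon> + (2 M + 10) \<eta>\<close>; the unitary correction moves it by at most
    \<open>16 \<eta>\<close>, which costs another \<open>32 M \<eta>\<close>\<close>
  define \<eta> where "\<eta> = min (1 / 16) (\<epsilon> / (34 * M + 10))"
  have \<eta>: "\<eta> > 0" "8 * \<eta> \<le> 1 / 2" using \<epsilon> M1 by (auto simp: \<eta>_def)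
  have "(34 * M + 10) * \<eta> \<le> (34 * M + 10) * (\<epsilon> / (34 * M + 10))"
    unfolding \<eta>_def using M1 by (intro mult_left_mono) auto
  then have \<eta>M: "(34 * M + 10) * \<eta> \<le> \<epsilon>" using M1 by simp
  obtain N1 where
    N1: "\<And>n x. n \<ge> N1 \<Longrightarrow> x \<in> X \<Longrightarrow> norm (A x - (coord_proj e n o\<^sub>L A x)) \<le> \<eta>"
      "\<And>n x. n \<ge> N1 \<Longrightarrow> x \<in> X \<Longrightarrow> norm (A x - (A x o\<^sub>L coord_proj e n)) \<le> \<eta>"
    using compact_over_coord_proj[OF A e \<eta>(1)] by blast
  obtain N2 where
    N2: "\<And>n x. n \<ge> N2 \<Longrightarrow> x \<in> X \<Longrightarrow> norm (B x - (coord_proj e n o\<^sub>L B x)) \<le> \<eta>"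
      "\<And>n x. n \<ge> N2 \<Longrightarrow> x \<in> X \<Longrightarrow> norm (B x - (B x o\<^sub>L coord_proj e n)) \<le> \<eta>"
    using compact_over_coord_proj[OF B e \<eta>(1)] by blast
  obtain N3 where
    N3: "\<And>n x. n \<ge> N3 \<Longrightarrow> x \<in> X \<Longrightarrow> norm (W x - (coord_proj e n o\<^sub>L W x)) \<le> \<eta>"
      "\<And>n x. n \<ge> N3 \<Longrightarrow> x \<in> X \<Longrightarrow> norm (W x - (W x o\<^sub>L coord_proj e n)) \<le> \<eta>"
    using compact_over_coord_proj[OF W e \<eta>(1)] by blast
  obtain N4 where
    N4: "\<And>n x. n \<ge> N4 \<Longrightarrow> x \<in> X \<Longrightarrow> norm (KA x - (coord_proj e n o\<^sub>L KA x)) \<le> \<eta>"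
      "\<And>n x. n \<ge> N4 \<Longrightarrow> x \<in> X \<Longrightarrow> norm (KA x - (KA x o\<^sub>L coord_proj e n)) \<le> \<eta>"
    using compact_over_coord_proj[OF KA e \<eta>(1)] by blast
  obtain N5 where
    N5: "\<And>n x. n \<ge> N5 \<Longrightarrow> x \<in> X \<Longrightarrow> norm (KB x - (coord_proj e n o\<^sub>L KB x)) \<le> \<eta>"
      "\<And>n x. n \<ge> N5 \<Longrightarrow> x \<in> X \<Longrightarrow> norm (KB x - (KB x o\<^sub>L coord_proj e n)) \<le> \<eta>"
    using compact_over_coord_proj[OF KB e \<eta>(1)] by blast
  define N where "N = Max {N1, N2, N3, N4, N5}"
  have N: "N \<ge> N1" "N \<ge> N2" "N \<ge> N3" "N \<ge> N4" "N \<ge> N5"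
    unfolding N_def by (auto intro: Max_ge)
  define p where "p = coord_proj e N"
  define S where "S = basis_shift e N"
  interpret block_decomposition p S
    unfolding p_def S_def by (rule block_decomposition_basis_shift[OF e])
  have pS_K: "p \<in> compact_operators" "S \<in> compact_operators" by (simp_all add: p_def S_def)
  have adjs: "adjointable (A x)" "adjointable (B x)" "adjointable (W x)" "adjointable (KA x)" "adjointable (KB x)"
    "adjointable (D x)" "adjointable (D' x)" if "x \<in> X" for x
    using compact_over_pointwise[OF _ that] A B W KA KB compact_operators_adjoint(1)
    by (auto simp: D_def D'_def intro!: adjointable_diff)
  have D_adj: "cadjoint (D x) = D x" "cadjoint (D' x) = D' x" if "x \<in> X" for x
    using adjs[OF that] KA_adj[OF that] KB_adj[OF that] by (simp_all add: D_def D'_def cadjoint_diff)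
  have le1: "norm (W x) \<le> 1" "norm (D x) \<le> 1" "norm (D' x) \<le> 1" if x: "x \<in> X" for x
  proof -
    show "norm (W x) \<le> 1" "norm (D' x) \<le> 1"
      using norm_le_1_of_defect[of "W x" "D' x"] adjs[OF x] D_adj[OF x] W1[OF x] by auto
    show "norm (D x) \<le> 1"
      using norm_le_1_of_defect[of "cadjoint (W x)" "D x"] adjs[OF x] D_adj[OF x] W2[OF x] by auto
  qed
  have small: "norm ((id_blinfun - p) o\<^sub>L Y o\<^sub>L p) \<le> \<eta>"
    if x: "x \<in> X" and Y: "Y \<in> {W x, cadjoint (W x), D x, D' x}" for x Y
  proof -
    have *: "norm ((id_blinfun - p) o\<^sub>L Z o\<^sub>L p) \<le> \<eta>" if "norm (Z - (p o\<^sub>L Z)) \<le> \<eta>" for Z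
      using order_trans[OF norm_compose_contraction[OF norm_p] that]
      by (simp add: blinfun_compose.diff_left)
    have "norm (cadjoint (W x - (W x o\<^sub>L p))) \<le> \<eta>"
      using N3(2)[OF N(3) x] adjs(3)[OF x] adj(1)
      by (subst norm_cadjoint) (auto simp: p_def intro!: adjointable_diff adjointable_compose)
    then have W': "norm (cadjoint (W x) - (p o\<^sub>L cadjoint (W x))) \<le> \<eta>"
      using adjs(3)[OF x] adj(1) by (simp add: cadjoint_diff cadjoint_compose adjointable_compose p_adj)
    have D: "(id_blinfun - p) o\<^sub>L (id_blinfun - K) o\<^sub>L p = - ((id_blinfun - p) o\<^sub>L K o\<^sub>L p)" for K
      by (intro blinfun_eqI) (simp add: blinfun.bilinear_simps pointwise)
    show ?thesis
      using Y *[OF N3(1)[OF N(3) x, folded p_def]] *[OF W'] *[OF N4(1)[OF N(4) x, folded p_def]]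
        *[OF N5(1)[OF N(5) x, folded p_def]]
      by (auto simp: D_def D'_def D)
  qed
  define U where "U x = block_dilation p S (p o\<^sub>L W x o\<^sub>L p) (p o\<^sub>L D x o\<^sub>L p) (p o\<^sub>L D' x o\<^sub>L p)" for x
  have U_adj: "adjointable (U x)"
    "cadjoint (U x) = block_dilation p S (p o\<^sub>L cadjoint (W x) o\<^sub>L p) (p o\<^sub>L D' x o\<^sub>L p) (p o\<^sub>L D x o\<^sub>L p)"
    if x: "x \<in> X" for x
    using block_dilation_adjoint[of "p o\<^sub>L W x o\<^sub>L p" "p o\<^sub>L D x o\<^sub>L p" "p o\<^sub>L D' x o\<^sub>L p"]
      adjs[OF x] D_adj[OF x] adj unfolding U_def
    by (simp_all add: compress_cadjoint adjointable_compose)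
  have U1: "norm ((cadjoint (U x) o\<^sub>L U x) - id_blinfun) \<le> 8 * \<eta>" if x: "x \<in> X" for x
    unfolding U_def
    by (rule block_dilation_almost_isometry[OF adjs(3,6,7)[OF x] D_adj[OF x] le1[OF x]
          W1[OF x] W2[OF x] W3[OF x] small[OF x]])
  have U2: "norm ((U x o\<^sub>L cadjoint (U x)) - id_blinfun) \<le> 8 * \<eta>" if x: "x \<in> X" for x
  proof -
    let ?V = "block_dilation p S (p o\<^sub>L cadjoint (W x) o\<^sub>L p) (p o\<^sub>L D' x o\<^sub>L p) (p o\<^sub>L D x o\<^sub>L p)"
    have "cadjoint (D x o\<^sub>L W x) = cadjoint (W x o\<^sub>L D' x)" by (simp add: W3[OF x])
    then have "D' x o\<^sub>L cadjoint (W x) = cadjoint (W x) o\<^sub>L D x"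
      using adjs[OF x] D_adj[OF x] by (simp add: cadjoint_compose)
    moreover have "norm (cadjoint (W x)) \<le> 1" using le1[OF x] adjs[OF x] by simp
    ultimately have "norm ((cadjoint ?V o\<^sub>L ?V) - id_blinfun) \<le> 8 * \<eta>"
      using adjs[OF x] D_adj[OF x] le1[OF x] W1[OF x] W2[OF x] small[OF x]
      by (intro block_dilation_almost_isometry) auto
    then show ?thesis
      using U_adj[OF x] cadjoint_cadjoint by metis
  qed
  have U_K: "U x - id_blinfun \<in> compact_operators" if x: "x \<in> X" for x
  proof -
    have "U x - id_blinfun = (p o\<^sub>L W x o\<^sub>L p) + (p o\<^sub>L D x o\<^sub>L p o\<^sub>L cadjoint S) + (S o\<^sub>L (p o\<^sub>L D' x o\<^sub>L p))
        - (S o\<^sub>L cadjoint (p o\<^sub>L W x o\<^sub>L p) o\<^sub>L cadjoint S) - p - (S o\<^sub>L cadjoint S)"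
      unfolding U_def block_dilation_def by simp
    also have "\<dots> \<in> compact_operators"
      using adj adjs[OF x]
      by (intro compact_operators_add compact_operators_diff compact_operators_compose_right pS_K
          adjointable_compose adjointable_cadjoint)
    finally show ?thesis .
  qed
  have contD: "continuous_on X D" "continuous_on X D'"
    unfolding D_def D'_def by (intro continuous_intros compact_over_continuous[OF KA] compact_over_continuous[OF KB])+
  have contU: "continuous_on X U"
    unfolding U_def block_dilation_def
    using adj adjs
    by (intro continuous_on_add continuous_on_diff blinfun_compose.continuous_on continuous_on_const
        compact_over_continuous[OF W] contD continuous_on_cadjoint adjointable_compose)
  have "0 < 8 * \<eta>" using \<eta> by simp
  obtain V where contV: "continuous_on X V" and V_unitary: "\<And>x. x \<in> X \<Longrightarrow> unitary_op (V x)"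
    and V_adj: "\<And>x. x \<in> X \<Longrightarrow> adjointable (V x)"
    and V_K: "\<And>x. x \<in> X \<Longrightarrow> V x - id_blinfun \<in> compact_operators"
    and VU: "\<And>x. x \<in> X \<Longrightarrow> norm (V x - U x) \<le> 2 * (8 * \<eta>)"
    using almost_unitary_family_near_unitary[OF contU U_adj(1) U_K U1 U2 \<open>0 < 8 * \<eta>\<close> \<eta>(2)] by metis
  show ?thesis
  proof (rule that[OF contV _ V_unitary])
    show "(\<lambda>x. V x - id_blinfun) \<in> compact_over e X"
      using contV V_K by (auto simp: compact_over_iff[OF X e] intro!: continuous_intros)
    fix x assume x: "x \<in> X"
    have VV: "cadjoint (V x) o\<^sub>L V x = id_blinfun" using V_unitary[OF x] by (simp add: unitary_op_def)
    then have "(norm (V x))\<^sup>2 \<le> 1"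
      using norm_cadjoint_compose_bound[OF V_adj[OF x]] norm_blinfun_id_le by metis
    then have V1: "norm (cadjoint (V x)) \<le> 1"
      using V_adj[OF x] by (simp add: power_le_one_iff)
    have AU: "norm ((A x o\<^sub>L U x) - (U x o\<^sub>L B x)) \<le> 2 * \<epsilon> + (2 * M + 10) * \<eta>"
      unfolding U_def
      by (rule block_dilation_almost_intertwines[OF adjs(3)[OF x] le1[OF x] AW[OF x] AD[OF x] DB[OF x] M[OF x]
          N1(2)[OF N(1) x, folded p_def] N2(1)[OF N(2) x, folded p_def] N3[OF N(3) x, folded p_def]])
    have "norm (((A x o\<^sub>L U x) - (U x o\<^sub>L B x)) + (A x o\<^sub>L (V x - U x)) - ((V x - U x) o\<^sub>L B x))
        \<le> (2 * \<epsilon> + (2 * M + 10) * \<eta>) + M * (2 * (8 * \<eta>)) + (2 * (8 * \<eta>)) * M"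
      by (rule norm_diff_le[OF norm_add_le[OF AU]]) (intro norm_compose_le VU x M)+
    also have "\<dots> = 2 * \<epsilon> + (34 * M + 10) * \<eta>" by (simp add: algebra_simps)
    also have "\<dots> \<le> 3 * \<epsilon>" using \<eta>M by simp
    also have "((A x o\<^sub>L U x) - (U x o\<^sub>L B x)) + (A x o\<^sub>L (V x - U x)) - ((V x - U x) o\<^sub>L B x)
        = - ((V x o\<^sub>L B x) - (A x o\<^sub>L V x))"
      by (simp add: blinfun_compose.diff_left blinfun_compose.diff_right)
    finally have main: "norm ((V x o\<^sub>L B x) - (A x o\<^sub>L V x)) \<le> 3 * \<epsilon>" by (simp only: norm_minus_cancel)
    have "B x - (cadjoint (V x) o\<^sub>L A x o\<^sub>L V x) = cadjoint (V x) o\<^sub>L ((V x o\<^sub>L B x) - (A x o\<^sub>L V x))"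
    proof (rule blinfun_eqI)
      fix v
      have "blinfun_apply (cadjoint (V x)) (blinfun_apply (V x) w) = w" for w
        using VV by (metis blinfun_apply_blinfun_compose blinfun_apply_id_blinfun id_apply)
      then show "blinfun_apply (B x - (cadjoint (V x) o\<^sub>L A x o\<^sub>L V x)) v
          = blinfun_apply (cadjoint (V x) o\<^sub>L ((V x o\<^sub>L B x) - (A x o\<^sub>L V x))) v"
        by (simp add: blinfun.bilinear_simps)
    qed
    also have "norm \<dots> \<le> norm ((V x o\<^sub>L B x) - (A x o\<^sub>L V x))"
      by (rule norm_contraction_compose[OF V1])
    finally show "norm (B x - (cadjoint (V x) o\<^sub>L A x o\<^sub>L V x)) \<le> 3 * \<epsilon>"
      using main by linarith
  qed
qed

section \<open>Eigenvalue curves\<close>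

lemma multiplicity_free_eigenvectors:
  assumes T: "multiplicity_free T"
    and v: "blinfun_apply T v = \<mu> *\<^sub>C v" "v \<noteq> 0" and w: "blinfun_apply T w = \<mu> *\<^sub>C w"
  obtains c where "w = c *\<^sub>C v"
proof -
  have "\<mu> \<in> Eig T" using v by (auto simp: Eig_def)
  then have "cdim (eigenspace T \<mu>) = 1" using T by (simp add: multiplicity_free_def)
  then obtain B where B: "eigenspace T \<mu> \<subseteq> cspan B" "card B = 1"
    using complex_vector.basis_exists[of "eigenspace T \<mu>"] by (metis cdim_def cspan_def)
  then obtain b where b: "B = {b}" by (meson card_1_singletonE)
  have "v \<in> cspan {b}" "w \<in> cspan {b}"
    using B(1) v w by (auto simp: b eigenspace_def)
  then obtain k k' where k: "v = k *\<^sub>C b" "w = k' *\<^sub>C b"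
    by (auto simp: complex_vector.span_singleton)
  then have "w = (k' / k) *\<^sub>C v" using v(2) by (simp add: scaleC_scaleC)
  then show ?thesis using that by blast
qed

lemma unit_eigenvectors_phase:
  assumes T: "multiplicity_free T"
    and v: "blinfun_apply T v = \<mu> *\<^sub>C v" "norm v = 1" and w: "blinfun_apply T w = \<mu> *\<^sub>C w" "norm w = 1"
  obtains c where "w = c *\<^sub>C v" and "cmod c = 1"
proof -
  have "v \<noteq> 0" using v(2) by auto
  then obtain c where c: "w = c *\<^sub>C v"
    using multiplicity_free_eigenvectors[OF T v(1) _ w(1)] by blast
  moreover have "cmod c = 1" using v(2) w(2) by (simp add: c norm_scaleC)
  ultimately show ?thesis using that by blast
qed

lemma Eig_unit_eigenvector:
  assumes "adjointable T" "\<mu> \<in> Eig T"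
  shows "\<exists>v. norm v = 1 \<and> blinfun_apply T v = \<mu> *\<^sub>C v"
proof -
  obtain v where v: "v \<noteq> 0" "blinfun_apply T v = \<mu> *\<^sub>C v" using assms(2) by (auto simp: Eig_def)
  then show ?thesis
    using assms(1)
    by (intro exI[of _ "of_real (1 / norm v) *\<^sub>C v"])
      (simp add: norm_scaleC norm_divide adjointable_scaleC complex_vector.scale_left_commute)
qed

lemma Eig_norm_le: "\<mu> \<in> Eig T \<Longrightarrow> cmod \<mu> \<le> norm T"
proof -
  assume "\<mu> \<in> Eig T"
  then obtain v where v: "v \<noteq> 0" "blinfun_apply T v = \<mu> *\<^sub>C v" by (auto simp: Eig_def)
  then show ?thesis using norm_blinfun[of T v] by (simp add: norm_scaleC)
qed

text \<open>The curves take the value \<open>0\<close> outside the unit interval, so that a curve is determined by its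
  values on the interval, and sets of curves can serve as index sets.\<close>

definition eigenvalue_curves :: "(real \<Rightarrow> complex set) \<Rightarrow> (real \<Rightarrow> complex) set" where
  "eigenvalue_curves E =
     {l. continuous_on {0..1} l \<and> (\<forall>x\<in>{0..1}. l x \<in> E x) \<and> (\<forall>x. x \<notin> {0..1} \<longrightarrow> l x = 0)}"

text \<open>The last assumption is condition (1).\<close>

locale simple_spectrum_path =
  fixes A :: "real \<Rightarrow> 'h::complex_hilbert_space \<Rightarrow>\<^sub>L 'h"
  assumes cont: "continuous_on {0..1} A"
    and compact: "x \<in> {0..1} \<Longrightarrow> A x \<in> compact_operators"
    and normal: "x \<in> {0..1} \<Longrightarrow> normal_op (A x)"
    and simple: "x \<in> {0..1} \<Longrightarrow> multiplicity_free (A x)"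
    and nonzero: "x \<in> {0..1} \<Longrightarrow> 0 \<notin> Eig (A x)"
    and through: "x \<in> {0..1} \<Longrightarrow> \<mu> \<in> Eig (A x) \<Longrightarrow> \<exists>l\<in>eigenvalue_curves (\<lambda>x. Eig (A x)). l x = \<mu>"
begin

abbreviation "curves \<equiv> eigenvalue_curves (\<lambda>x. Eig (A x))"

lemma adj: "x \<in> {0..1} \<Longrightarrow> adjointable (A x)"
  using compact compact_operators_adjoint by blast

lemma curve_cont: "l \<in> curves \<Longrightarrow> continuous_on {0..1} l"
  and curve_Eig: "l \<in> curves \<Longrightarrow> x \<in> {0..1} \<Longrightarrow> l x \<in> Eig (A x)"
  by (auto simp: eigenvalue_curves_def)

lemma curve_nonzero: "l \<in> curves \<Longrightarrow> x \<in> {0..1} \<Longrightarrow> l x \<noteq> 0"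
  using curve_Eig nonzero by metis

lemma unit_eigenvectors_subconverge:
  assumes x: "\<And>n::nat. x n \<in> {0..1}" "x \<longlonglongrightarrow> x0" and m: "m \<longlonglongrightarrow> \<mu>" "\<mu> \<noteq> 0"
    and v: "\<And>n. norm (v n) = 1" "\<And>n. blinfun_apply (A (x n)) (v n) = m n *\<^sub>C v n"
  obtains r w where "strict_mono r" and "(\<lambda>n. v (r n)) \<longlonglongrightarrow> w" and "norm w = 1"
    and "blinfun_apply (A x0) w = \<mu> *\<^sub>C w" and "x0 \<in> {0..1}"
proof -
  have x0: "x0 \<in> {0..1}" using closed_sequentially[OF _ x(1) x(2)] by simp
  have lim: "(\<lambda>n. A (x n)) \<longlonglongrightarrow> A x0"
    by (rule continuous_on_tendsto_compose[OF cont x(2) x0]) (simp add: x(1)[simplified])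
  show ?thesis
    using eigenvectors_subconverge[OF compact[OF x0] m(2) v(1) lim m(1) v(2)] that x0 by blast
qed

text \<open>Eigenvectors of different eigenvalues are orthogonal, so their limits cannot lie in the same one-dimensional
  eigenspace.\<close>

lemma eigenvalues_do_not_merge:
  assumes x: "\<And>n::nat. x n \<in> {0..1}" "x \<longlonglongrightarrow> x0"
    and m: "\<And>n. m n \<in> Eig (A (x n))" "m \<longlonglongrightarrow> \<mu>" and k: "\<And>n. k n \<in> Eig (A (x n))" "k \<longlonglongrightarrow> \<mu>"
    and "\<mu> \<noteq> 0"
  shows "\<exists>n. m n = k n"
proof (rule ccontr)
  assume neq: "\<nexists>n. m n = k n"
  obtain v where v: "\<And>n. norm (v n) = 1" "\<And>n. blinfun_apply (A (x n)) (v n) = m n *\<^sub>C v n"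
    using Eig_unit_eigenvector[OF adj[OF x(1)] m(1)] by metis
  obtain w where w: "\<And>n. norm (w n) = 1" "\<And>n. blinfun_apply (A (x n)) (w n) = k n *\<^sub>C w n"
    using Eig_unit_eigenvector[OF adj[OF x(1)] k(1)] by metis
  have orth: "cinner (v n) (w n) = 0" for n
    using normal_op_eigenvectors_orthogonal[OF adj[OF x(1)] normal[OF x(1)] v(2) w(2)] neq by blast
  obtain r v0 where r: "strict_mono r" "(\<lambda>n. v (r n)) \<longlonglongrightarrow> v0" "norm v0 = 1"
    "blinfun_apply (A x0) v0 = \<mu> *\<^sub>C v0" "x0 \<in> {0..1}"
    by (rule unit_eigenvectors_subconverge[OF x m(2) \<open>\<mu> \<noteq> 0\<close> v])
  have xr: "(\<lambda>n. x (r n)) \<longlonglongrightarrow> x0" and kr: "(\<lambda>n. k (r n)) \<longlonglongrightarrow> \<mu>"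
    using LIMSEQ_subseq_LIMSEQ[OF x(2) r(1)] LIMSEQ_subseq_LIMSEQ[OF k(2) r(1)] by (simp_all add: o_def)
  obtain s w0 where s: "strict_mono s" "(\<lambda>n. w (r (s n))) \<longlonglongrightarrow> w0" "norm w0 = 1"
    "blinfun_apply (A x0) w0 = \<mu> *\<^sub>C w0"
    by (rule unit_eigenvectors_subconverge[OF x(1) xr kr \<open>\<mu> \<noteq> 0\<close> w])
  have "(\<lambda>n. v (r (s n))) \<longlonglongrightarrow> v0"
    using LIMSEQ_subseq_LIMSEQ[OF r(2) s(1)] by (simp add: o_def)
  then have "(\<lambda>n. cinner (v (r (s n))) (w (r (s n)))) \<longlonglongrightarrow> cinner v0 w0"
    by (intro tendsto_cinner s(2))
  then have "cinner v0 w0 = 0" by (simp add: orth LIMSEQ_const_iff)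
  moreover obtain c where "w0 = c *\<^sub>C v0" "cmod c = 1"
    by (rule unit_eigenvectors_phase[OF simple[OF r(5)] r(4,3) s(4,3)])
  ultimately show False
    using r(3) by (auto simp: cinner_scaleC_right)
qed

text \<open>The parameters where two curves agree form a closed set, and so do those where they differ, since
  eigenvalues do not merge; the interval is connected.\<close>

lemma curves_meeting_coincide:
  assumes l: "l \<in> curves" and m: "m \<in> curves" and x: "x \<in> {0..1}" "l x = m x"
  shows "l = m"
proof -
  let ?Z = "{y \<in> {0..1}. l y - m y = 0}" and ?N = "{y \<in> {0..1}. l y \<noteq> m y}"
  have "closed ?Z"
    by (intro continuous_closed_preimage_constant continuous_on_diff curve_cont l m) simp
  moreover have "closed ?N"
    unfolding closed_sequential_limits
  proof (intro allI impI)
    fix y y0 assume y: "(\<forall>n. y n \<in> ?N) \<and> y \<longlonglongrightarrow> y0"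
    then have y01: "\<And>n. y n \<in> {0..1}" "y \<longlonglongrightarrow> y0" and neq: "\<And>n. l (y n) \<noteq> m (y n)" by auto
    have y0: "y0 \<in> {0..1}" using closed_sequentially[OF _ y01] by simp
    have lim: "(\<lambda>n. f (y n)) \<longlonglongrightarrow> f y0" if "f \<in> curves" for f
      by (rule continuous_on_tendsto_compose[OF curve_cont[OF that] y01(2) y0]) (simp add: y01(1)[simplified])
    have "l y0 \<noteq> m y0"
    proof
      assume eq: "l y0 = m y0"
      have "\<exists>n. l (y n) = m (y n)"
        by (rule eigenvalues_do_not_merge[OF y01 _ lim[OF l] _ _ curve_nonzero[OF l y0]])
           (use lim[OF m] curve_Eig[OF l] curve_Eig[OF m] y01 eq in auto)
      then show False using neq by blast
    qed
    then show "y0 \<in> ?N" using y0 by auto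
  qed
  moreover have "connected {0..1::real}" by simp
  moreover have "{0..1} \<subseteq> ?Z \<union> ?N" "?Z \<inter> ?N \<inter> {0..1} = {}" "?Z \<inter> {0..1} \<noteq> {}" using x by auto
  ultimately have "?N \<inter> {0..1} = {}"
    unfolding connected_closed by blast
  then have "l y = m y" if "y \<in> {0..1}" for y using that by blast
  moreover have "l y = m y" if "y \<notin> {0..1}" for y
    using l m that by (auto simp: eigenvalue_curves_def)
  ultimately show ?thesis by blast
qed

text \<open>Infinitely many distinct curves with points of modulus at least \<open>\<epsilon>\<close> would accumulate at some
  eigenvalue; the curve through that eigenvalue would then meet infinitely many of them.\<close>

lemma finite_large_curves:
  assumes "\<epsilon> > 0"
  shows "finite {l \<in> curves. \<exists>x\<in>{0..1}. \<epsilon> \<le> cmod (l x)}"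
proof (rule ccontr)
  assume "infinite {l \<in> curves. \<exists>x\<in>{0..1}. \<epsilon> \<le> cmod (l x)}"
  then obtain f :: "nat \<Rightarrow> _" where f: "inj f" "range f \<subseteq> {l \<in> curves. \<exists>x\<in>{0..1}. \<epsilon> \<le> cmod (l x)}"
    using infinite_countable_subset by blast
  then have fc: "f n \<in> curves" for n by auto
  have "\<forall>n. \<exists>x\<in>{0..1}. \<epsilon> \<le> cmod (f n x)" using f(2) by auto
  then obtain x where x: "\<And>n. x n \<in> {0..1}" "\<And>n. \<epsilon> \<le> cmod (f n (x n))" by metis
  have "bounded (A ` {0..1})"
    by (intro compact_imp_bounded compact_continuous_image cont) simp
  then obtain M where M: "\<And>x. x \<in> {0..1} \<Longrightarrow> norm (A x) \<le> M" by (metis bounded_iff imageI)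
  have "(x n, f n (x n)) \<in> {0..1} \<times> cball 0 M" for n
    using x(1)[of n] Eig_norm_le[OF curve_Eig[OF fc x(1)], of n] M[OF x(1)[of n]] by (auto intro: order_trans)
  moreover have "seq_compact ({0..1::real} \<times> cball (0::complex) M)"
    by (intro compact_imp_seq_compact compact_Times) auto
  ultimately obtain p r where r: "strict_mono r" "((\<lambda>n. (x n, f n (x n))) \<circ> r) \<longlonglongrightarrow> p"
    using seq_compactE[of "{0..1::real} \<times> cball (0::complex) M" "\<lambda>n. (x n, f n (x n))"] by metis
  then have lim: "(\<lambda>n. x (r n)) \<longlonglongrightarrow> fst p" "(\<lambda>n. f (r n) (x (r n))) \<longlonglongrightarrow> snd p"
    using tendsto_fst[OF r(2)] tendsto_snd[OF r(2)] by (simp_all add: o_def)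
  have "\<epsilon> \<le> cmod (snd p)"
    by (rule tendsto_lowerbound[OF tendsto_norm[OF lim(2)]]) (use x(2) in auto)
  then have nz: "snd p \<noteq> 0" using \<open>\<epsilon> > 0\<close> by auto
  have "\<forall>n. \<exists>v. norm v = 1 \<and> blinfun_apply (A (x (r n))) v = f (r n) (x (r n)) *\<^sub>C v"
    by (intro allI Eig_unit_eigenvector[OF adj[OF x(1)] curve_Eig[OF fc x(1)]])
  then obtain v where v: "\<And>n. norm (v n) = 1"
    "\<And>n. blinfun_apply (A (x (r n))) (v n) = f (r n) (x (r n)) *\<^sub>C v n" by metis
  obtain s w where "norm w = 1" "blinfun_apply (A (fst p)) w = snd p *\<^sub>C w" and p01: "fst p \<in> {0..1}"
    by (rule unit_eigenvectors_subconverge[OF x(1) lim nz v])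
  moreover from this have "w \<noteq> 0" by auto
  ultimately have "snd p \<in> Eig (A (fst p))" unfolding Eig_def by blast
  then obtain l where l: "l \<in> curves" "l (fst p) = snd p" using through[OF p01] by blast
  have hit: "\<exists>n. f (q n) = l" if limq: "(\<lambda>n. x (q n)) \<longlonglongrightarrow> fst p"
    "(\<lambda>n. f (q n) (x (q n))) \<longlonglongrightarrow> snd p" for q
  proof -
    have "(\<lambda>n. l (x (q n))) \<longlonglongrightarrow> snd p"
      unfolding l(2)[symmetric]
      by (rule continuous_on_tendsto_compose[OF curve_cont[OF l(1)] limq(1) p01]) (simp add: x(1)[simplified])
    from eigenvalues_do_not_merge[OF x(1) limq(1) curve_Eig[OF fc x(1)] limq(2) curve_Eig[OF l(1) x(1)] this nz]
    obtain n where "f (q n) (x (q n)) = l (x (q n))" by blast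
    then show ?thesis using curves_meeting_coincide[OF fc l(1) x(1)] by blast
  qed
  obtain n1 where n1: "f (r n1) = l" using hit[OF lim] by blast
  \<comment> \<open>the tail of the subsequence beyond \<open>n1\<close> hits the same curve a second time, contradicting injectivity\<close>
  have tail: "(\<lambda>n. x (r (n + Suc n1))) \<longlonglongrightarrow> fst p" "(\<lambda>n. f (r (n + Suc n1)) (x (r (n + Suc n1)))) \<longlonglongrightarrow> snd p"
    using LIMSEQ_ignore_initial_segment[OF lim(1), of "Suc n1"] LIMSEQ_ignore_initial_segment[OF lim(2), of "Suc n1"] by auto
  obtain n2 where "f (r (n2 + Suc n1)) = l" using hit[OF tail] by blast
  then have "r (n2 + Suc n1) = r n1" using n1 f(1) by (metis injD)
  then show False using strict_mono_eq[OF r(1)] by simp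
qed

end

section \<open>Continuous eigenvectors\<close>

text \<open>A continuous path of rank one projections has a continuous unit section: near each point it is obtained
  by projecting a fixed vector, and sections over adjacent intervals are glued after adjusting a phase.\<close>

lemma rank_one_path_section:
  fixes w :: "real \<Rightarrow> 'h::complex_hilbert_space"
  assumes w: "\<And>x. x \<in> {0..1} \<Longrightarrow> norm (w x) = 1"
    and cont: "continuous_on {0..1} (\<lambda>x. outer (w x) (w x))"
  obtains v where "continuous_on {0..1} v" and "\<And>x. x \<in> {0..1} \<Longrightarrow> \<exists>c. cmod c = 1 \<and> v x = c *\<^sub>C w x"
proof -
  \<comment> \<open>sections exist with every prescribed phase at the left end, which is what gluing at the end of another interval requires\<close>
  define Q where "Q a b \<longleftrightarrow> (0 \<le> a \<longrightarrow> b \<le> 1 \<longrightarrow> (\<forall>c0. cmod c0 = 1 \<longrightarrow> (\<exists>v. continuous_on {a..b} v \<and>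
      (\<forall>x\<in>{a..b}. \<exists>c. cmod c = 1 \<and> v x = c *\<^sub>C w x) \<and> v a = c0 *\<^sub>C w a)))" for a b
  have "Q 0 1"
    using zero_le_one
  proof (induction rule: Bolzano)
    case (trans a b c)
    show ?case unfolding Q_def
    proof (intro impI allI)
      fix c0 assume *: "0 \<le> a" "c \<le> 1" "cmod c0 = 1"
      then obtain v1 where v1: "continuous_on {a..b} v1"
        "\<forall>x\<in>{a..b}. \<exists>c. cmod c = 1 \<and> v1 x = c *\<^sub>C w x" "v1 a = c0 *\<^sub>C w a"
        using trans unfolding Q_def by (meson order_trans)
      then obtain c1 where c1: "cmod c1 = 1" "v1 b = c1 *\<^sub>C w b"
        using trans by (metis atLeastAtMost_iff order_refl)
      then obtain v2 where v2: "continuous_on {b..c} v2"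
        "\<forall>x\<in>{b..c}. \<exists>c. cmod c = 1 \<and> v2 x = c *\<^sub>C w x" "v2 b = c1 *\<^sub>C w b"
        using trans * unfolding Q_def by (meson order_trans)
      let ?v = "\<lambda>x. if x \<le> b then v1 x else v2 x"
      have "continuous_on ({a..b} \<union> {b..c}) ?v"
        by (intro continuous_on_cases v1(1) v2(1)) (use c1 v2(3) in auto)
      moreover have "{a..b} \<union> {b..c} = {a..c}" using trans by auto
      ultimately show "\<exists>v. continuous_on {a..c} v \<and>
        (\<forall>x\<in>{a..c}. \<exists>c. cmod c = 1 \<and> v x = c *\<^sub>C w x) \<and> v a = c0 *\<^sub>C w a"
        using v1 v2 trans by (intro exI[of _ ?v]) auto
    qed
  next
    case (local x)
    then have x: "x \<in> {0..1}" by simp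
    obtain d where d: "d > 0" "\<And>y. y \<in> {0..1} \<Longrightarrow> \<bar>y - x\<bar> < d \<Longrightarrow>
        norm (outer (w y) (w y) - outer (w x) (w x)) < 1 / 2"
      using cont x unfolding continuous_on_iff dist_norm real_norm_def
      by (meson half_gt_zero zero_less_one)
    show ?case
    proof (intro exI[of _ d] conjI d(1) allI impI)
      fix a b assume ab: "a \<le> x \<and> x \<le> b \<and> b - a < d"
      show "Q a b" unfolding Q_def
      proof (intro impI allI)
        fix c0 assume *: "0 \<le> a" "b \<le> 1" "cmod c0 = 1"
        define g where "g y = cinner (w y) (w x)" for y
        have pr: "blinfun_apply (outer (w y) (w y)) (w x) = g y *\<^sub>C w y" for y by (simp add: g_def)
        have g: "g y \<noteq> 0" if y: "y \<in> {a..b}" for y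
        proof
          assume "g y = 0"
          then have "blinfun_apply (outer (w y) (w y) - outer (w x) (w x)) (w x) = - w x"
            using pr[of y] cinner_self[of "w x"] w[OF x] by (simp add: blinfun.diff_left)
          then have "1 \<le> norm (outer (w y) (w y) - outer (w x) (w x))"
            using norm_blinfun[of "outer (w y) (w y) - outer (w x) (w x)" "w x"] w[OF x] by simp
          moreover have "\<bar>y - x\<bar> < d" using y ab by (auto simp: abs_less_iff)
          ultimately show False using d(2)[of y] y * by auto
        qed
        define u where "u y = (1 / norm (g y *\<^sub>C w y)) *\<^sub>R (g y *\<^sub>C w y)" for y
        have u: "u y = (g y / cmod (g y)) *\<^sub>C w y" if "y \<in> {a..b}" for y
          using w[of y] that *
          by (simp add: u_def norm_scaleC scaleC_of_real[symmetric] scaleC_scaleC del: scaleC_of_real)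
        have cg: "continuous_on {a..b} (\<lambda>y. g y *\<^sub>C w y)"
          unfolding pr[symmetric] using *
          by (intro blinfun.continuous_on continuous_on_const continuous_on_subset[OF cont]) auto
        have cu: "continuous_on {a..b} u"
          unfolding u_def using g w *
          by (intro continuous_on_scaleR continuous_on_divide continuous_on_const continuous_on_norm cg)
             (auto simp: norm_scaleC)
        define c1 where "c1 = c0 * cmod (g a) / g a"
        have ga: "g a \<noteq> 0" using g[of a] ab by auto
        have c1: "cmod c1 = 1" using ga *(3) by (simp add: c1_def norm_mult norm_divide)
        show "\<exists>v. continuous_on {a..b} v \<and> (\<forall>x\<in>{a..b}. \<exists>c. cmod c = 1 \<and> v x = c *\<^sub>C w x) \<and> v a = c0 *\<^sub>C w a"
        proof (intro exI[of _ "\<lambda>y. c1 *\<^sub>C u y"] conjI ballI)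
          show "continuous_on {a..b} (\<lambda>y. c1 *\<^sub>C u y)"
            by (intro continuous_on_scaleC continuous_on_const cu)
          show "c1 *\<^sub>C u a = c0 *\<^sub>C w a"
            using u[of a] ga ab by (simp add: c1_def scaleC_scaleC)
          fix y assume y: "y \<in> {a..b}"
          show "\<exists>c. cmod c = 1 \<and> c1 *\<^sub>C u y = c *\<^sub>C w y"
            by (intro exI[of _ "c1 * (g y / cmod (g y))"])
               (use u[OF y] g[OF y] c1 in \<open>simp add: scaleC_scaleC norm_mult norm_divide\<close>)
        qed
      qed
    qed
  qed
  then obtain v where "continuous_on {0..1} v" "\<forall>x\<in>{0..1}. \<exists>c. cmod c = 1 \<and> v x = c *\<^sub>C w x"
    unfolding Q_def by (metis norm_one order_refl)
  then show ?thesis using that by blast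
qed

context simple_spectrum_path
begin

text \<open>The rank one projections onto the eigenspaces along a curve are continuous, because every sequence of unit
  eigenvectors subconverges to a unit eigenvector, which is unique up to a phase.\<close>

lemma continuous_unit_eigenvector:
  assumes l: "l \<in> curves"
  obtains v where "continuous_on {0..1} v" and "\<And>x. x \<in> {0..1} \<Longrightarrow> norm (v x) = 1"
    and "\<And>x. x \<in> {0..1} \<Longrightarrow> blinfun_apply (A x) (v x) = l x *\<^sub>C v x"
proof -
  have "\<forall>x. \<exists>v. x \<in> {0..1} \<longrightarrow> norm v = 1 \<and> blinfun_apply (A x) v = l x *\<^sub>C v"
    using Eig_unit_eigenvector[OF adj curve_Eig[OF l]] by metis
  then obtain w where w: "\<And>x. x \<in> {0..1} \<Longrightarrow> norm (w x) = 1"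
    "\<And>x. x \<in> {0..1} \<Longrightarrow> blinfun_apply (A x) (w x) = l x *\<^sub>C w x" by metis
  let ?P = "\<lambda>x. outer (w x) (w x)"
  have "continuous_on {0..1} ?P"
    unfolding continuous_on_sequentially o_def
  proof (intro allI ballI impI)
    fix x :: "nat \<Rightarrow> real" and a assume a: "a \<in> {0..1}" and *: "(\<forall>n. x n \<in> {0..1}) \<and> x \<longlonglongrightarrow> a"
    then have x: "\<And>n. x n \<in> {0..1}" "x \<longlonglongrightarrow> a" by auto
    show "(\<lambda>n. ?P (x n)) \<longlonglongrightarrow> ?P a"
    proof (rule ccontr)
      assume "\<not> (\<lambda>n. ?P (x n)) \<longlonglongrightarrow> ?P a"
      then obtain \<epsilon> where "\<epsilon> > 0" "\<not> (\<forall>\<^sub>F n in sequentially. dist (?P (x n)) (?P a) < \<epsilon>)"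
        by (auto simp: tendsto_iff)
      then obtain r where r: "strict_mono r" "\<And>n::nat. \<not> dist (?P (x (r n))) (?P a) < \<epsilon>"
        using not_eventually_sequentiallyD by fast
      have xr: "(\<lambda>n. x (r n)) \<longlonglongrightarrow> a"
        using LIMSEQ_subseq_LIMSEQ[OF x(2) r(1)] by (simp add: o_def)
      have lr: "(\<lambda>n. l (x (r n))) \<longlonglongrightarrow> l a"
        by (rule continuous_on_tendsto_compose[OF curve_cont[OF l] xr a]) (simp add: x(1)[simplified])
      obtain s w0 where s: "strict_mono s" "(\<lambda>n. w (x (r (s n)))) \<longlonglongrightarrow> w0" "norm w0 = 1"
        "blinfun_apply (A a) w0 = l a *\<^sub>C w0"
        by (rule unit_eigenvectors_subconverge[OF x(1) xr lr curve_nonzero[OF l a] w(1)[OF x(1)] w(2)[OF x(1)]])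
      obtain c where c: "w0 = c *\<^sub>C w a" "cmod c = 1"
        by (rule unit_eigenvectors_phase[OF simple[OF a] w(2)[OF a] w(1)[OF a] s(4,3)])
      have "outer w0 w0 = ?P a"
        using c(2) complex_norm_square[of c] by (simp add: c(1) outer_scaleC_left scaleC_scaleC mult.commute)
      then have "(\<lambda>n. ?P (x (r (s n)))) \<longlonglongrightarrow> ?P a"
        using tendsto_outer[OF s(2) s(2)] by simp
      then show False
        using r(2) \<open>\<epsilon> > 0\<close> unfolding tendsto_iff by (metis (mono_tags, lifting) eventually_sequentially order_refl)
    qed
  qed
  then obtain v where v: "continuous_on {0..1} v" "\<And>x. x \<in> {0..1} \<Longrightarrow> \<exists>c. cmod c = 1 \<and> v x = c *\<^sub>C w x"
    using rank_one_path_section[of w] w(1) by blast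
  show ?thesis
  proof (rule that[OF v(1)])
    fix x :: real assume x: "x \<in> {0..1}"
    then obtain c where "cmod c = 1" "v x = c *\<^sub>C w x" using v(2) by blast
    then show "norm (v x) = 1" "blinfun_apply (A x) (v x) = l x *\<^sub>C v x"
      using w[OF x] adj[OF x] by (simp_all add: norm_scaleC adjointable_scaleC complex_vector.scale_left_commute)
  qed
qed

end

section \<open>Monodromy\<close>

text \<open>The curve that continues \<open>l\<close> when the parameter runs around the circle a second time.\<close>

definition monodromy :: "(real \<Rightarrow> complex set) \<Rightarrow> (real \<Rightarrow> complex) \<Rightarrow> real \<Rightarrow> complex" where
  "monodromy E l = (SOME m. m \<in> eigenvalue_curves E \<and> m 0 = l 1)"

locale simple_spectrum_loop = simple_spectrum_path +
  assumes closed_up: "A 0 = A 1"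
begin

abbreviation "\<sigma> \<equiv> monodromy (\<lambda>x. Eig (A x))"

lemma monodromy:
  assumes "l \<in> curves"
  shows "\<sigma> l \<in> curves" and "\<sigma> l 0 = l 1"
proof -
  have "\<exists>m. m \<in> curves \<and> m 0 = l 1"
    using through[of 0 "l 1"] curve_Eig[OF assms, of 1] closed_up by auto
  then have "\<sigma> l \<in> curves \<and> \<sigma> l 0 = l 1"
    unfolding monodromy_def by (rule someI_ex)
  then show "\<sigma> l \<in> curves" "\<sigma> l 0 = l 1" by auto
qed

lemma inj_on_monodromy: "inj_on \<sigma> curves"
proof (rule inj_onI)
  fix l m assume lm: "l \<in> curves" "m \<in> curves" "\<sigma> l = \<sigma> m"
  then have "l 1 = m 1" using monodromy(2) by metis
  then show "l = m" using curves_meeting_coincide[OF lm(1,2), of 1] by simp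
qed

lemma monodromy_surj:
  assumes m: "m \<in> curves"
  obtains l where "l \<in> curves" and "\<sigma> l = m"
proof -
  have "m 0 \<in> Eig (A 1)" using curve_Eig[OF m, of 0] closed_up by simp
  then obtain l where l: "l \<in> curves" "l 1 = m 0" using through[of 1] by auto
  have "\<sigma> l = m"
    using curves_meeting_coincide[OF monodromy(1)[OF l(1)] m, of 0] monodromy(2)[OF l(1)] l(2) by simp
  then show ?thesis using that l(1) by blast
qed

definition eigenframe :: "((real \<Rightarrow> complex) \<Rightarrow> real \<Rightarrow> 'a) \<Rightarrow> bool" where
  "eigenframe f \<longleftrightarrow> (\<forall>l\<in>curves. continuous_on {0..1} (f l) \<and>
     (\<forall>x\<in>{0..1}. norm (f l x) = 1 \<and> blinfun_apply (A x) (f l x) = l x *\<^sub>C f l x) \<and> f l 1 = f (\<sigma> l) 0)"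

text \<open>At the end of a curve, the eigenvector differs from the initial one of the successor by a phase \<open>exp (i t)\<close>. Turning
  the eigenvectors along the curve by \<open>exp (- i t x)\<close> removes it without changing the initial vectors.\<close>

lemma eigenframe_exists: "\<exists>f. eigenframe f"
proof -
  have "\<forall>l. \<exists>v. l \<in> curves \<longrightarrow> continuous_on {0..1} v \<and>
      (\<forall>x\<in>{0..1}. norm (v x) = 1 \<and> blinfun_apply (A x) (v x) = l x *\<^sub>C v x)"
    using continuous_unit_eigenvector by metis
  then obtain v where v: "\<And>l. l \<in> curves \<Longrightarrow> continuous_on {0..1} (v l)"
    "\<And>l x. l \<in> curves \<Longrightarrow> x \<in> {0..1} \<Longrightarrow> norm (v l x) = 1"
    "\<And>l x. l \<in> curves \<Longrightarrow> x \<in> {0..1} \<Longrightarrow> blinfun_apply (A x) (v l x) = l x *\<^sub>C v l x"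
    by metis
  have "\<exists>t. v l 1 = exp (\<i> * of_real t) *\<^sub>C v (\<sigma> l) 0" if l: "l \<in> curves" for l
  proof -
    have 0: "(0::real) \<in> {0..1}" and 1: "(1::real) \<in> {0..1}" by auto
    have "blinfun_apply (A 0) (v l 1) = \<sigma> l 0 *\<^sub>C v l 1"
      using v(3)[OF l 1] closed_up monodromy(2)[OF l] by simp
    then obtain c where "v l 1 = c *\<^sub>C v (\<sigma> l) 0" "cmod c = 1"
      using unit_eigenvectors_phase[OF simple[OF 0] v(3)[OF monodromy(1)[OF l] 0] v(2)[OF monodromy(1)[OF l] 0]]
        v(2)[OF l 1] by metis
    then show ?thesis using complex_norm_eq_1_exp[of c] by metis
  qed
  then obtain t where t: "\<And>l. l \<in> curves \<Longrightarrow> v l 1 = exp (\<i> * of_real (t l)) *\<^sub>C v (\<sigma> l) 0" by metis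
  define f where "f l x = exp (- (\<i> * of_real (t l * x))) *\<^sub>C v l x" for l x
  have "eigenframe f"
    unfolding eigenframe_def
  proof (intro ballI conjI)
    fix l assume l: "l \<in> curves"
    show "continuous_on {0..1} (f l)"
      unfolding f_def by (intro continuous_on_scaleC v(1) l continuous_intros)
    show "f l 1 = f (\<sigma> l) 0"
      using t[OF l] by (simp add: f_def scaleC_scaleC flip: exp_add)
    fix x :: real assume x: "x \<in> {0..1}"
    show "norm (f l x) = 1" using v(2)[OF l x] by (simp add: f_def norm_scaleC)
    show "blinfun_apply (A x) (f l x) = l x *\<^sub>C f l x"
      using v(3)[OF l x] adj[OF x] by (simp add: f_def adjointable_scaleC complex_vector.scale_left_commute)
  qed
  then show ?thesis by blast
qed

lemma eigenframe_orthonormal: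
  assumes f: "eigenframe f" and l: "l \<in> curves" and m: "m \<in> curves" and x: "x \<in> {0..1}"
  shows "cinner (f l x) (f m x) = (if l = m then 1 else 0)"
proof (cases "l = m")
  case True
  then show ?thesis using f l x by (simp add: eigenframe_def cinner_self)
next
  case False
  then have "l x \<noteq> m x" using curves_meeting_coincide[OF l m x] by blast
  then show ?thesis
    using False f l m x normal_op_eigenvectors_orthogonal[OF adj[OF x] normal[OF x], of "f l x" "l x" "f m x" "m x"]
    by (simp add: eigenframe_def)
qed

end

section \<open>Diagonal operators\<close>

definition diagonal_op :: "'i set \<Rightarrow> ('i \<Rightarrow> complex) \<Rightarrow> ('i \<Rightarrow> 'h::complex_hilbert_space) \<Rightarrow> ('i \<Rightarrow> 'h) \<Rightarrow> 'h \<Rightarrow>\<^sub>L 'h" where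
  "diagonal_op F t u v = (\<Sum>i\<in>F. outer (t i *\<^sub>C u i) (v i))"

lemma diagonal_op_compact: "diagonal_op F t u v \<in> compact_operators"
  by (simp add: diagonal_op_def compact_operators_sum)

lemma diagonal_op_adjoint:
  "adjointable (diagonal_op F t u v)"
  "cadjoint (diagonal_op F t u v) = diagonal_op F (\<lambda>i. cnj (t i)) v u"
  using adjointable_sum[of F "\<lambda>i. outer (t i *\<^sub>C u i) (v i)"]
    outer_scaleC_left[of "cnj (t i)" "v i" "u i" for i]
  by (auto simp: diagonal_op_def)

lemma diagonal_op_apply: "blinfun_apply (diagonal_op F t u v) x = (\<Sum>i\<in>F. (cinner (v i) x * t i) *\<^sub>C u i)"
  by (simp add: diagonal_op_def blinfun.sum_left scaleC_scaleC)

lemma diagonal_op_vector: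
  assumes "finite F" "j \<in> F" and "\<And>i j. i \<in> F \<Longrightarrow> j \<in> F \<Longrightarrow> cinner (v i) (v j) = (if i = j then 1 else 0)"
  shows "blinfun_apply (diagonal_op F t u v) (v j) = t j *\<^sub>C u j"
proof -
  have "blinfun_apply (diagonal_op F t u v) (v j) = (\<Sum>i\<in>F. if i = j then t j *\<^sub>C u j else 0)"
    unfolding diagonal_op_apply by (rule sum.cong) (auto simp: assms(2,3))
  then show ?thesis using assms(1,2) by simp
qed

lemma diagonal_op_compose:
  assumes "finite F" and "\<And>i j. i \<in> F \<Longrightarrow> j \<in> F \<Longrightarrow> cinner (v i) (v j) = (if i = j then 1 else 0)"
  shows "diagonal_op F t u v o\<^sub>L diagonal_op F s v w = diagonal_op F (\<lambda>i. t i * s i) u w"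
proof (rule blinfun_eqI)
  fix x
  have "blinfun_apply (diagonal_op F t u v o\<^sub>L diagonal_op F s v w) x
      = (\<Sum>i\<in>F. (cinner (w i) x * s i) *\<^sub>C blinfun_apply (diagonal_op F t u v) (v i))"
    unfolding blinfun_apply_blinfun_compose diagonal_op_apply[of F s v w]
    by (simp add: blinfun.sum_right adjointable_scaleC diagonal_op_adjoint)
  also have "\<dots> = blinfun_apply (diagonal_op F (\<lambda>i. t i * s i) u w) x"
    unfolding diagonal_op_apply[of F "\<lambda>i. t i * s i"]
    by (rule sum.cong) (simp_all add: diagonal_op_vector[OF assms(1) _ assms(2)] scaleC_scaleC mult_ac)
  finally show "blinfun_apply (diagonal_op F t u v o\<^sub>L diagonal_op F s v w) x
      = blinfun_apply (diagonal_op F (\<lambda>i. t i * s i) u w) x" .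
qed

lemma compose_diagonal_op:
  assumes "adjointable T" and "\<And>i. i \<in> F \<Longrightarrow> blinfun_apply T (u i) = a i *\<^sub>C u i"
  shows "T o\<^sub>L diagonal_op F t u v = diagonal_op F (\<lambda>i. a i * t i) u v"
  unfolding diagonal_op_def blinfun_compose.sum_right
  by (rule sum.cong) (simp_all add: compose_outer assms adjointable_scaleC scaleC_scaleC mult.commute)

lemma diagonal_op_compose_normal:
  assumes T: "adjointable T" "normal_op T" and ev: "\<And>i. i \<in> F \<Longrightarrow> blinfun_apply T (v i) = a i *\<^sub>C v i"
  shows "diagonal_op F t u v o\<^sub>L T = diagonal_op F (\<lambda>i. a i * t i) u v"
  unfolding diagonal_op_def blinfun_compose.sum_left
  by (rule sum.cong)
     (simp_all add: outer_compose T normal_op_eigenvector_cadjoint[OF T ev] scaleC_scaleC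
       adjointable_scaleC[OF adjointable_cadjoint[OF T(1)]]
       outer_scaleC_left mult.commute)

lemma diagonal_op_diff:
  "diagonal_op F s u v - diagonal_op F t u v = diagonal_op F (\<lambda>i. s i - t i) u v"
  by (rule blinfun_eqI)
     (simp add: blinfun.diff_left diagonal_op_apply right_diff_distrib
       complex_vector.scale_left_diff_distrib sum_subtractf)

lemma diagonal_op_add:
  "diagonal_op F s u v + diagonal_op F t u v = diagonal_op F (\<lambda>i. s i + t i) u v"
  by (rule blinfun_eqI)
     (simp add: blinfun.add_left diagonal_op_apply distrib_left scaleC_add_left sum.distrib)

lemma continuous_on_diagonal_op:
  assumes "\<And>i. i \<in> F \<Longrightarrow> continuous_on X (t i)" "\<And>i. i \<in> F \<Longrightarrow> continuous_on X (u i)"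
    and "\<And>i. i \<in> F \<Longrightarrow> continuous_on X (v i)"
  shows "continuous_on X (\<lambda>x. diagonal_op F (\<lambda>i. t i x) (\<lambda>i. u i x) (\<lambda>i. v i x))"
  unfolding diagonal_op_def by (intro continuous_on_sum continuous_on_outer continuous_on_scaleC assms)

text \<open>The defects of the contraction \<open>W\<close> come from the points \<open>(s i, c i)\<close> of the unit circle, so that no square roots of
  operators have to be taken.\<close>

lemma diagonal_dilation:
  fixes s c :: "'i \<Rightarrow> real"
  assumes F: "finite F" and sc: "\<And>i. i \<in> F \<Longrightarrow> (s i)\<^sup>2 + (c i)\<^sup>2 = 1"
    and u: "\<And>i j. i \<in> F \<Longrightarrow> j \<in> F \<Longrightarrow> cinner (u i) (u j) = (if i = j then 1 else 0)"
    and v: "\<And>i j. i \<in> F \<Longrightarrow> j \<in> F \<Longrightarrow> cinner (v i) (v j) = (if i = j then 1 else 0)"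
  defines "W \<equiv> diagonal_op F (\<lambda>i. of_real (s i)) u v"
    and "D \<equiv> id_blinfun - diagonal_op F (\<lambda>i. of_real (1 - c i)) u u"
    and "D' \<equiv> id_blinfun - diagonal_op F (\<lambda>i. of_real (1 - c i)) v v"
  shows "(cadjoint W o\<^sub>L W) + (D' o\<^sub>L D') = id_blinfun"
    and "(W o\<^sub>L cadjoint W) + (D o\<^sub>L D) = id_blinfun"
    and "D o\<^sub>L W = W o\<^sub>L D'"
proof -
  have *: "(diagonal_op F (\<lambda>i. of_real (s i)) y x o\<^sub>L diagonal_op F (\<lambda>i. of_real (s i)) x y)
      + ((id_blinfun - diagonal_op F (\<lambda>i. of_real (1 - c i)) y y) o\<^sub>L
         (id_blinfun - diagonal_op F (\<lambda>i. of_real (1 - c i)) y y)) = id_blinfun"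
    if x: "\<And>i j. i \<in> F \<Longrightarrow> j \<in> F \<Longrightarrow> cinner (x i) (x j) = (if i = j then 1 else 0)"
      and y: "\<And>i j. i \<in> F \<Longrightarrow> j \<in> F \<Longrightarrow> cinner (y i) (y j) = (if i = j then 1 else 0)" for x y
  proof -
    let ?k = "\<lambda>i. complex_of_real (1 - c i)" and ?s = "\<lambda>i. complex_of_real (s i)"
    have "diagonal_op F (\<lambda>i. ?s i * ?s i + ?k i * ?k i - (?k i + ?k i)) y y = 0"
      unfolding diagonal_op_def
    proof (rule sum.neutral, rule ballI)
      fix i assume "i \<in> F"
      then have "s i * s i + (1 - c i) * (1 - c i) - ((1 - c i) + (1 - c i)) = 0"
        using sc[of i] by (simp add: power2_eq_square algebra_simps)
      then have 0: "?s i * ?s i + ?k i * ?k i - (?k i + ?k i) = 0"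
        unfolding of_real_mult[symmetric] of_real_add[symmetric] of_real_diff[symmetric] by simp
      show "outer ((?s i * ?s i + ?k i * ?k i - (?k i + ?k i)) *\<^sub>C y i) (y i) = 0"
        unfolding 0 by (rule blinfun_eqI) simp
    qed
    then have "diagonal_op F (\<lambda>i. ?s i * ?s i) y y + diagonal_op F (\<lambda>i. ?k i * ?k i) y y
        - (diagonal_op F ?k y y + diagonal_op F ?k y y) = 0"
      unfolding diagonal_op_add diagonal_op_diff .
    then show ?thesis
      by (simp only: diagonal_op_compose[OF F x] diagonal_op_compose[OF F y] blinfun_compose.diff_left
          blinfun_compose.diff_right id_compose compose_id) (simp add: algebra_simps)
  qed
  have Wa: "cadjoint W = diagonal_op F (\<lambda>i. of_real (s i)) v u"
    by (simp add: W_def diagonal_op_adjoint)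
  show "(cadjoint W o\<^sub>L W) + (D' o\<^sub>L D') = id_blinfun"
    unfolding Wa unfolding W_def D'_def by (rule *[OF u v])
  show "(W o\<^sub>L cadjoint W) + (D o\<^sub>L D) = id_blinfun"
    unfolding Wa unfolding W_def D_def by (rule *[OF v u])
  show "D o\<^sub>L W = W o\<^sub>L D'"
    unfolding W_def D_def D'_def
    by (simp only: blinfun_compose.diff_left blinfun_compose.diff_right id_compose compose_id
        diagonal_op_compose[OF F u] diagonal_op_compose[OF F v] mult.commute)
qed

text \<open>The operator \<open>D\<close> damps \<open>T\<close> by the factor \<open>c i\<close> on the eigenvector \<open>u i\<close> and is the identity on the orthogonal
  complement. Since \<open>D\<close> commutes with \<open>T\<close>, the product is compact and normal, and each of its eigenvalues is a damped
  eigenvalue \<open>a i * c i\<close> or an eigenvalue of \<open>T\<close> on the complement.\<close>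

lemma damped_normal_norm_le:
  fixes c :: "'i \<Rightarrow> real"
  assumes K: "T \<in> compact_operators" and nT: "normal_op T" and F: "finite F"
    and orth: "\<And>i j. i \<in> F \<Longrightarrow> j \<in> F \<Longrightarrow> cinner (u i) (u j) = (if i = j then 1 else 0)"
    and ev: "\<And>i. i \<in> F \<Longrightarrow> blinfun_apply T (u i) = a i *\<^sub>C u i"
    and small: "\<And>i. i \<in> F \<Longrightarrow> cmod (a i) * \<bar>c i\<bar> \<le> \<epsilon>"
    and rest: "\<And>v \<nu>. v \<noteq> 0 \<Longrightarrow> blinfun_apply T v = \<nu> *\<^sub>C v \<Longrightarrow> (\<And>i. i \<in> F \<Longrightarrow> cinner (u i) v = 0) \<Longrightarrow> cmod \<nu> \<le> \<epsilon>"
    and "0 \<le> \<epsilon>"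
  defines "D \<equiv> id_blinfun - diagonal_op F (\<lambda>i. of_real (1 - c i)) u u"
  shows "norm (T o\<^sub>L D) \<le> \<epsilon>" and "D o\<^sub>L T = T o\<^sub>L D"
proof -
  have aT: "adjointable T" using compact_operators_adjoint[OF K] by blast
  let ?G = "diagonal_op F (\<lambda>i. of_real (1 - c i)) u u"
  have G: "adjointable ?G" "cadjoint ?G = ?G" using diagonal_op_adjoint[of F "\<lambda>i. of_real (1 - c i)" u u] by auto
  have aD: "adjointable D" "cadjoint D = D"
    using G by (auto simp: D_def adjointable_diff cadjoint_diff)
  have TG: "?G o\<^sub>L T = T o\<^sub>L ?G"
    by (simp add: compose_diagonal_op[OF aT ev] diagonal_op_compose_normal[OF aT nT ev])
  then show DT: "D o\<^sub>L T = T o\<^sub>L D"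
    by (simp add: D_def blinfun_compose.diff_left blinfun_compose.diff_right)
  have "cadjoint (D o\<^sub>L T) = cadjoint (T o\<^sub>L D)" by (simp add: DT)
  then have DT': "D o\<^sub>L cadjoint T = cadjoint T o\<^sub>L D"
    using aT aD by (simp add: cadjoint_compose)
  note comm = DT[THEN arg_cong[where f = "\<lambda>R. blinfun_apply R x" for x], simplified]
    DT'[THEN arg_cong[where f = "\<lambda>R. blinfun_apply R x" for x], simplified]
    normal_op_apply[OF nT]
  have Du: "blinfun_apply D (u i) = of_real (c i) *\<^sub>C u i" if "i \<in> F" for i
    unfolding D_def using diagonal_op_vector[OF F that orth]
    by (simp add: blinfun.diff_left complex_vector.scale_left_diff_distrib)
  show "norm (T o\<^sub>L D) \<le> \<epsilon>"
  proof (rule compact_normal_norm_le)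
    show "T o\<^sub>L D \<in> compact_operators" by (rule compact_operators_compose_right[OF K aD(1)])
    show "normal_op (T o\<^sub>L D)"
      unfolding normal_op_def cadjoint_compose[OF aT aD(1)] aD(2)
      by (rule blinfun_eqI) (simp add: comm)
    show "0 \<le> \<epsilon>" by fact
    fix \<nu> assume "\<nu> \<in> Eig (T o\<^sub>L D)"
    then obtain v where v: "v \<noteq> 0" "blinfun_apply T (blinfun_apply D v) = \<nu> *\<^sub>C v" by (auto simp: Eig_def)
    show "cmod \<nu> \<le> \<epsilon>"
    proof (cases "\<exists>i\<in>F. cinner (u i) v \<noteq> 0")
      case True
      then obtain i where i: "i \<in> F" "cinner (u i) v \<noteq> 0" by blast
      have "\<nu> * cinner (u i) v = cinner (u i) (blinfun_apply T (blinfun_apply D v))"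
        by (simp add: v(2) cinner_scaleC_right)
      also have "\<dots> = cinner (blinfun_apply D (blinfun_apply (cadjoint T) (u i))) v"
        using aD aT cinner_cadjoint_left[OF aD(1)] by (simp add: cinner_cadjoint_left)
      also have "\<dots> = a i * of_real (c i) * cinner (u i) v"
        using normal_op_eigenvector_cadjoint[OF aT nT ev[OF i(1)]] Du[OF i(1)] aD(1)
        by (simp add: adjointable_scaleC cinner_scaleC_left)
      finally have "\<nu> = a i * of_real (c i)" using i(2) by simp
      then show ?thesis using small[OF i(1)] by (simp add: norm_mult)
    next
      case False
      then have "blinfun_apply D v = v"
        unfolding D_def by (simp add: blinfun.diff_left diagonal_op_apply)
      then show ?thesis using rest[of v \<nu>] v False by auto
    qed
  qed
qed

section \<open>Loops of operators\<close>

lemma loop_on_circle: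
  fixes h :: "real \<Rightarrow> 'b::real_normed_vector"
  assumes "continuous_on {0..1} h" and "h 0 = h 1"
  shows "continuous_on (sphere 0 1) (\<lambda>t. h (Arg2pi t / (2 * pi)))"
proof -
  have "homotopic_loops UNIV h h"
    using assms by (simp add: homotopic_loops_refl path_def pathfinish_def pathstart_def)
  then have "homotopic_with_canon (\<lambda>h. True) (sphere 0 1) UNIV
      (h \<circ> (\<lambda>z. Arg2pi z / (2 * pi))) (h \<circ> (\<lambda>z. Arg2pi z / (2 * pi)))"
    by (rule homotopic_loops_imp_homotopic_circlemaps)
  then show ?thesis
    using homotopic_with_imp_continuous by (fastforce simp: o_def)
qed

context simple_spectrum_loop
begin

definition large_curves :: "real \<Rightarrow> (real \<Rightarrow> complex) set" where
  "large_curves r = {l \<in> curves. \<exists>x\<in>{0..1}. r \<le> cmod (l x)}"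

lemma large_curves: "l \<in> large_curves r \<Longrightarrow> l \<in> curves" "r > 0 \<Longrightarrow> finite (large_curves r)"
  using finite_large_curves by (auto simp: large_curves_def)

text \<open>Monodromy may move a large curve to one that is not large, or conversely. The two curves share the value
  at the joint, which then has modulus below \<open>r\<close>, where \<open>\<theta>\<close> vanishes.\<close>

lemma diagonal_loop_closes:
  assumes r: "r > 0" and \<theta>: "\<And>z. cmod z < r \<Longrightarrow> \<theta> z = 0"
    and f: "\<And>l. l \<in> curves \<Longrightarrow> f l 1 = f (\<sigma> l) 0" and g: "\<And>l. l \<in> curves \<Longrightarrow> g l 1 = g (\<sigma> l) 0"
  shows "diagonal_op (large_curves r) (\<lambda>l. \<theta> (l 1)) (\<lambda>l. f l 1) (\<lambda>l. g l 1)
       = diagonal_op (large_curves r) (\<lambda>l. \<theta> (l 0)) (\<lambda>l. f l 0 :: 'a) (\<lambda>l. g l 0)"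
proof -
  let ?F = "large_curves r"
  define h where "h l = outer (\<theta> (l 0) *\<^sub>C f l 0) (g l 0)" for l
  have small: "cmod (l x) < r" if "l \<in> curves" "l \<notin> ?F" "x \<in> {0..1}" for l x
    using that by (auto simp: large_curves_def not_le)
  have h0: "h l = 0" if "cmod (l 0) < r" for l
    using \<theta>[OF that] by (simp add: h_def) (rule blinfun_eqI, simp)
  have "diagonal_op ?F (\<lambda>l. \<theta> (l 1)) (\<lambda>l. f l 1) (\<lambda>l. g l 1) = (\<Sum>l\<in>?F. h (\<sigma> l))"
    unfolding diagonal_op_def h_def
    by (rule sum.cong) (auto simp: f g monodromy(2) dest: large_curves(1))
  also have "\<dots> = (\<Sum>l\<in>\<sigma> ` ?F. h l)"
    by (subst sum.reindex) (auto intro: inj_on_subset[OF inj_on_monodromy] dest: large_curves(1) simp: o_def)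
  also have "\<dots> = (\<Sum>l\<in>\<sigma> ` ?F \<union> ?F. h l)"
  proof (rule sum.mono_neutral_left)
    show "\<forall>m\<in>\<sigma> ` ?F \<union> ?F - \<sigma> ` ?F. h m = 0"
    proof
      fix m assume m: "m \<in> \<sigma> ` ?F \<union> ?F - \<sigma> ` ?F"
      then obtain l where l: "l \<in> curves" "\<sigma> l = m" using monodromy_surj large_curves(1) by blast
      then have "l \<notin> ?F" using m by auto
      then show "h m = 0"
        using small[OF l(1), of 1] monodromy(2)[OF l(1)] l(2) by (intro h0) simp
    qed
  qed (use large_curves(2)[OF r] in auto)
  also have "\<dots> = (\<Sum>l\<in>?F. h l)"
  proof (rule sum.mono_neutral_right)
    show "\<forall>m\<in>\<sigma> ` ?F \<union> ?F - ?F. h m = 0"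
      using small monodromy(1) large_curves(1) by (auto intro!: h0)
  qed (use large_curves(2)[OF r] in auto)
  finally show ?thesis by (simp add: diagonal_op_def h_def)
qed

text \<open>The eigenvalue lies on some curve, and its eigenspace is spanned by the frame vector of that curve. So orthogonality
  to the frame vectors of all large curves means that the curve is not large.\<close>

lemma complement_eigenvalue_small:
  assumes x: "x \<in> {0..1}" and f: "eigenframe f" and v: "v \<noteq> 0" "blinfun_apply (A x) v = \<nu> *\<^sub>C v"
    and orth: "\<And>l. l \<in> large_curves r \<Longrightarrow> cinner (f l x) v = 0"
  shows "cmod \<nu> < r"
proof -
  have "\<nu> \<in> Eig (A x)" using v by (auto simp: Eig_def)
  then obtain l where l: "l \<in> curves" "l x = \<nu>" using through[OF x] by blast
  have fl: "blinfun_apply (A x) (f l x) = \<nu> *\<^sub>C f l x" "norm (f l x) = 1"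
    using f l x by (auto simp: eigenframe_def)
  then have "f l x \<noteq> 0" by auto
  then obtain c where c: "v = c *\<^sub>C f l x"
    using multiplicity_free_eigenvectors[OF simple[OF x] fl(1) _ v(2)] by blast
  have "cinner (f l x) v = c" using fl(2) by (simp add: c cinner_scaleC_right cinner_self)
  then have "l \<notin> large_curves r" using orth[of l] v(1) c by auto
  then show ?thesis using l x by (auto simp: large_curves_def not_le)
qed

lemma damped_norm_le:
  assumes x: "x \<in> {0..1}" and f: "eigenframe f" and r: "0 < r" "r \<le> \<epsilon>"
    and small: "\<And>z. cmod z * \<bar>c z\<bar> \<le> \<epsilon>"
  defines "D \<equiv> id_blinfun - diagonal_op (large_curves r) (\<lambda>l. of_real (1 - c (l x))) (\<lambda>l. f l x) (\<lambda>l. f l x)"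
  shows "norm (A x o\<^sub>L D) \<le> \<epsilon>" and "D o\<^sub>L A x = A x o\<^sub>L D"
proof -
  have rest: "cmod \<nu> \<le> \<epsilon>" if "v \<noteq> 0" "blinfun_apply (A x) v = \<nu> *\<^sub>C v"
    "\<And>l. l \<in> large_curves r \<Longrightarrow> cinner (f l x) v = 0" for v \<nu>
  proof -
    have "cmod \<nu> < r" by (rule complement_eigenvalue_small[OF x f that])
    then show ?thesis using r by simp
  qed
  have ev: "blinfun_apply (A x) (f l x) = l x *\<^sub>C f l x" if "l \<in> large_curves r" for l
    using f x large_curves(1)[OF that] by (simp add: eigenframe_def)
  have orth: "cinner (f l x) (f m x) = (if l = m then 1 else 0)"
    if "l \<in> large_curves r" "m \<in> large_curves r" for l m
    by (rule eigenframe_orthonormal[OF f _ _ x]) (use that large_curves(1) in auto)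
  show "norm (A x o\<^sub>L D) \<le> \<epsilon>" "D o\<^sub>L A x = A x o\<^sub>L D"
    unfolding D_def
    by (rule damped_normal_norm_le[OF compact[OF x] normal[OF x] large_curves(2)[OF r(1)] orth ev small rest]
        | use r in simp)+
qed

end

section \<open>Approximate unitary equivalence over the circle\<close>

lemma simple_spectrum_loopI:
  assumes A: "A \<in> compact_over e (sphere 0 1)" and n: "\<forall>t\<in>sphere 0 1. normal_op (A t)"
    and m: "\<forall>t\<in>sphere 0 1. multiplicity_free (A t)" and nz: "\<forall>t\<in>sphere 0 1. Eig (A t) \<subseteq> - {0}"
    and c1: "condition_one_circle A"
  shows "simple_spectrum_loop (\<lambda>x. A (exp (2 * of_real pi * of_real x * \<i>)))"
proof -
  have circ: "exp (2 * of_real pi * of_real x * \<i>) \<in> sphere 0 1" for x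
    by (simp add: norm_exp_eq_Re)
  show ?thesis
  proof
    show "continuous_on {0..1} (\<lambda>x. A (exp (2 * of_real pi * of_real x * \<i>)))"
      by (rule continuous_on_compose2[OF compact_over_continuous[OF A]])
         (use circ in \<open>auto intro!: continuous_intros\<close>)
    fix x :: real
    show "A (exp (2 * of_real pi * of_real x * \<i>)) \<in> compact_operators"
      by (rule compact_over_pointwise[OF A circ])
    show "normal_op (A (exp (2 * of_real pi * of_real x * \<i>)))"
      "multiplicity_free (A (exp (2 * of_real pi * of_real x * \<i>)))"
      "0 \<notin> Eig (A (exp (2 * of_real pi * of_real x * \<i>)))"
      using n m nz circ[of x] by blast+
    fix \<mu> assume x: "x \<in> {0..1}" and mu: "\<mu> \<in> Eig (A (exp (2 * of_real pi * of_real x * \<i>)))"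
    obtain l where l: "continuous_on {0..1} l" "l x = \<mu>"
        "\<And>x. x \<in> {0..1} \<Longrightarrow> l x \<in> Eig (A (exp (2 * of_real pi * of_real x * \<i>)))"
      using c1 x mu unfolding condition_one_circle_def condition_one_interval_def by meson
    define l' where "l' y = (if y \<in> {0..1} then l y else 0)" for y
    have "continuous_on {0..1} l'"
      using l(1) by (rule continuous_on_eq) (simp add: l'_def)
    then have "l' \<in> eigenvalue_curves (\<lambda>x. Eig (A (exp (2 * of_real pi * of_real x * \<i>))))"
      using l(3) by (auto simp: eigenvalue_curves_def l'_def)
    moreover have "l' x = \<mu>" using x l(2) by (simp add: l'_def)
    ultimately show "\<exists>l\<in>eigenvalue_curves (\<lambda>x. Eig (A (exp (2 * of_real pi * of_real x * \<i>)))). l x = \<mu>"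
      by blast
  next
    show "A (exp (2 * of_real pi * of_real 0 * \<i>)) = A (exp (2 * of_real pi * of_real 1 * \<i>))"
      by (simp add: exp_two_pi_i)
  qed
qed

lemma circle_parameter:
  assumes "t \<in> sphere 0 (1::real)"
  defines "x \<equiv> Arg2pi t / (2 * pi)"
  shows "x \<in> {0..1}" and "exp (2 * of_real pi * of_real x * \<i>) = t"
proof -
  show "x \<in> {0..1}"
    unfolding x_def using Arg2pi[of t] by simp
  show "exp (2 * of_real pi * of_real x * \<i>) = t"
    using complex_norm_eq_1_exp[of t] assms by (simp add: x_def mult.commute)
qed

text \<open>Sine and cosine of an angle that grows from \<open>0\<close> to \<open>pi / 2\<close> while the modulus grows from \<open>\<epsilon> / 2\<close> to \<open>\<epsilon>\<close>.\<close>

lemma cutoff_pair: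
  assumes "0 < \<epsilon>"
  obtains s c :: "complex \<Rightarrow> real" where "continuous_on UNIV s" and "continuous_on UNIV c"
    and "\<And>z. (s z)\<^sup>2 + (c z)\<^sup>2 = 1" and "\<And>z. cmod z < \<epsilon> / 2 \<Longrightarrow> s z = 0 \<and> c z = 1"
    and "\<And>z. cmod z * \<bar>c z\<bar> \<le> \<epsilon>"
proof -
  define a where "a z = pi / 2 * max 0 (min 1 (2 * cmod z / \<epsilon> - 1))" for z
  have cont: "continuous_on UNIV a"
    unfolding a_def using assms by (intro continuous_intros) auto
  show ?thesis
  proof (rule that[of "\<lambda>z. sin (a z)" "\<lambda>z. cos (a z)"])
    show "continuous_on UNIV (\<lambda>z. sin (a z))" "continuous_on UNIV (\<lambda>z. cos (a z))"
      by (intro continuous_intros cont)+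
    show "sin (a z) = 0 \<and> cos (a z) = 1" if "cmod z < \<epsilon> / 2" for z
    proof -
      have "2 * cmod z / \<epsilon> - 1 \<le> 0" using that assms by (simp add: field_simps)
      then have "a z = 0" by (simp add: a_def)
      then show ?thesis by simp
    qed
    show "cmod z * \<bar>cos (a z)\<bar> \<le> \<epsilon>" for z
    proof (cases "cmod z \<le> \<epsilon>")
      case True
      then show ?thesis using mult_mono[OF True abs_cos_le_one[of "a z"]] assms by simp
    next
      case False
      then have "1 \<le> 2 * cmod z / \<epsilon> - 1" using assms by (simp add: field_simps)
      then have "a z = pi / 2" by (simp add: a_def)
      then show ?thesis using assms by (simp only: cos_pi_half)
    qed
  qed simp
qed

theorem corollary3p12:
  fixes e :: "nat \<Rightarrow> 'h::complex_hilbert_space"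
    and A B :: "complex \<Rightarrow> 'h \<Rightarrow>\<^sub>L 'h"
  assumes "orthonormal_basis e"
    and "A \<in> compact_over e (sphere 0 1)" and "B \<in> compact_over e (sphere 0 1)"
    and "\<forall>t\<in>sphere 0 1. normal_op (A t)" and "\<forall>t\<in>sphere 0 1. normal_op (B t)"
    and "\<forall>t\<in>sphere 0 1. multiplicity_free (A t)" and "\<forall>t\<in>sphere 0 1. multiplicity_free (B t)"
    and "\<forall>t\<in>sphere 0 1. Eig (A t) = Eig (B t) \<and> Eig (A t) \<subseteq> - {0}"
    and "condition_one_circle A" and "condition_one_circle B"
  shows "approx_unitarily_equivalent e (sphere 0 1) A B"
  unfolding approx_unitarily_equivalent_def
proof (intro allI impI)
  fix \<epsilon>0 :: real assume "\<epsilon>0 > 0"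
  \<comment> \<open>the dilation argument yields the bound \<open>3 \<epsilon>\<close>, which has to be strictly below \<open>\<epsilon>0\<close>\<close>
  define \<epsilon> where "\<epsilon> = \<epsilon>0 / 4"
  have \<epsilon>: "\<epsilon> > 0" using \<open>\<epsilon>0 > 0\<close> by (simp add: \<epsilon>_def)
  define r where "r = \<epsilon> / 2"
  have r: "0 < r" "r \<le> \<epsilon>" using \<epsilon> by (auto simp: r_def)
  let ?q = "\<lambda>x. exp (2 * complex_of_real pi * complex_of_real x * \<i>)"
  define A' where "A' = (\<lambda>x. A (?q x))"
  define B' where "B' = (\<lambda>x. B (?q x))"
  interpret PA: simple_spectrum_loop A'
    unfolding A'_def by (rule simple_spectrum_loopI[of A e]) (use assms in auto)
  interpret PB: simple_spectrum_loop B'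
    unfolding B'_def by (rule simple_spectrum_loopI[of B e]) (use assms in auto)
  have circ: "?q x \<in> sphere 0 1" for x by (simp add: norm_exp_eq_Re)
  have Eig_eq: "(\<lambda>x. Eig (B' x)) = (\<lambda>x. Eig (A' x))"
    using assms(8) circ by (auto simp: A'_def B'_def)
  have large_eq: "PB.large_curves r = PA.large_curves r"
    unfolding PB.large_curves_def PA.large_curves_def Eig_eq ..
  let ?F = "PA.large_curves r"
  obtain f where f: "PA.eigenframe f" using PA.eigenframe_exists by blast
  obtain g where g: "PB.eigenframe g" using PB.eigenframe_exists by blast
  have F: "finite ?F" "\<And>l. l \<in> ?F \<Longrightarrow> l \<in> PA.curves"
    using PA.large_curves r(1) by auto
  have F_B: "\<And>l. l \<in> ?F \<Longrightarrow> l \<in> PB.curves" using F(2) by (simp add: Eig_eq)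
  have f_orth: "cinner (f l x) (f m x) = (if l = m then 1 else 0)"
    if "l \<in> ?F" "m \<in> ?F" "x \<in> {0..1}" for l m x
    using PA.eigenframe_orthonormal[OF f] F(2) that by blast
  have g_orth: "cinner (g l x) (g m x) = (if l = m then 1 else 0)"
    if "l \<in> ?F" "m \<in> ?F" "x \<in> {0..1}" for l m x
    using PB.eigenframe_orthonormal[OF g] F_B that by blast
  have f_cont: "continuous_on {0..1} (f l)" and f_close: "f l 1 = f (PA.\<sigma> l) 0" if "l \<in> PA.curves" for l
    using f that by (auto simp: PA.eigenframe_def)
  have g_cont: "continuous_on {0..1} (g l)" and g_close: "g l 1 = g (PA.\<sigma> l) 0" if "l \<in> PA.curves" for l
    using g that by (auto simp: PB.eigenframe_def Eig_eq)
  obtain s c :: "complex \<Rightarrow> real" where s: "continuous_on UNIV s" and c: "continuous_on UNIV c"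
    and sc: "\<And>z. (s z)\<^sup>2 + (c z)\<^sup>2 = 1" and low: "\<And>z. cmod z < \<epsilon> / 2 \<Longrightarrow> s z = 0 \<and> c z = 1"
    and damp: "\<And>z. cmod z * \<bar>c z\<bar> \<le> \<epsilon>"
    using cutoff_pair[OF \<epsilon>] by metis
  \<comment> \<open>\<open>G s f g\<close> is the damped intertwiner, \<open>1 - G k f f\<close> and \<open>1 - G k g g\<close> with \<open>k = 1 - c\<close> are its defects\<close>
  define G where "G \<theta> u v x = diagonal_op ?F (\<lambda>l. complex_of_real (\<theta> (l x))) (\<lambda>l. u l x) (\<lambda>l. v l x)"
    for \<theta> :: "complex \<Rightarrow> real" and u v :: "(real \<Rightarrow> complex) \<Rightarrow> real \<Rightarrow> 'h" and x
  define par where "par t = Arg2pi t / (2 * pi)" for t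
  have G_over: "(\<lambda>t. G \<theta> u v (par t)) \<in> compact_over e (sphere 0 1)"
    if \<theta>: "continuous_on UNIV \<theta>" "\<And>z. cmod z < r \<Longrightarrow> \<theta> z = 0"
      and u: "\<And>l. l \<in> PA.curves \<Longrightarrow> continuous_on {0..1} (u l)" "\<And>l. l \<in> PA.curves \<Longrightarrow> u l 1 = u (PA.\<sigma> l) 0"
      and v: "\<And>l. l \<in> PA.curves \<Longrightarrow> continuous_on {0..1} (v l)" "\<And>l. l \<in> PA.curves \<Longrightarrow> v l 1 = v (PA.\<sigma> l) 0"
    for \<theta> u v
  proof -
    have "continuous_on {0..1} (G \<theta> u v)"
      unfolding G_def
    proof (intro continuous_on_diagonal_op u v F(2))
      fix l assume "l \<in> ?F"
      then have "continuous_on {0..1} (\<lambda>x. \<theta> (l x))"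
        by (intro continuous_on_compose2[OF \<theta>(1)] PA.curve_cont F(2)) auto
      then show "continuous_on {0..1} (\<lambda>x. complex_of_real (\<theta> (l x)))"
        by (intro continuous_intros)
    qed
    moreover have "G \<theta> u v 0 = G \<theta> u v 1"
      unfolding G_def
      using PA.diagonal_loop_closes[OF r(1), of "\<lambda>z. complex_of_real (\<theta> z)" u v] \<theta>(2) u(2) v(2) by simp
    ultimately have "continuous_on (sphere 0 1) (\<lambda>t. G \<theta> u v (par t))"
      unfolding par_def by (rule loop_on_circle)
    moreover have "G \<theta> u v x \<in> compact_operators" for x
      unfolding G_def by (rule diagonal_op_compact)
    ultimately show ?thesis
      by (simp add: compact_over_iff[OF compact_sphere assms(1)])
  qed
  have G_adj: "cadjoint (G \<theta> u u x) = G \<theta> u u x" for \<theta> u x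
    by (simp add: G_def diagonal_op_adjoint)
  define k where "k z = 1 - c z" for z
  have k: "continuous_on UNIV k" unfolding k_def by (intro continuous_intros c)
  have par: "par t \<in> {0..1}" and A_par: "A t = A' (par t)" and B_par: "B t = B' (par t)"
    if "t \<in> sphere 0 1" for t
    using circle_parameter[OF that] by (simp_all add: par_def A'_def B'_def)
  have dil: "(cadjoint (G s f g x) o\<^sub>L G s f g x) + ((id_blinfun - G k g g x) o\<^sub>L (id_blinfun - G k g g x)) = id_blinfun"
    "(G s f g x o\<^sub>L cadjoint (G s f g x)) + ((id_blinfun - G k f f x) o\<^sub>L (id_blinfun - G k f f x)) = id_blinfun"
    "(id_blinfun - G k f f x) o\<^sub>L G s f g x = G s f g x o\<^sub>L (id_blinfun - G k g g x)" if x: "x \<in> {0..1}" for x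
    unfolding G_def k_def
    by (rule diagonal_dilation[OF F(1), of "\<lambda>l. s (l x)" "\<lambda>l. c (l x)" "\<lambda>l. f l x" "\<lambda>l. g l x"];
        use sc f_orth g_orth x in simp)+
  have AW: "A' x o\<^sub>L G s f g x = G s f g x o\<^sub>L B' x" if x: "x \<in> {0..1}" for x
  proof -
    have fA: "blinfun_apply (A' x) (f l x) = l x *\<^sub>C f l x" if "l \<in> ?F" for l
      using f F(2)[OF that] x by (simp add: PA.eigenframe_def)
    have gB: "blinfun_apply (B' x) (g l x) = l x *\<^sub>C g l x" if "l \<in> ?F" for l
      using g F_B[OF that] x by (simp add: PB.eigenframe_def)
    show ?thesis
      unfolding G_def
      by (simp add: compose_diagonal_op[where u = "\<lambda>l. f l x" and a = "\<lambda>l. l x", OF PA.adj[OF x] fA]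
          diagonal_op_compose_normal[where v = "\<lambda>l. g l x" and a = "\<lambda>l. l x", OF PB.adj[OF x] PB.normal[OF x] gB])
  qed
  have AD: "norm (A' x o\<^sub>L (id_blinfun - G k f f x)) \<le> \<epsilon>" if "x \<in> {0..1}" for x
    unfolding G_def k_def by (rule PA.damped_norm_le(1)[OF that f r damp])
  have DB: "norm ((id_blinfun - G k g g x) o\<^sub>L B' x) \<le> \<epsilon>" if "x \<in> {0..1}" for x
    unfolding G_def k_def
    using PB.damped_norm_le[OF that g r damp, unfolded large_eq] by simp
  have "\<exists>U. continuous_on (sphere 0 1) U \<and> (\<lambda>t. U t - id_blinfun) \<in> compact_over e (sphere 0 1) \<and>
      (\<forall>t\<in>sphere 0 1. unitary_op (U t)) \<and>
      (\<forall>t\<in>sphere 0 1. norm (B t - (cadjoint (U t) o\<^sub>L A t o\<^sub>L U t)) \<le> 3 * \<epsilon>)"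
  proof (rule unitary_from_intertwiner[OF compact_sphere assms(1) \<epsilon> assms(2,3),
        of "\<lambda>t. G s f g (par t)" "\<lambda>t. G k f f (par t)" "\<lambda>t. G k g g (par t)"])
    show "(\<lambda>t. G s f g (par t)) \<in> compact_over e (sphere 0 1)"
      by (rule G_over[OF s]) (use low f_cont f_close g_cont g_close in \<open>auto simp: r_def\<close>)
    show "(\<lambda>t. G k f f (par t)) \<in> compact_over e (sphere 0 1)"
      by (rule G_over[OF k]) (use low f_cont f_close in \<open>auto simp: r_def k_def\<close>)
    show "(\<lambda>t. G k g g (par t)) \<in> compact_over e (sphere 0 1)"
      by (rule G_over[OF k]) (use low g_cont g_close in \<open>auto simp: r_def k_def\<close>)
  qed (use G_adj dil par A_par B_par AW AD DB in auto)
  moreover have "3 * \<epsilon> < \<epsilon>0" using \<open>\<epsilon>0 > 0\<close> by (simp add: \<epsilon>_def)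
  ultimately show "\<exists>U. continuous_on (sphere 0 1) U \<and> (\<lambda>t. U t - id_blinfun) \<in> compact_over e (sphere 0 1) \<and>
      (\<forall>t\<in>sphere 0 1. unitary_op (U t)) \<and>
      (\<forall>t\<in>sphere 0 1. norm (B t - (cadjoint (U t) o\<^sub>L A t o\<^sub>L U t)) < \<epsilon>0)"
    by (meson order_le_less_trans)
qed

end
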